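(* Let $\Omega\subset\mathbb{R}^n$ be a bounded $H^1$-Sobolev admissible domain, with associated Borel measure $\mu$ on $\partial\Omega$, and let $a>0$. The weak eigenvalue problem $$\forall v\in H^1(\Omega)\qquad (u,v)_{\mathrm{Tr}}=\lambda\,(u,v)_{L_2(\Omega)}$$ has a countable number of strictly positive eigenvalues of finite multiplicity, which can be numbered in non-decreasing order: $$0<\lambda_1\le\lambda_2\le\lambda_3\le\cdots,\qquad \lambda_j\to+\infty\ \text{ as } j\to+\infty.$$ In addition, the corresponding eigenfunctions form an orthonormal basis of $L^2(\Omega)$ and an orthogonal basis of $H^1(\Omega)$ (endowed with the inner product $(\cdot,\cdot)_{\mathrm{Tr}}$).
   Context: For $a>0$, $H^1(\Omega)=W^1_2(\Omega)$ is endowed with the norm $\|u\|_{\mathrm{Tr}}^2=(u,u)_{\mathrm{Tr}}$, where $$(u,v)_{\mathrm{Tr}}=\int_\Omega\nabla u\cdot\nabla v\,dx+a\int_{\partial\Omega}\mathrm{Tr}_{\partial\Omega}u\,\mathrm{Tr}_{\partial\Omega}v\,d\mu .$$ Notation: $B_r(x)$ is the open Euclidean ball in $\mathbb{R}^n$, $\lambda(A)$ is the Lebesgue measure of a set $A$ (not to be confused with the eigenvalue $\lambda$). Conditions on a Borel measure $\mu$ on $\mathbb{R}^n$ with support $F$: - $D_s$-condition ($0<s\le n$): there is $c_s>0$ with $\mu(B_{\kappa r}(x))\le c_s\kappa^s\mu(B_r(x))$ for all $x\in F$, $r>0$, $\kappa\ge1$, $0<\kappa r\le 1$. - $L_d$-condition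 ($0\le d\le n$): there is $c_d>0$ with $\mu(B_{\kappa r}(x))\ge c_d\kappa^d\mu(B_r(x))$ for all $x\in F$, $r>0$, $\kappa\ge1$, $0<\kappa r\le 1$. - Normalization condition: there are constants $c_1,c_2>0$ with $c_1\le\mu(B_1(x))\le c_2$ for all $x\in F$. An $n$-set is a set $\Omega\subset\mathbb{R}^n$ for which there is $c>0$ with $\lambda(B_r(x)\cap\Omega)\ge c\,r^n$ for all $x\in\Omega$, $0<r\le1$. For $\Omega$ of positive Lebesgue measure, $C^1_2(\Omega)$ is the space of $f\in L_2(\Omega)$ such that $$f^\sharp_{1,\Omega}(x)=\sup_{r>0}r^{-1}\inf_{P\in\mathbb{R}}\frac1{\lambda(B_r(x))}\int_{B_r(x)\cap\Omega}|f-P|\,dy$$ belongs to $L_2(\Omega)$, with norm $\|f\|_{L_2(\Omega)}+\|f^\sharp_{1,\Omega}\|_{L_2(\Omega)}$. A domain $\Omega\subset\mathbb{R}^n$ is called $H^1$-Sobolev admissible if it is an $n$-set, $H^1(\Omega)=C^1_2(\Omega)$ as sets with equivalent norms (hence $\Omega$ is an $H^1$-extension domain, i.e. there is a bounded linear extension operator $H^1(\Omega)\to H^1(\mathbb{R}^n)$), and its closed boundary $\partial\Omega$ is the support of a Borel measure $\mu$ satisfying the $D_s$-, $L_d$- and normalization conditions for some $0\le d\le n$, $d\le s\le n$, $s>0$ with $\frac{n-d}{2}<1<1+\frac{n-s}{2}$. The trace of $u\in L_1^{loc}(\Omega)$ is $\mathrm{Tr}_{\partial\Omega}u(x)=\lim_{r\to0}\frac{1}{\lambda(\Omega\cap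 B_r(x))}\int_{\Omega\cap B_r(x)}u(y)\,dy$ at all $x\in\partial\Omega$ where the limit exists, considered as a $\mu$-class. *)

theory Defs
  imports "HOL-Analysis.Analysis"
begin

text \<open>Elements of the function spaces below are functions rather than classes modulo
  null sets, so each of these sets is closed under almost-everywhere modification on \<open>\<Omega>\<close>,
  and uniqueness, linear independence and spanning are understood almost everywhere.
  The space \<open>\<real>\<^sup>n\<close> is a type \<open>'a::euclidean_space\<close> with \<open>n = DIM('a)\<close>.\<close>

definition domain :: "'a::euclidean_space set \<Rightarrow> bool" where
  "domain \<Omega> \<longleftrightarrow> open \<Omega> \<and> connected \<Omega> \<and> \<Omega> \<noteq> {}"


subsection \<open>Square integrable functions and weak gradients\<close>

definition L2 :: "'a::euclidean_space set \<Rightarrow> ('a \<Rightarrow> real) set" where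
  "L2 \<Omega> = {f. f \<in> borel_measurable (lebesgue_on \<Omega>) \<and> integrable (lebesgue_on \<Omega>) (\<lambda>x. (f x)\<^sup>2)}"

definition L2_inner :: "'a::euclidean_space set \<Rightarrow> ('a \<Rightarrow> real) \<Rightarrow> ('a \<Rightarrow> real) \<Rightarrow> real" where
  "L2_inner \<Omega> f g = (LINT x|lebesgue_on \<Omega>. f x * g x)"

definition L2_norm :: "'a::euclidean_space set \<Rightarrow> ('a \<Rightarrow> real) \<Rightarrow> real" where
  "L2_norm \<Omega> f = sqrt (L2_inner \<Omega> f f)"

fun C_k :: "nat \<Rightarrow> ('a::euclidean_space \<Rightarrow> real) \<Rightarrow> bool" where
  "C_k 0 \<phi> \<longleftrightarrow> continuous_on UNIV \<phi>"
| "C_k (Suc k) \<phi> \<longleftrightarrow> \<phi> differentiable_on UNIV \<and>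
     (\<forall>b\<in>Basis. C_k k (\<lambda>x. frechet_derivative \<phi> (at x) b))"

definition test_functions :: "'a::euclidean_space set \<Rightarrow> ('a \<Rightarrow> real) set" where
  "test_functions \<Omega> = {\<phi>. (\<forall>k. C_k k \<phi>) \<and>
     compact (closure {x. \<phi> x \<noteq> 0}) \<and> closure {x. \<phi> x \<noteq> 0} \<subseteq> \<Omega>}"

definition locally_integrable ::
    "'a::euclidean_space set \<Rightarrow> ('a \<Rightarrow> 'b::euclidean_space) \<Rightarrow> bool" where
  "locally_integrable \<Omega> f \<longleftrightarrow> (\<forall>K. compact K \<and> K \<subseteq> \<Omega> \<longrightarrow> f absolutely_integrable_on K)"

definition has_weak_gradient ::
    "'a::euclidean_space set \<Rightarrow> ('a \<Rightarrow> real) \<Rightarrow> ('a \<Rightarrow> 'a) \<Rightarrow> bool" where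
  "has_weak_gradient \<Omega> u g \<longleftrightarrow> locally_integrable \<Omega> u \<and> locally_integrable \<Omega> g \<and>
     (\<forall>\<phi>\<in>test_functions \<Omega>. \<forall>b\<in>Basis.
        (LINT x|lebesgue_on \<Omega>. u x * frechet_derivative \<phi> (at x) b)
        = - (LINT x|lebesgue_on \<Omega>. (g x \<bullet> b) * \<phi> x))"

definition has_L2_gradient ::
    "'a::euclidean_space set \<Rightarrow> ('a \<Rightarrow> real) \<Rightarrow> ('a \<Rightarrow> 'a) \<Rightarrow> bool" where
  "has_L2_gradient \<Omega> u g \<longleftrightarrow> has_weak_gradient \<Omega> u g \<and> (\<forall>b\<in>Basis. (\<lambda>x. g x \<bullet> b) \<in> L2 \<Omega>)"

definition H1 :: "'a::euclidean_space set \<Rightarrow> ('a \<Rightarrow> real) set" where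
  "H1 \<Omega> = {u \<in> L2 \<Omega>. \<exists>g. has_L2_gradient \<Omega> u g}"

text \<open>A weak gradient is unique up to a null set; any representative may be chosen.\<close>

definition weak_grad :: "'a::euclidean_space set \<Rightarrow> ('a \<Rightarrow> real) \<Rightarrow> 'a \<Rightarrow> 'a" where
  "weak_grad \<Omega> u = (SOME g. has_L2_gradient \<Omega> u g)"

definition grad_inner :: "'a::euclidean_space set \<Rightarrow> ('a \<Rightarrow> real) \<Rightarrow> ('a \<Rightarrow> real) \<Rightarrow> real" where
  "grad_inner \<Omega> u v = (LINT x|lebesgue_on \<Omega>. weak_grad \<Omega> u x \<bullet> weak_grad \<Omega> v x)"

definition H1_norm :: "'a::euclidean_space set \<Rightarrow> ('a \<Rightarrow> real) \<Rightarrow> real" where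
  "H1_norm \<Omega> u = sqrt (L2_inner \<Omega> u u + grad_inner \<Omega> u u)"


subsection \<open>The space \<open>C\<^sup>1\<^sub>2(\<Omega>)\<close>\<close>

definition sharp_maximal ::
    "'a::euclidean_space set \<Rightarrow> ('a \<Rightarrow> real) \<Rightarrow> 'a \<Rightarrow> ennreal" where
  "sharp_maximal \<Omega> f x = (SUP r\<in>{0<..}. (INF P\<in>(UNIV::real set).
      (\<integral>\<^sup>+ y. ennreal \<bar>f y - P\<bar> \<partial>lebesgue_on (ball x r \<inter> \<Omega>)) / emeasure lebesgue (ball x r))
      / ennreal r)"

definition C12 :: "'a::euclidean_space set \<Rightarrow> ('a \<Rightarrow> real) set" where
  "C12 \<Omega> = {f \<in> L2 \<Omega>. sharp_maximal \<Omega> f \<in> borel_measurable (lebesgue_on \<Omega>) \<and>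
     (\<integral>\<^sup>+ x. (sharp_maximal \<Omega> f x)\<^sup>2 \<partial>lebesgue_on \<Omega>) < \<infinity>}"

definition C12_norm :: "'a::euclidean_space set \<Rightarrow> ('a \<Rightarrow> real) \<Rightarrow> real" where
  "C12_norm \<Omega> f = L2_norm \<Omega> f
     + sqrt (enn2real (\<integral>\<^sup>+ x. (sharp_maximal \<Omega> f x)\<^sup>2 \<partial>lebesgue_on \<Omega>))"


subsection \<open>Conditions on the boundary measure\<close>

definition measure_support :: "'a::topological_space measure \<Rightarrow> 'a set" where
  "measure_support \<mu> = {x. \<forall>U. open U \<and> x \<in> U \<longrightarrow> emeasure \<mu> U > 0}"

definition D_condition :: "real \<Rightarrow> 'a::euclidean_space measure \<Rightarrow> bool" where
  "D_condition s \<mu> \<longleftrightarrow> (\<exists>c>0. \<forall>x\<in>measure_support \<mu>. \<forall>r>0. \<forall>\<kappa>\<ge>1. \<kappa> * r \<le> 1 \<longrightarrow>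
     emeasure \<mu> (ball x (\<kappa> * r)) \<le> ennreal (c * \<kappa> powr s) * emeasure \<mu> (ball x r))"

definition L_condition :: "real \<Rightarrow> 'a::euclidean_space measure \<Rightarrow> bool" where
  "L_condition d \<mu> \<longleftrightarrow> (\<exists>c>0. \<forall>x\<in>measure_support \<mu>. \<forall>r>0. \<forall>\<kappa>\<ge>1. \<kappa> * r \<le> 1 \<longrightarrow>
     emeasure \<mu> (ball x (\<kappa> * r)) \<ge> ennreal (c * \<kappa> powr d) * emeasure \<mu> (ball x r))"

definition normalization_condition :: "'a::euclidean_space measure \<Rightarrow> bool" where
  "normalization_condition \<mu> \<longleftrightarrow> (\<exists>c1>0. \<exists>c2>0. \<forall>x\<in>measure_support \<mu>.
     ennreal c1 \<le> emeasure \<mu> (ball x 1) \<and> emeasure \<mu> (ball x 1) \<le> ennreal c2)"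

definition admissible_boundary_measure ::
    "'a::euclidean_space set \<Rightarrow> 'a measure \<Rightarrow> bool" where
  "admissible_boundary_measure \<Omega> \<mu> \<longleftrightarrow>
     sets \<mu> = sets borel \<and> measure_support \<mu> = frontier \<Omega> \<and>
     (\<exists>d s. 0 \<le> d \<and> d \<le> real DIM('a) \<and> d \<le> s \<and> s \<le> real DIM('a) \<and> 0 < s \<and>
        (real DIM('a) - d) / 2 < 1 \<and> 1 < 1 + (real DIM('a) - s) / 2 \<and>
        D_condition s \<mu> \<and> L_condition d \<mu>) \<and>
     normalization_condition \<mu>"


subsection \<open>Sobolev admissible domains\<close>

definition n_set :: "'a::euclidean_space set \<Rightarrow> bool" where
  "n_set \<Omega> \<longleftrightarrow> (\<exists>c>0. \<forall>x\<in>\<Omega>. \<forall>r. 0 < r \<and> r \<le> 1 \<longrightarrow>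
     emeasure lebesgue (ball x r \<inter> \<Omega>) \<ge> ennreal (c * r ^ DIM('a)))"

definition H1_Sobolev_admissible :: "'a::euclidean_space set \<Rightarrow> bool" where
  "H1_Sobolev_admissible \<Omega> \<longleftrightarrow> domain \<Omega> \<and> n_set \<Omega> \<and>
     H1 \<Omega> = C12 \<Omega> \<and>
     (\<exists>c>0. \<exists>C>0. \<forall>u\<in>H1 \<Omega>. c * H1_norm \<Omega> u \<le> C12_norm \<Omega> u \<and> C12_norm \<Omega> u \<le> C * H1_norm \<Omega> u) \<and>
     (\<exists>\<mu>. admissible_boundary_measure \<Omega> \<mu>)"


subsection \<open>The trace and the trace inner product\<close>

definition ball_average :: "'a::euclidean_space set \<Rightarrow> ('a \<Rightarrow> real) \<Rightarrow> 'a \<Rightarrow> real \<Rightarrow> real" where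
  "ball_average \<Omega> u x r =
     (LINT y|lebesgue_on (\<Omega> \<inter> ball x r). u y) / measure lebesgue (\<Omega> \<inter> ball x r)"

text \<open>The value \<open>0\<close> at points where the limit does not exist is a dummy; for
  \<open>u \<in> H1 \<Omega>\<close> on a bounded admissible domain these points form a null set of the boundary measure.\<close>

definition boundary_trace :: "'a::euclidean_space set \<Rightarrow> ('a \<Rightarrow> real) \<Rightarrow> 'a \<Rightarrow> real" where
  "boundary_trace \<Omega> u x =
     (if \<exists>l. (ball_average \<Omega> u x \<longlongrightarrow> l) (at_right 0) then Lim (at_right 0) (ball_average \<Omega> u x) else 0)"

definition Tr_inner ::
    "'a::euclidean_space set \<Rightarrow> 'a measure \<Rightarrow> real \<Rightarrow> ('a \<Rightarrow> real) \<Rightarrow> ('a \<Rightarrow> real) \<Rightarrow> real" where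
  "Tr_inner \<Omega> \<mu> a u v = grad_inner \<Omega> u v
     + a * (LINT x:frontier \<Omega>|\<mu>. boundary_trace \<Omega> u x * boundary_trace \<Omega> v x)"


subsection \<open>The weak eigenvalue problem\<close>

definition eigenspace ::
    "'a::euclidean_space set \<Rightarrow> 'a measure \<Rightarrow> real \<Rightarrow> real \<Rightarrow> ('a \<Rightarrow> real) set" where
  "eigenspace \<Omega> \<mu> a lam = {u \<in> H1 \<Omega>. \<forall>v\<in>H1 \<Omega>. Tr_inner \<Omega> \<mu> a u v = lam * L2_inner \<Omega> u v}"

definition eigenfunction ::
    "'a::euclidean_space set \<Rightarrow> 'a measure \<Rightarrow> real \<Rightarrow> real \<Rightarrow> ('a \<Rightarrow> real) \<Rightarrow> bool" where
  "eigenfunction \<Omega> \<mu> a lam u \<longleftrightarrow> u \<in> eigenspace \<Omega> \<mu> a lam \<and> \<not> (AE x in lebesgue_on \<Omega>. u x = 0)"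

definition eigenvalue :: "'a::euclidean_space set \<Rightarrow> 'a measure \<Rightarrow> real \<Rightarrow> real \<Rightarrow> bool" where
  "eigenvalue \<Omega> \<mu> a lam \<longleftrightarrow> (\<exists>u. eigenfunction \<Omega> \<mu> a lam u)"

text \<open>The eigenspace, modulo functions vanishing almost everywhere on \<open>\<Omega>\<close>, has dimension \<open>m\<close>.\<close>

definition has_multiplicity ::
    "'a::euclidean_space set \<Rightarrow> 'a measure \<Rightarrow> real \<Rightarrow> real \<Rightarrow> nat \<Rightarrow> bool" where
  "has_multiplicity \<Omega> \<mu> a lam m \<longleftrightarrow> (\<exists>e :: nat \<Rightarrow> 'a \<Rightarrow> real.
     (\<forall>i<m. e i \<in> eigenspace \<Omega> \<mu> a lam) \<and>
     (\<forall>c :: nat \<Rightarrow> real. (AE x in lebesgue_on \<Omega>. (\<Sum>i<m. c i * e i x) = 0) \<longrightarrow> (\<forall>i<m. c i = 0)) \<and>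
     (\<forall>u\<in>eigenspace \<Omega> \<mu> a lam. \<exists>c :: nat \<Rightarrow> real.
        AE x in lebesgue_on \<Omega>. u x = (\<Sum>i<m. c i * e i x)))"


subsection \<open>Orthogonal bases of function spaces\<close>

text \<open>Here \<open>X\<close> is a space of functions with inner product \<open>ip\<close>; convergence of the expansion
  is convergence in the norm induced by \<open>ip\<close>.\<close>

definition orthogonal_basis ::
    "('a \<Rightarrow> real) set \<Rightarrow> (('a \<Rightarrow> real) \<Rightarrow> ('a \<Rightarrow> real) \<Rightarrow> real) \<Rightarrow> (nat \<Rightarrow> 'a \<Rightarrow> real) \<Rightarrow> bool" where
  "orthogonal_basis X ip w \<longleftrightarrow>
     (\<forall>j. w j \<in> X \<and> ip (w j) (w j) > 0) \<and>
     (\<forall>i j. i \<noteq> j \<longrightarrow> ip (w i) (w j) = 0) \<and>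
     (\<forall>f\<in>X. \<exists>c :: nat \<Rightarrow> real.
        (\<lambda>N. let h = (\<lambda>x. f x - (\<Sum>i<N. c i * w i x)) in sqrt (ip h h)) \<longlonglongrightarrow> 0)"

definition orthonormal_basis ::
    "('a \<Rightarrow> real) set \<Rightarrow> (('a \<Rightarrow> real) \<Rightarrow> ('a \<Rightarrow> real) \<Rightarrow> real) \<Rightarrow> (nat \<Rightarrow> 'a \<Rightarrow> real) \<Rightarrow> bool" where
  "orthonormal_basis X ip w \<longleftrightarrow> orthogonal_basis X ip w \<and> (\<forall>j. ip (w j) (w j) = 1)"

end

theory Submission
  imports Defs
begin

text \<open>The analytic estimates all come from the hypothesis \<open>H1 \<Omega> = C12 \<Omega>\<close>. If \<open>f\<close> is the sharp maximal
  function of \<open>u\<close>, then two averages of \<open>u\<close> over comparable balls inside \<open>B\<^sub>R(y)\<close> differ by at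
  most a constant times \<open>R f(y)\<close>, because \<open>\<Omega>\<close> is an \<open>n\<close>-set.
  For \<open>y \<in> \<Omega>\<close> the telescoping sum over dyadic radii gives \<open>\<bar>u(y) - u\<^sub>r(p)\<bar> \<le> C r f(y)\<close> for
  \<open>y \<in> B\<^sub>r(p)\<close>, where \<open>u\<^sub>r\<close> denotes the averages at radius \<open>r\<close>; covering \<open>\<Omega>\<close> by finitely
  many such balls yields compactness of the embedding into \<open>L2 \<Omega>\<close>.
  For boundary points one first averages the square of the estimate over \<open>B\<^sub>r(x) \<inter> \<Omega>\<close> and then
  integrates against \<open>\<mu>\<close>: since \<open>\<mu>(B\<^sub>r(x)) \<le> C r\<^sup>d\<close> with \<open>d > n - 2\<close>, the increments of the
  averages decay geometrically in \<open>L2(\<mu>)\<close>, so the trace exists almost everywhere and is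
  bounded. A function of vanishing energy is constant by connectedness and vanishes because its
  trace does, and the eigenfunctions are obtained by minimising the Rayleigh quotient
  successively on \<open>L2\<close>-orthogonal complements.\<close>

section \<open>Positive semidefinite forms on spaces of functions\<close>

text \<open>Since the spaces consist of functions and not of classes, both forms are only
  semidefinite, and neither \<open>weak_grad\<close> nor \<open>boundary_trace\<close> is linear
  pointwise. The abstract part therefore works with two semidefinite forms having the same null
  vectors; bilinearity of the concrete forms is proved almost everywhere, from uniqueness of weak
  gradients and from existence of the trace limits. No quotient space and no solution operator is
  formed. The condition d > n - 2 enters by counting powers: squared increments of averages at
  radius r carry r^2 from the sharp maximal estimate, r^(-n) from averaging over a ball of volume
  comparable to r^n, and r^d from integrating against the boundary measure. The total exponent d -
  (n - 2) is positive; half of it is spent on making one majorant dominate all scales at once, the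
  other half on summing that majorant. Completeness of the eigenfunctions in
  \<open>L2 \<Omega>\<close> is not contained in the abstract theorem, which only expands elements
  of the energy space; it is recovered from the fact that test functions lie in
  \<open>H1 \<Omega>\<close>.\<close>

locale psd_form =
  fixes V :: "('x \<Rightarrow> real) set" and B :: "('x \<Rightarrow> real) \<Rightarrow> ('x \<Rightarrow> real) \<Rightarrow> real"
  assumes zero_mem: "(\<lambda>x. 0) \<in> V"
    and lin_mem: "u \<in> V \<Longrightarrow> v \<in> V \<Longrightarrow> (\<lambda>x. u x + c * v x) \<in> V"
    and sym: "u \<in> V \<Longrightarrow> v \<in> V \<Longrightarrow> B u v = B v u"
    and lin: "u \<in> V \<Longrightarrow> v \<in> V \<Longrightarrow> w \<in> V \<Longrightarrow> B (\<lambda>x. u x + c * v x) w = B u w + c * B v w"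
    and nonneg: "u \<in> V \<Longrightarrow> 0 \<le> B u u"
begin

lemma diff_mem: "u \<in> V \<Longrightarrow> v \<in> V \<Longrightarrow> (\<lambda>x. u x - v x) \<in> V"
  using lin_mem[of u v "-1"] by simp

lemma add_mem: "u \<in> V \<Longrightarrow> v \<in> V \<Longrightarrow> (\<lambda>x. u x + v x) \<in> V"
  using lin_mem[of u v 1] by simp

lemma scale_mem: "u \<in> V \<Longrightarrow> (\<lambda>x. c * u x) \<in> V"
  using lin_mem[OF zero_mem, of u c] by simp

lemma zero_left: "w \<in> V \<Longrightarrow> B (\<lambda>x. 0) w = 0"
  using lin[OF zero_mem zero_mem, of w 1] by simp

lemma diff_left: "u \<in> V \<Longrightarrow> v \<in> V \<Longrightarrow> w \<in> V \<Longrightarrow> B (\<lambda>x. u x - v x) w = B u w - B v w"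
  using lin[of u v w "-1"] by simp

lemma scale_left: "u \<in> V \<Longrightarrow> w \<in> V \<Longrightarrow> B (\<lambda>x. c * u x) w = c * B u w"
  using lin[OF zero_mem, of u w c] zero_left by simp

lemma lin_right: "u \<in> V \<Longrightarrow> v \<in> V \<Longrightarrow> w \<in> V \<Longrightarrow> B w (\<lambda>x. u x + c * v x) = B w u + c * B w v"
  using lin[of u v w c] sym[OF lin_mem[of u v c], of w] sym[of u w] sym[of v w] by simp

lemma diff_right: "u \<in> V \<Longrightarrow> v \<in> V \<Longrightarrow> w \<in> V \<Longrightarrow> B w (\<lambda>x. u x - v x) = B w u - B w v"
  using lin_right[of u v w "-1"] by simp

lemma sum_mem: "(\<And>i. i < (n::nat) \<Longrightarrow> w i \<in> V) \<Longrightarrow> (\<lambda>x. \<Sum>i<n. c i * w i x) \<in> V"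
proof (induction n)
  case (Suc n)
  then show ?case using lin_mem[of "\<lambda>x. \<Sum>i<n. c i * w i x" "w n" "c n"] by simp
qed (simp add: zero_mem)

lemma sum_left: "(\<And>i. i < (n::nat) \<Longrightarrow> w i \<in> V) \<Longrightarrow> v \<in> V \<Longrightarrow>
  B (\<lambda>x. \<Sum>i<n. c i * w i x) v = (\<Sum>i<n. c i * B (w i) v)"
proof (induction n)
  case (Suc n)
  then show ?case
    using lin[of "\<lambda>x. \<Sum>i<n. c i * w i x" "w n" v "c n"] sum_mem[of n w c] by simp
qed (simp add: zero_left)

lemma quadratic: "u \<in> V \<Longrightarrow> v \<in> V \<Longrightarrow>
  B (\<lambda>x. u x + c * v x) (\<lambda>x. u x + c * v x) = B u u + 2 * c * B u v + c\<^sup>2 * B v v"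
proof -
  assume u: "u \<in> V" and v: "v \<in> V"
  note w = lin_mem[OF u v, of c]
  show ?thesis
    unfolding lin[OF u v w] lin_right[OF u v u] lin_right[OF u v v] sym[OF v u]
    by (simp add: power2_eq_square algebra_simps)
qed

lemma quadratic_diff: "u \<in> V \<Longrightarrow> v \<in> V \<Longrightarrow>
  B (\<lambda>x. u x - v x) (\<lambda>x. u x - v x) = B u u - 2 * B u v + B v v"
  using quadratic[of u v "-1"] by simp

lemma quadratic_add: "u \<in> V \<Longrightarrow> v \<in> V \<Longrightarrow>
  B (\<lambda>x. u x + v x) (\<lambda>x. u x + v x) = B u u + 2 * B u v + B v v"
  using quadratic[of u v 1] by simp

lemma scale_quadratic: "u \<in> V \<Longrightarrow> B (\<lambda>x. c * u x) (\<lambda>x. c * u x) = c\<^sup>2 * B u u"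
  using quadratic[OF zero_mem, of u c] zero_left[OF zero_mem] zero_left[of u] by simp

lemma cauchy_schwarz:
  assumes u: "u \<in> V" and v: "v \<in> V"
  shows "(B u v)\<^sup>2 \<le> B u u * B v v"
proof -
  have q: "0 \<le> B u u + 2 * c * B u v + c\<^sup>2 * B v v" for c
    using quadratic[OF u v, of c] nonneg[OF lin_mem[OF u v, of c]] by simp
  show ?thesis
  proof (cases "B v v = 0")
    case True
    \<comment> \<open>The quadratic in \<open>c\<close> degenerates to an affine function that is
      bounded below, so its slope must vanish; the value of \<open>c\<close> used below would make
      it equal to -1.\<close>
    have "B u v = 0"
    proof (rule ccontr)
      assume ne: "B u v \<noteq> 0"
      have "0 \<le> B u u + 2 * (- (B u u + 1) / (2 * B u v)) * B u v"
        using q[of "- (B u u + 1) / (2 * B u v)"] True by simp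
      then show False using ne by (simp add: field_simps)
    qed
    then show ?thesis using True by simp
  next
    case False
    then have pos: "B v v > 0" using nonneg[OF v] by simp
    have "0 \<le> B u u - (B u v)\<^sup>2 / B v v"
      using q[of "- B u v / B v v"] pos by (simp add: field_simps power2_eq_square)
    then show ?thesis using pos by (simp add: field_simps)
  qed
qed

text \<open>This is what makes null vectors harmless: functions vanishing almost everywhere drop out
  of every inner product.\<close>

lemma null_left: "u \<in> V \<Longrightarrow> v \<in> V \<Longrightarrow> B u u = 0 \<Longrightarrow> B u v = 0"
  using cauchy_schwarz[of u v] by simp

text \<open>Cauchy-Schwarz: convergence in the seminorm of \<open>B\<close> implies weak
  convergence.\<close>

lemma tendsto_left:
  assumes u: "\<And>n. u n \<in> V" and l: "l \<in> V" and v: "v \<in> V"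
    and conv: "(\<lambda>n. B (\<lambda>x. u n x - l x) (\<lambda>x. u n x - l x)) \<longlonglongrightarrow> 0"
  shows "(\<lambda>n. B (u n) v) \<longlonglongrightarrow> B l v"
proof -
  have "(\<lambda>n. (B (\<lambda>x. u n x - l x) v)\<^sup>2) \<longlonglongrightarrow> 0"
  proof (rule tendsto_sandwich[OF _ _ tendsto_const])
    show "(\<lambda>n. B (\<lambda>x. u n x - l x) (\<lambda>x. u n x - l x) * B v v) \<longlonglongrightarrow> 0"
      using tendsto_mult_left_zero[OF conv] .
  qed (use cauchy_schwarz[OF diff_mem[OF u l] v] in auto)
  then have "(\<lambda>n. B (\<lambda>x. u n x - l x) v) \<longlonglongrightarrow> 0"
    using tendsto_real_sqrt by (fastforce simp: tendsto_rabs_zero_iff)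
  then have "(\<lambda>n. B (u n) v - B l v) \<longlonglongrightarrow> 0"
    using diff_left[OF u l v] by simp
  then show ?thesis using Lim_null by blast
qed

lemma tendsto_quadratic:
  assumes u: "\<And>n. u n \<in> V" and l: "l \<in> V"
    and conv: "(\<lambda>n. B (\<lambda>x. u n x - l x) (\<lambda>x. u n x - l x)) \<longlonglongrightarrow> 0"
  shows "(\<lambda>n. B (u n) (u n)) \<longlonglongrightarrow> B l l"
proof -
  have eq: "B (u n) (u n) = B (\<lambda>x. u n x - l x) (\<lambda>x. u n x - l x) + 2 * B (u n) l - B l l" for n
    using quadratic_diff[OF u l] by simp
  have "(\<lambda>n. B (\<lambda>x. u n x - l x) (\<lambda>x. u n x - l x) + 2 * B (u n) l - B l l) \<longlonglongrightarrow> 0 + 2 * B l l - B l l"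
    by (intro tendsto_intros conv tendsto_left[OF u l l conv])
  then show ?thesis unfolding eq by simp
qed

text \<open>The residual is orthogonal to the vectors already subtracted, so its square is computed
  by Pythagoras; its nonnegativity is Bessel's inequality, the last claim.\<close>

lemma projection_error:
  assumes w: "\<And>i. w i \<in> V" and on: "\<And>i j. B (w i) (w j) = (if i = j then 1 else 0)" and f: "f \<in> V"
  defines "h \<equiv> \<lambda>(n::nat) x. f x - (\<Sum>i<n. B f (w i) * w i x)"
  shows "h n \<in> V" and "B (h n) (h n) = B f f - (\<Sum>i<n. (B f (w i))\<^sup>2)"
    and "j < n \<Longrightarrow> B (h n) (w j) = 0"
    and "(\<Sum>i<n. (B f (w i))\<^sup>2) \<le> B f f"
proof -
  let ?s = "\<lambda>n x. \<Sum>i<n. B f (w i) * w i x"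
  have s: "?s n \<in> V" for n using sum_mem[of n w] w by simp
  show hV: "h n \<in> V" for n unfolding h_def using diff_mem[OF f s] .
  have sw: "B (?s n) (w j) = (if j < n then B f (w j) else 0)" for n j
  proof -
    have "B (?s n) (w j) = (\<Sum>i<n. B f (w i) * B (w i) (w j))"
      using sum_left[of n w] w by simp
    also have "\<dots> = (\<Sum>i<n. if i = j then B f (w j) else 0)" by (intro sum.cong) (auto simp: on)
    finally show ?thesis by simp
  qed
  show ort: "B (h n) (w j) = 0" if "j < n" for n j
    unfolding h_def using diff_left[OF f s w] sw that by simp
  have fs: "B f (?s n) = (\<Sum>i<n. (B f (w i))\<^sup>2)" for n
    using sym[OF f s] sum_left[of n w f] w f sym[OF f w] by (simp add: power2_eq_square)
  have ss: "B (?s n) (?s n) = (\<Sum>i<n. (B f (w i))\<^sup>2)" for n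
  proof -
    have "B (?s n) (?s n) = (\<Sum>i<n. B f (w i) * B (w i) (?s n))" using sum_left[of n w] w s by simp
    also have "\<dots> = (\<Sum>i<n. (B f (w i))\<^sup>2)"
      by (intro sum.cong) (use sym[OF w s] sw in \<open>auto simp: power2_eq_square\<close>)
    finally show ?thesis .
  qed
  show q: "B (h n) (h n) = B f f - (\<Sum>i<n. (B f (w i))\<^sup>2)" for n
    unfolding h_def using quadratic_diff[OF f s] fs ss by simp
  show "(\<Sum>i<n. (B f (w i))\<^sup>2) \<le> B f f"
    using q[of n] nonneg[OF hV[of n]] by simp
qed

text \<open>For \<open>m \<le> n\<close> both \<open>h m\<close> and \<open>h n\<close> have the
  same product with \<open>h n\<close>, because they differ from \<open>f\<close> by vectors
  orthogonal to \<open>h n\<close>. Convergence of the norms of the residuals thus makes the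
  residuals themselves a Cauchy sequence.\<close>

lemma projection_residual_diff:
  assumes w: "\<And>i. w i \<in> V" and on: "\<And>i j. B (w i) (w j) = (if i = j then 1 else 0)" and f: "f \<in> V"
  defines "h \<equiv> \<lambda>(n::nat) x. f x - (\<Sum>i<n. B f (w i) * w i x)"
  assumes mn: "m \<le> n"
  shows "B (\<lambda>x. h m x - h n x) (\<lambda>x. h m x - h n x) = B (h m) (h m) - B (h n) (h n)"
proof -
  have hn: "h k = (\<lambda>x. f x - (\<Sum>i<k. B f (w i) * w i x))" for k by (simp add: h_def)
  note pe = projection_error[of w f, OF w on f, folded hn]
  have s: "(\<lambda>x. \<Sum>i<k. B f (w i) * w i x) \<in> V" for k using sum_mem[of k w] w by simp
  have "B (h k) (h n) = B f (h n)" if "k \<le> n" for k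
  proof -
    have "B (\<lambda>x. \<Sum>i<k. B f (w i) * w i x) (h n) = (\<Sum>i<k. B f (w i) * B (w i) (h n))"
      using sum_left[of k w "h n" "\<lambda>i. B f (w i)"] w pe(1) by simp
    also have "\<dots> = 0" using that sym[OF w pe(1)] pe(3) by (intro sum.neutral) auto
    finally show ?thesis using diff_left[OF f s[of k] pe(1)[of n]] unfolding hn[of k] by simp
  qed
  from this[of m] this[of n] mn have "B (h m) (h n) = B (h n) (h n)" by simp
  then show ?thesis using quadratic_diff[OF pe(1) pe(1), of m n] by simp
qed

end

section \<open>Extraction of subsequences from finitely many real sequences\<close>

lemma bounded_finite_convergent_subseq:
  fixes f :: "nat \<Rightarrow> nat \<Rightarrow> real"
  assumes "\<And>i. i < m \<Longrightarrow> bounded (range (f i))"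
  shows "\<exists>r. strict_mono (r :: nat \<Rightarrow> nat) \<and> (\<forall>i<m. convergent (\<lambda>n. f i (r n)))"
  using assms
proof (induction m)
  case 0
  then show ?case using strict_mono_id by auto
next
  case (Suc m)
  then obtain r where r: "strict_mono (r :: nat \<Rightarrow> nat)" "\<forall>i<m. convergent (\<lambda>n. f i (r n))"
    by (meson less_SucI)
  have "bounded (range (\<lambda>n. f m (r n)))"
    by (rule bounded_subset[OF Suc.prems[of m]]) auto
  then obtain l s where s: "strict_mono (s :: nat \<Rightarrow> nat)" "((\<lambda>n. f m (r n)) \<circ> s) \<longlonglongrightarrow> l"
    using bounded_imp_convergent_subsequence by blast
  have "convergent (\<lambda>n. f i (r (s n)))" if "i < Suc m" for i
  proof (cases "i = m")
    case True
    then show ?thesis using s by (auto simp: convergent_def o_def)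
  next
    case False
    then have "convergent (\<lambda>n. f i (r n))" using r that by auto
    then show ?thesis using convergent_subseq_convergent[OF _ s(1), of "\<lambda>n. f i (r n)"] by (simp add: o_def)
  qed
  then show ?case using strict_mono_o[OF r(1) s(1)] by (intro exI[of _ "r \<circ> s"]) (simp add: o_def)
qed

lemma convergent_finite_sum_Cauchy:
  fixes g :: "nat \<Rightarrow> nat \<Rightarrow> real"
  assumes "\<And>i. i < m \<Longrightarrow> convergent (g i)" and "e > 0"
  shows "\<exists>M. \<forall>j\<ge>M. \<forall>k\<ge>M. (\<Sum>i<m. (g i j - g i k)\<^sup>2) < e"
  using assms
proof (induction m arbitrary: e)
  case (Suc m)
  obtain M1 where M1: "\<forall>j\<ge>M1. \<forall>k\<ge>M1. (\<Sum>i<m. (g i j - g i k)\<^sup>2) < e / 2"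
    using Suc.IH[of "e / 2"] Suc.prems by auto
  have "Cauchy (g m)" using Suc.prems by (simp add: convergent_Cauchy)
  then obtain M2 where M2: "\<forall>j\<ge>M2. \<forall>k\<ge>M2. \<bar>g m j - g m k\<bar> < sqrt (e / 2)"
    using Suc.prems(2) unfolding Cauchy_def dist_real_def by (meson half_gt_zero real_sqrt_gt_zero)
  have gm: "(g m j - g m k)\<^sup>2 < e / 2" if "j \<ge> M2" "k \<ge> M2" for j k
  proof -
    have "(\<bar>g m j - g m k\<bar>)\<^sup>2 < (sqrt (e / 2))\<^sup>2" using M2 that by (intro power_strict_mono) auto
    then show ?thesis using Suc.prems(2) by simp
  qed
  show ?case
  proof (intro exI[of _ "max M1 M2"] allI impI)
    fix j k assume "j \<ge> max M1 M2" "k \<ge> max M1 M2"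
    then have "(\<Sum>i<m. (g i j - g i k)\<^sup>2) < e / 2" "(g m j - g m k)\<^sup>2 < e / 2"
      using M1 gm by auto
    then show "(\<Sum>i<Suc m. (g i j - g i k)\<^sup>2) < e" by simp
  qed
qed auto


section \<open>The spectral theorem for a pair of forms\<close>

text \<open>The hypothesis \<open>compact\<close> is the compactness of the embedding of the energy space
  into the space with form \<open>B\<close>, in a form in which extraction of subsequences is only needed for
  finitely many real sequences.\<close>

locale spectral_pair = A: psd_form V A + B: psd_form V B
  for V :: "('x \<Rightarrow> real) set" and A B +
  assumes null_iff: "u \<in> V \<Longrightarrow> A u u = 0 \<longleftrightarrow> B u u = 0"
    and complete: "(\<And>n::nat. s n \<in> V) \<Longrightarrow>
      (\<And>e. e > 0 \<Longrightarrow> \<exists>M. \<forall>m\<ge>M. \<forall>n\<ge>M. A (\<lambda>x. s m x - s n x) (\<lambda>x. s m x - s n x)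
         + B (\<lambda>x. s m x - s n x) (\<lambda>x. s m x - s n x) < e) \<Longrightarrow>
      \<exists>l\<in>V. (\<lambda>n. A (\<lambda>x. s n x - l x) (\<lambda>x. s n x - l x)
         + B (\<lambda>x. s n x - l x) (\<lambda>x. s n x - l x)) \<longlonglongrightarrow> 0"
    and compact: "e > 0 \<Longrightarrow> \<exists>(m::nat) \<phi> C.
      (\<forall>i<m. \<forall>u\<in>V. \<forall>v\<in>V. \<phi> i (\<lambda>x. u x - v x) = \<phi> i u - \<phi> i v) \<and>
      (\<forall>i<m. \<forall>u\<in>V. (\<phi> i u)\<^sup>2 \<le> C * B u u) \<and>
      (\<forall>u\<in>V. B u u \<le> e * (A u u + B u u) + (\<Sum>i<m. (\<phi> i u)\<^sup>2))"
    and infinite_dim: "\<exists>\<phi> :: nat \<Rightarrow> 'x \<Rightarrow> real. (\<forall>i. \<phi> i \<in> V) \<and>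
      (\<forall>i j. B (\<phi> i) (\<phi> j) = (if i = j then 1 else 0))"
begin

abbreviation "N u \<equiv> A u u + B u u"

lemma tendsto_parts:
  assumes u: "\<And>n. u n \<in> V" and l: "l \<in> V" and conv: "(\<lambda>n. N (\<lambda>x. u n x - l x)) \<longlonglongrightarrow> 0"
  shows "(\<lambda>n. A (\<lambda>x. u n x - l x) (\<lambda>x. u n x - l x)) \<longlonglongrightarrow> 0"
    and "(\<lambda>n. B (\<lambda>x. u n x - l x) (\<lambda>x. u n x - l x)) \<longlonglongrightarrow> 0"
  using A.nonneg[OF A.diff_mem[OF u l]] B.nonneg[OF A.diff_mem[OF u l]]
  by (auto intro!: tendsto_sandwich[OF _ _ tendsto_const conv])

text \<open>Along a subsequence the finitely many functionals \<open>\<phi> i\<close> converge, so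
  by linearity their values on differences tend to 0 and only the term with \<open>e\<close>
  survives. That term is left on the right; each application absorbs it by its own choice of
  \<open>e\<close>.\<close>

lemma compact_subseq:
  assumes u: "\<And>n. u n \<in> V" and bnd: "\<And>n. B (u n) (u n) \<le> K" and e: "e > 0"
  shows "\<exists>r. strict_mono (r :: nat \<Rightarrow> nat) \<and> (\<forall>d>0. \<exists>M. \<forall>j\<ge>M. \<forall>k\<ge>M.
    B (\<lambda>x. u (r j) x - u (r k) x) (\<lambda>x. u (r j) x - u (r k) x)
      \<le> e * N (\<lambda>x. u (r j) x - u (r k) x) + d)"
proof -
  from compact[OF e] obtain m \<phi> C where
    lin: "\<And>i u v. i < (m::nat) \<Longrightarrow> u \<in> V \<Longrightarrow> v \<in> V \<Longrightarrow> \<phi> i (\<lambda>x. u x - v x) = \<phi> i u - \<phi> i v" and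
    bd: "\<And>i u. i < m \<Longrightarrow> u \<in> V \<Longrightarrow> (\<phi> i u)\<^sup>2 \<le> C * B u u" and
    est: "\<And>u. u \<in> V \<Longrightarrow> B u u \<le> e * N u + (\<Sum>i<m. (\<phi> i u)\<^sup>2)"
    by blast
  have "bounded (range (\<lambda>n. \<phi> i (u n)))" if "i < m" for i
  proof -
    have "\<bar>\<phi> i (u n)\<bar> \<le> sqrt (\<bar>C\<bar> * K)" for n
    proof -
      have "(\<phi> i (u n))\<^sup>2 \<le> C * B (u n) (u n)" using bd[OF that u] .
      also have "\<dots> \<le> \<bar>C\<bar> * K"
        using bnd[of n] B.nonneg[OF u[of n]] by (intro mult_mono) auto
      finally show ?thesis using real_le_rsqrt by (metis abs_le_square_iff power2_abs real_sqrt_abs real_sqrt_le_mono)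
    qed
    then show ?thesis by (intro boundedI) auto
  qed
  from bounded_finite_convergent_subseq[where f = "\<lambda>i n. \<phi> i (u n)", OF this]
  obtain r where r: "strict_mono (r :: nat \<Rightarrow> nat)" "\<forall>i<m. convergent (\<lambda>n. \<phi> i (u (r n)))"
    by blast
  have "\<exists>M. \<forall>j\<ge>M. \<forall>k\<ge>M. B (\<lambda>x. u (r j) x - u (r k) x) (\<lambda>x. u (r j) x - u (r k) x)
      \<le> e * N (\<lambda>x. u (r j) x - u (r k) x) + d" if "d > 0" for d
  proof -
    obtain M where M: "\<forall>j\<ge>M. \<forall>k\<ge>M. (\<Sum>i<m. (\<phi> i (u (r j)) - \<phi> i (u (r k)))\<^sup>2) < d"
      using convergent_finite_sum_Cauchy[of m "\<lambda>i n. \<phi> i (u (r n))" d] r \<open>d > 0\<close> by blast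
    have "B (\<lambda>x. u (r j) x - u (r k) x) (\<lambda>x. u (r j) x - u (r k) x)
      \<le> e * N (\<lambda>x. u (r j) x - u (r k) x) + d" if "j \<ge> M" "k \<ge> M" for j k
    proof -
      have "(\<Sum>i<m. (\<phi> i (\<lambda>x. u (r j) x - u (r k) x))\<^sup>2) = (\<Sum>i<m. (\<phi> i (u (r j)) - \<phi> i (u (r k)))\<^sup>2)"
        by (intro sum.cong) (auto simp: lin u)
      moreover have "\<dots> < d" using M that by blast
      ultimately show ?thesis using est[OF A.diff_mem[OF u u], of "r j" "r k"] by linarith
    qed
    then show ?thesis by blast
  qed
  with r show ?thesis by blast
qed

section \<open>Minimisers of the Rayleigh quotient under orthogonality constraints\<close>

definition perp :: "('x \<Rightarrow> real) set \<Rightarrow> ('x \<Rightarrow> real) set" where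
  "perp E = {v \<in> V. \<forall>e\<in>E. B v e = 0}"

text \<open>Minimality of the Rayleigh quotient is stated without division, since
  \<open>B v v\<close> may vanish for admissible \<open>v\<close>.\<close>

definition is_min :: "('x \<Rightarrow> real) set \<Rightarrow> ('x \<Rightarrow> real) \<Rightarrow> bool" where
  "is_min E u \<longleftrightarrow> u \<in> perp E \<and> B u u = 1 \<and> (\<forall>v\<in>perp E. A u u * B v v \<le> A v v)"

lemma perpD: "v \<in> perp E \<Longrightarrow> v \<in> V" "v \<in> perp E \<Longrightarrow> e \<in> E \<Longrightarrow> B v e = 0"
  by (auto simp: perp_def)

lemma perp_lin: "E \<subseteq> V \<Longrightarrow> u \<in> perp E \<Longrightarrow> v \<in> perp E \<Longrightarrow> (\<lambda>x. u x + c * v x) \<in> perp E"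
  unfolding perp_def using B.lin A.lin_mem by (auto simp: subset_iff)

lemma perp_scale: "E \<subseteq> V \<Longrightarrow> v \<in> perp E \<Longrightarrow> (\<lambda>x. c * v x) \<in> perp E"
  unfolding perp_def using B.scale_left A.scale_mem by (auto simp: subset_iff)

text \<open>Direct method: the parallelogram law turns near-minimality of two normalised vectors
  into a bound for the energy of their difference by a small term plus \<open>l\<close> times its
  \<open>B\<close>-square. \<open>compact_subseq\<close> controls the latter, so a minimising
  sequence has a Cauchy subsequence in the full norm.\<close>

lemma ex_min:
  assumes E: "E \<subseteq> V" and ex: "\<exists>v\<in>perp E. B v v > 0"
  shows "\<exists>u. is_min E u"
proof -
  define S where "S = {A v v | v. v \<in> perp E \<and> B v v = 1}"
  have normalise: "\<exists>a\<in>S. a * B v v = A v v" if v: "v \<in> perp E" and pos: "B v v > 0" for v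
  proof -
    let ?c = "1 / sqrt (B v v)"
    have V: "v \<in> V" using v perpD by blast
    have c2: "?c\<^sup>2 = 1 / B v v" using pos by (simp add: power_divide)
    have "B (\<lambda>x. ?c * v x) (\<lambda>x. ?c * v x) = 1"
      using B.scale_quadratic[OF V, of ?c] c2 pos by simp
    then have "A (\<lambda>x. ?c * v x) (\<lambda>x. ?c * v x) \<in> S"
      using perp_scale[OF E v, of ?c] unfolding S_def by blast
    moreover have "A (\<lambda>x. ?c * v x) (\<lambda>x. ?c * v x) * B v v = A v v"
      using A.scale_quadratic[OF V, of ?c] c2 pos by simp
    ultimately show ?thesis by blast
  qed
  have Sne: "S \<noteq> {}" using ex normalise by blast
  have S0: "\<And>a. a \<in> S \<Longrightarrow> 0 \<le> a" unfolding S_def using A.nonneg perpD by blast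
  then have bdd: "bdd_below S" by (meson bdd_belowI)
  define l where "l = Inf S"
  have l0: "l \<ge> 0" unfolding l_def using Sne S0 by (rule cInf_greatest)
  have low: "l * B v v \<le> A v v" if v: "v \<in> perp E" for v
  proof (cases "B v v = 0")
    case True
    then show ?thesis using A.nonneg perpD v by simp
  next
    case False
    then have pos: "B v v > 0" using B.nonneg[of v] perpD v by force
    then obtain a where a: "a \<in> S" "a * B v v = A v v" using normalise v by blast
    have "l \<le> a" unfolding l_def using a(1) bdd by (rule cInf_lower)
    then show ?thesis using a pos by (metis mult_right_mono less_imp_le)
  qed
  have "\<exists>v. v \<in> perp E \<and> B v v = 1 \<and> A v v < l + 1 / real (Suc n)" for n
  proof -
    have "\<exists>a\<in>S. a < l + 1 / real (Suc n)" unfolding l_def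
      using Sne bdd by (subst cInf_less_iff[symmetric]) auto
    then show ?thesis unfolding S_def by blast
  qed
  then obtain u where u: "\<And>n. u n \<in> perp E" "\<And>n. B (u n) (u n) = 1"
    "\<And>n. A (u n) (u n) < l + 1 / real (Suc n)" by metis
  have uV: "\<And>n. u n \<in> V" using u perpD by blast
  \<comment> \<open>With this \<open>e\<close>, the bound for \<open>(l + 1) * B ?w ?w\<close> below
    contains exactly half of \<open>N ?w\<close>, which is absorbed on the left.\<close>
  from compact_subseq[where u = u and K = 1 and e = "1 / (2 * (l + 1))", OF uV] u l0
  obtain r where r: "strict_mono (r :: nat \<Rightarrow> nat)" and
    C: "\<And>d. d > 0 \<Longrightarrow> \<exists>M. \<forall>j\<ge>M. \<forall>k\<ge>M. B (\<lambda>x. u (r j) x - u (r k) x) (\<lambda>x. u (r j) x - u (r k) x)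
      \<le> 1 / (2 * (l + 1)) * N (\<lambda>x. u (r j) x - u (r k) x) + d" by auto
  have "\<exists>M. \<forall>j\<ge>M. \<forall>k\<ge>M. N (\<lambda>x. u (r j) x - u (r k) x) < e" if e: "e > 0" for e
  proof -
    define d where "d = e / (4 * (l + 1))"
    have d: "d > 0" using e l0 by (simp add: d_def)
    obtain M1 where M1: "\<forall>j\<ge>M1. \<forall>k\<ge>M1. B (\<lambda>x. u (r j) x - u (r k) x) (\<lambda>x. u (r j) x - u (r k) x)
      \<le> 1 / (2 * (l + 1)) * N (\<lambda>x. u (r j) x - u (r k) x) + d" using C[OF d] by blast
    \<comment> \<open>Each of the two energies exceeds \<open>l\<close> by less than
      \<open>e / 16\<close> and enters with factor 2, so the total excess over \<open>4 * l\<close>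
      is below \<open>e / 4\<close>.\<close>
    obtain M2 :: nat where M2: "1 / real (Suc M2) < e / 16"
      using e nat_approx_posE[of "e / 16"] by auto
    have "N (\<lambda>x. u (r j) x - u (r k) x) < e" if j: "j \<ge> max M1 M2" and k: "k \<ge> max M1 M2" for j k
    proof -
      let ?u = "u (r j)" and ?v = "u (r k)"
      let ?w = "\<lambda>x. ?u x - ?v x"
      have small: "1 / real (Suc (r i)) < e / 16" if "i \<ge> M2" for i
      proof -
        have "M2 \<le> r i" using that strict_mono_imp_increasing[OF r, of i] by linarith
        then have "1 / real (Suc (r i)) \<le> 1 / real (Suc M2)" by (simp add: frac_le)
        with M2 show ?thesis by linarith
      qed
      \<comment> \<open>The sum is again admissible, so \<open>l\<close> bounds its energy from
        below; by the parallelogram law this bounds the energy of the difference from above.\<close>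
      have "(\<lambda>x. ?u x + ?v x) \<in> perp E" using perp_lin[OF E u(1) u(1), of _ 1] by simp
      then have "l * B (\<lambda>x. ?u x + ?v x) (\<lambda>x. ?u x + ?v x) \<le> A (\<lambda>x. ?u x + ?v x) (\<lambda>x. ?u x + ?v x)"
        by (rule low)
      moreover have "A (\<lambda>x. ?u x + ?v x) (\<lambda>x. ?u x + ?v x) = 2 * A ?u ?u + 2 * A ?v ?v - A ?w ?w"
        using A.quadratic_add[OF uV uV] A.quadratic_diff[OF uV uV] by simp
      moreover have "B (\<lambda>x. ?u x + ?v x) (\<lambda>x. ?u x + ?v x) = 4 - B ?w ?w"
        using B.quadratic_add[OF uV uV] B.quadratic_diff[OF uV uV] u(2) by simp
      ultimately have "A ?w ?w \<le> 2 * A ?u ?u + 2 * A ?v ?v - 4 * l + l * B ?w ?w"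
        by (simp add: algebra_simps)
      moreover have "A ?u ?u < l + e / 16" "A ?v ?v < l + e / 16"
        using u(3)[of "r j"] u(3)[of "r k"] small j k by (smt (verit) max.bounded_iff)+
      ultimately have 1: "N ?w < e / 4 + (l + 1) * B ?w ?w" by (simp add: algebra_simps)
      have "B ?w ?w \<le> 1 / (2 * (l + 1)) * N ?w + d" using M1 j k by simp
      then have "(l + 1) * B ?w ?w \<le> (l + 1) * (1 / (2 * (l + 1)) * N ?w + d)"
        using l0 by (intro mult_left_mono) auto
      also have "\<dots> = N ?w / 2 + e / 4"
      proof -
        have "p * (1 / (2 * p) * y + e / (4 * p)) = y / 2 + e / 4" if "p > 0" for p y :: real
          using that by (simp add: field_simps)
        from this[of "l + 1"] show ?thesis unfolding d_def using l0 by simp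
      qed
      finally have "N ?w < e / 4 + (N ?w / 2 + e / 4)"
        by (intro less_le_trans[OF 1] add_left_mono)
      then show ?thesis by (simp add: field_simps)
    qed
    then show ?thesis by blast
  qed
  from complete[OF _ this] uV obtain g where g: "g \<in> V"
    and lim: "(\<lambda>n. N (\<lambda>x. u (r n) x - g x)) \<longlonglongrightarrow> 0" by auto
  note limA = tendsto_parts(1)[of "\<lambda>n. u (r n)", OF uV g lim]
  note limB = tendsto_parts(2)[of "\<lambda>n. u (r n)", OF uV g lim]
  have "B g e = 0" if "e \<in> E" for e
    using B.tendsto_left[of "\<lambda>n. u (r n)", OF uV g _ limB, of e] that E perpD(2)[OF u(1) that]
    by (auto simp: LIMSEQ_const_iff)
  then have gp: "g \<in> perp E" using g by (simp add: perp_def)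
  have B1: "B g g = 1"
    using B.tendsto_quadratic[of "\<lambda>n. u (r n)", OF uV g limB] u(2) by (simp add: LIMSEQ_const_iff)
  have "A g g \<le> l"
  proof (rule LIMSEQ_le)
    show "(\<lambda>n. A (u (r n)) (u (r n))) \<longlonglongrightarrow> A g g"
      by (rule A.tendsto_quadratic[of "\<lambda>n. u (r n)", OF uV g limA])
    have "(\<lambda>n. 1 / real (Suc n)) \<longlonglongrightarrow> 0" using LIMSEQ_Suc[OF lim_1_over_n] by simp
    from LIMSEQ_subseq_LIMSEQ[OF this r] have "(\<lambda>n. 1 / real (Suc (r n))) \<longlonglongrightarrow> 0"
      unfolding o_def .
    then show "(\<lambda>n. l + 1 / real (Suc (r n))) \<longlonglongrightarrow> l" using tendsto_add[OF tendsto_const] by fastforce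
    show "\<exists>N. \<forall>n\<ge>N. A (u (r n)) (u (r n)) \<le> l + 1 / real (Suc (r n))"
      using u(3) less_imp_le by blast
  qed
  then have "A g g * B v v \<le> A v v" if "v \<in> perp E" for v
    using low[OF that] B.nonneg[OF perpD(1)[OF that]] by (meson mult_right_mono order_trans)
  with gp B1 show ?thesis unfolding is_min_def by blast
qed

text \<open>The choice is made inside the recursion because each minimiser is sought orthogonal to
  all earlier ones; \<open>ev\<close> and \<open>eset_eq\<close> recover the sequence from the sets.
  That the choice always has a witness is part of \<open>ev_props\<close>.\<close>

primrec eset :: "nat \<Rightarrow> ('x \<Rightarrow> real) set" where
  "eset 0 = {}"
| "eset (Suc k) = insert (SOME u. is_min (eset k) u) (eset k)"

definition ev :: "nat \<Rightarrow> 'x \<Rightarrow> real" where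
  "ev k = (SOME u. is_min (eset k) u)"

lemma eset_eq: "eset k = ev ` {..<k}"
  by (induction k) (auto simp: lessThan_Suc ev_def)

text \<open>The eigenvalue is built in as \<open>A u u\<close>, which is the Rayleigh quotient for
  the \<open>B\<close>-normalised vectors to which this is applied.\<close>

definition is_eigen :: "('x \<Rightarrow> real) \<Rightarrow> bool" where
  "is_eigen u \<longleftrightarrow> (\<forall>v\<in>V. A u v = A u u * B u v)"

text \<open>Euler-Lagrange equation: along \<open>u + c v\<close> the nonnegative quadratic
  \<open>2 c p + c^2 q\<close> vanishes at \<open>c = 0\<close>, so its linear coefficient must be
  zero.\<close>

lemma is_min_eigen:
  assumes E: "E \<subseteq> V" and m: "is_min E u" and v: "v \<in> perp E"
  shows "A u v = A u u * B u v"
proof -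
  have uV: "u \<in> V" and vV: "v \<in> V" using m v perpD unfolding is_min_def by blast+
  have B1: "B u u = 1" using m by (simp add: is_min_def)
  let ?p = "A u v - A u u * B u v" and ?q = "A v v - A u u * B v v"
  have q: "0 \<le> 2 * c * ?p + c\<^sup>2 * ?q" for c
  proof -
    have "(\<lambda>x. u x + c * v x) \<in> perp E" using perp_lin[OF E _ v] m by (simp add: is_min_def)
    then have "A u u * B (\<lambda>x. u x + c * v x) (\<lambda>x. u x + c * v x)
      \<le> A (\<lambda>x. u x + c * v x) (\<lambda>x. u x + c * v x)" using m by (simp add: is_min_def)
    then show ?thesis unfolding A.quadratic[OF uV vV] B.quadratic[OF uV vV] B1
      by (simp add: algebra_simps)
  qed
  have "?q \<ge> 0" using m v by (simp add: is_min_def)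
  have "?p = 0"
  proof (rule ccontr)
    assume ne: "?p \<noteq> 0"
    \<comment> \<open>The summand 1 keeps the denominator positive when \<open>?q = 0\<close>; the
      quadratic is negative at this point.\<close>
    let ?c = "- ?p / (?q + 1)"
    have "2 * ?c * ?p + ?c\<^sup>2 * ?q = - (?p\<^sup>2) * (?q + 2) / (?q + 1)\<^sup>2"
      using \<open>?q \<ge> 0\<close> by (simp add: power2_eq_square divide_simps) algebra
    also have "\<dots> < 0" using ne \<open>?q \<ge> 0\<close> by (intro divide_neg_pos mult_neg_pos) auto
    finally show False using q[of ?c] by linarith
  qed
  then show ?thesis by simp
qed

text \<open>Strong induction is needed twice: orthonormality of the earlier vectors yields an
  admissible vector with \<open>B v v > 0\<close>, and their eigenvalue equations extend the new one
  from the orthogonal complement to all of \<open>V\<close>.\<close>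

lemma ev_props:
  shows "ev k \<in> V" and "is_min (eset k) (ev k)" and "is_eigen (ev k)"
    and "i < k \<Longrightarrow> B (ev k) (ev i) = 0"
proof -
  have main: "is_min (eset k) (ev k) \<and> is_eigen (ev k)" for k
  proof (induction k rule: less_induct)
    case (less k)
    have V: "ev i \<in> V" if "i < k" for i using less[OF that] perpD unfolding is_min_def by blast
    have one: "B (ev i) (ev i) = 1" if "i < k" for i using less[OF that] unfolding is_min_def by blast
    have ort: "B (ev i) (ev j) = 0" if "i < k" "j < i" for i j
      using less[OF that(1)] that perpD(2)[of "ev i" "eset i" "ev j"] unfolding is_min_def eset_eq by auto
    have on: "B (ev i) (ev j) = (if i = j then 1 else 0)" if "i < k" "j < k" for i j
      using that one ort[of i j] ort[of j i] B.sym[OF V V, of i j] by (cases i j rule: linorder_cases) auto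
    have E: "eset k \<subseteq> V" using V by (auto simp: eset_eq)
    \<comment> \<open>Only the first \<open>k\<close> vectors are known to be orthonormal at this
      stage, whereas \<open>projection_error\<close> speaks of an infinite orthonormal family, so
      the projection is set up by hand.\<close>
    define pr where "pr v = (\<lambda>x. v x - (\<Sum>i<k. B v (ev i) * ev i x))" for v
    have smem: "(\<lambda>x. \<Sum>i<k. B v (ev i) * ev i x) \<in> V" if "v \<in> V" for v
      using A.sum_mem[of k ev] V by simp
    have sw: "B (\<lambda>x. \<Sum>i<k. B v (ev i) * ev i x) (ev j) = B v (ev j)" if "v \<in> V" "j < k" for v j
    proof -
      have "B (\<lambda>x. \<Sum>i<k. B v (ev i) * ev i x) (ev j) = (\<Sum>i<k. B v (ev i) * B (ev i) (ev j))"
        using B.sum_left[of k ev] V that by simp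
      also have "\<dots> = (\<Sum>i<k. if i = j then B v (ev j) else 0)"
        by (intro sum.cong) (auto simp: on that)
      finally show ?thesis using that by simp
    qed
    have prp: "pr v \<in> perp (eset k)" if "v \<in> V" for v
      unfolding pr_def perp_def eset_eq
      using A.diff_mem[OF that smem[OF that]] B.diff_left[OF that smem[OF that] V] sw[OF that] by auto
    have "\<exists>v\<in>perp (eset k). B v v > 0"
    proof (rule ccontr)
      assume "\<not> ?thesis"
      then have null: "B (pr v) (pr v) = 0" if "v \<in> V" for v
        using prp[OF that] B.nonneg[of "pr v"] perpD(1) by force
      obtain \<phi> :: "nat \<Rightarrow> 'x \<Rightarrow> real" where \<phi>: "\<And>i. \<phi> i \<in> V"
        "\<And>i j. B (\<phi> i) (\<phi> j) = (if i = j then 1 else 0)" using infinite_dim by blast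
      have parseval: "(\<Sum>i<k. (B v (ev i))\<^sup>2) = B v v" if v: "v \<in> V" for v
      proof -
        have "0 = B (pr v) v" using B.null_left[OF perpD(1)[OF prp[OF v]] v null[OF v]] by simp
        also have "\<dots> = B v v - (\<Sum>i<k. B v (ev i) * B (ev i) v)"
          unfolding pr_def using B.diff_left[OF v smem[OF v] v] B.sum_left[of k ev v] V v by simp
        also have "(\<Sum>i<k. B v (ev i) * B (ev i) v) = (\<Sum>i<k. (B v (ev i))\<^sup>2)"
          by (intro sum.cong) (auto simp: power2_eq_square B.sym[OF V v])
        finally show ?thesis by simp
      qed
      \<comment> \<open>Dimension count: if \<open>k\<close> vectors captured the whole norm, the
        squared products of \<open>Suc k\<close> orthonormal vectors with them would sum to
        \<open>Suc k\<close> in one order and, by Bessel, to at most \<open>k\<close> in the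
        other.\<close>
      have "real (Suc k) = (\<Sum>j<Suc k. B (\<phi> j) (\<phi> j))" using \<phi>(2) by simp
      also have "\<dots> = (\<Sum>j<Suc k. \<Sum>i<k. (B (\<phi> j) (ev i))\<^sup>2)"
        using parseval[OF \<phi>(1)] by simp
      also have "\<dots> = (\<Sum>i<k. \<Sum>j<Suc k. (B (\<phi> j) (ev i))\<^sup>2)" by (rule sum.swap)
      also have "\<dots> = (\<Sum>i<k. \<Sum>j<Suc k. (B (ev i) (\<phi> j))\<^sup>2)"
        using B.sym[OF \<phi>(1) V] by simp
      also have "\<dots> \<le> (\<Sum>i<k. B (ev i) (ev i))"
        by (intro sum_mono B.projection_error(4)[where w = \<phi>]) (auto simp: \<phi> V)
      also have "\<dots> = real k" using one by simp
      finally show False by simp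
    qed
    then have m: "is_min (eset k) (ev k)" unfolding ev_def using ex_min[OF E] someI_ex by metis
    have evV: "ev k \<in> V" using m perpD unfolding is_min_def by blast
    have ortk: "B (ev k) (ev i) = 0" if "i < k" for i
      using m perpD(2)[of "ev k" "eset k" "ev i"] that unfolding is_min_def eset_eq by auto
    \<comment> \<open>The earlier eigenvalue equation converts \<open>B\<close>-orthogonality into
      \<open>A\<close>-orthogonality. Hence subtracting the projection from \<open>v\<close> changes
      neither \<open>A (ev k) v\<close> nor \<open>B (ev k) v\<close>.\<close>
    have Aortk: "A (ev k) (ev i) = 0" if "i < k" for i
    proof -
      have "A (ev i) (ev k) = A (ev i) (ev i) * B (ev i) (ev k)"
        using less[OF that] evV unfolding is_eigen_def by blast
      then show ?thesis using ortk[OF that] A.sym[OF evV V[OF that]] B.sym[OF evV V[OF that]] by simp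
    qed
    have "A (ev k) v = A (ev k) (ev k) * B (ev k) v" if v: "v \<in> V" for v
    proof -
      have "B (ev k) (\<lambda>x. \<Sum>i<k. B v (ev i) * ev i x) = 0"
        using B.sym[OF evV smem[OF v]] B.sum_left[of k ev "ev k" "\<lambda>i. B v (ev i)"] V evV ortk B.sym[OF evV V]
        by simp
      moreover have "A (ev k) (\<lambda>x. \<Sum>i<k. B v (ev i) * ev i x) = 0"
        using A.sym[OF evV smem[OF v]] A.sum_left[of k ev "ev k" "\<lambda>i. B v (ev i)"] V evV Aortk A.sym[OF evV V]
        by simp
      ultimately show ?thesis
        using is_min_eigen[OF E m prp[OF v]] A.diff_right[OF v smem[OF v] evV]
          B.diff_right[OF v smem[OF v] evV] unfolding pr_def by simp
    qed
    with m show ?case unfolding is_eigen_def by blast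
  qed
  show "ev k \<in> V" "is_min (eset k) (ev k)" "is_eigen (ev k)"
    using main perpD unfolding is_min_def by blast+
  show "B (ev k) (ev i) = 0" if "i < k"
    using main[of k] perpD(2)[of "ev k" "eset k" "ev i"] that unfolding is_min_def eset_eq by auto
qed

section \<open>Growth of the eigenvalues and eigenvector expansions\<close>

lemma ev_orthonormal: "B (ev i) (ev j) = (if i = j then 1 else 0)"
  using ev_props(4)[of i j] ev_props(4)[of j i] B.sym[OF ev_props(1) ev_props(1), of i j] ev_props(2)[of i]
  by (cases i j rule: linorder_cases) (auto simp: is_min_def)

definition lam :: "nat \<Rightarrow> real" where "lam k = A (ev k) (ev k)"

lemma ev_eigen: "v \<in> V \<Longrightarrow> A (ev k) v = lam k * B (ev k) v"
  using ev_props(3) unfolding is_eigen_def lam_def by blast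

lemma lam_min: "v \<in> V \<Longrightarrow> (\<And>i. i < k \<Longrightarrow> B v (ev i) = 0) \<Longrightarrow> lam k * B v v \<le> A v v"
  using ev_props(2)[of k] unfolding is_min_def lam_def perp_def eset_eq by auto

lemma lam_pos: "0 < lam k"
proof -
  have "A (ev k) (ev k) \<noteq> 0" using null_iff[OF ev_props(1)] ev_orthonormal[of k k] by simp
  then show ?thesis using A.nonneg[OF ev_props(1)[of k]] unfolding lam_def by simp
qed

text \<open>A later minimiser satisfies all earlier constraints and so competes in the earlier
  problem.\<close>

lemma lam_mono: "mono lam"
proof
  fix i j :: nat assume "i \<le> j"
  then have "lam i * B (ev j) (ev j) \<le> A (ev j) (ev j)"
    by (intro lam_min ev_props(1)) (auto simp: ev_orthonormal)
  then show "lam i \<le> lam j" using ev_orthonormal[of j j] by (simp add: lam_def)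
qed

lemma ev_A_orthogonal: "i \<noteq> j \<Longrightarrow> A (ev i) (ev j) = 0"
  using ev_eigen[OF ev_props(1)] ev_orthonormal by simp

text \<open>A monotone sequence that does not diverge is bounded, say by \<open>Z\<close>. The
  eigenvectors are then bounded in energy, yet differences of distinct ones have
  \<open>B\<close>-square 2, which contradicts compactness.\<close>

lemma lam_at_top: "filterlim lam at_top sequentially"
proof (rule ccontr)
  assume "\<not> ?thesis"
  then obtain Z where Z: "\<And>n. lam n \<le> Z"
    using lam_mono unfolding filterlim_at_top eventually_sequentially mono_def
    by (metis linorder_le_cases order_trans)
  have Z0: "Z > 0" using Z[of 0] lam_pos[of 0] by linarith
  \<comment> \<open>The differences satisfy \<open>N ?w \<le> 2 * (Z + 1)\<close>, so this
    \<open>e\<close> contributes at most 1/2; with tolerance 1 the total 3/2 stays below 2.\<close>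
  from compact_subseq[where u = ev and K = 1 and e = "1 / (4 * (Z + 1))"] ev_props(1) ev_orthonormal Z0
  obtain r where r: "strict_mono (r :: nat \<Rightarrow> nat)" and
    C: "\<And>d. d > 0 \<Longrightarrow> \<exists>M. \<forall>j\<ge>M. \<forall>k\<ge>M. B (\<lambda>x. ev (r j) x - ev (r k) x) (\<lambda>x. ev (r j) x - ev (r k) x)
      \<le> 1 / (4 * (Z + 1)) * N (\<lambda>x. ev (r j) x - ev (r k) x) + d" by auto
  obtain M where M: "\<forall>j\<ge>M. \<forall>k\<ge>M. B (\<lambda>x. ev (r j) x - ev (r k) x) (\<lambda>x. ev (r j) x - ev (r k) x)
      \<le> 1 / (4 * (Z + 1)) * N (\<lambda>x. ev (r j) x - ev (r k) x) + 1" using C[of 1] by auto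
  have ne: "r (Suc M) \<noteq> r M" using r by (simp add: strict_mono_eq)
  let ?w = "\<lambda>x. ev (r (Suc M)) x - ev (r M) x"
  have b: "B ?w ?w = 2" using B.quadratic_diff[OF ev_props(1) ev_props(1)] ev_orthonormal ne by simp
  have "A ?w ?w = lam (r (Suc M)) + lam (r M)"
    using A.quadratic_diff[OF ev_props(1) ev_props(1)] ev_A_orthogonal ne by (simp add: lam_def)
  then have n: "N ?w \<le> 2 * (Z + 1)" using Z[of "r (Suc M)"] Z[of "r M"] b by simp
  have "B ?w ?w \<le> 1 / (4 * (Z + 1)) * N ?w + 1" using M by simp
  also have "\<dots> \<le> 1 / (4 * (Z + 1)) * (2 * (Z + 1)) + 1"
    using n Z0 by (intro add_right_mono mult_left_mono) auto
  also have "\<dots> = 3 / 2" using Z0 by (simp add: field_simps)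
  finally show False using b by simp
qed

text \<open>Minimality gives \<open>lam n * B (h n) (h n) \<le> A f f\<close>, so the
  \<open>B\<close>-part tends to 0 by divergence of \<open>lam\<close>. This alone does not make the
  energy tend to 0: the decreasing energies only show that the residuals are Cauchy, and their
  limit, having \<open>B\<close>-square 0, has energy 0 by \<open>null_iff\<close>.\<close>

lemma ev_expansion:
  assumes f: "f \<in> V"
  shows "(\<lambda>n. N (\<lambda>x. f x - (\<Sum>i<n. B f (ev i) * ev i x))) \<longlonglongrightarrow> 0"
proof -
  define h where "h n = (\<lambda>x. f x - (\<Sum>i<n. B f (ev i) * ev i x))" for n
  note pe = B.projection_error[of ev f, OF ev_props(1) ev_orthonormal f, folded h_def]
  have hV: "h n \<in> V" for n using pe(1) .
  \<comment> \<open>Pythagoras for \<open>A\<close>: the difference of two residuals is a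
    combination of eigenvectors with index below \<open>n\<close>, which are also
    \<open>A\<close>-orthogonal to \<open>h n\<close>.\<close>
  have dec: "A (h m) (h m) = A (h n) (h n) + A (\<lambda>x. h m x - h n x) (\<lambda>x. h m x - h n x)"
    if "m \<le> n" for m n
  proof -
    define s where "s = (\<lambda>x. \<Sum>i<n. (if m \<le> i then B f (ev i) else 0) * ev i x)"
    have sV: "s \<in> V" unfolding s_def using A.sum_mem[of n ev] ev_props(1) by simp
    have d: "(\<lambda>x. h m x - h n x) = s"
    proof
      fix x
      have "h m x - h n x = (\<Sum>i<n. B f (ev i) * ev i x) - (\<Sum>i<m. B f (ev i) * ev i x)"
        by (simp add: h_def)
      also have "(\<Sum>i<m. B f (ev i) * ev i x) = (\<Sum>i<n. if m \<le> i then 0 else B f (ev i) * ev i x)"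
        using that by (intro sum.mono_neutral_cong_left) auto
      also have "(\<Sum>i<n. B f (ev i) * ev i x) - \<dots> = s x"
        unfolding s_def sum_subtractf[symmetric] by (intro sum.cong) auto
      finally show "h m x - h n x = s x" .
    qed
    have "A s (h n) = (\<Sum>i<n. (if m \<le> i then B f (ev i) else 0) * A (ev i) (h n))"
      unfolding s_def using A.sum_left[of n ev] ev_props(1) hV by simp
    also have "\<dots> = 0"
      using ev_eigen[OF hV] B.sym[OF ev_props(1) hV] pe(3) by (intro sum.neutral) auto
    finally have "A s (h n) = 0" .
    moreover have "(\<lambda>x. s x + h n x) = h m" unfolding d[symmetric] by simp
    ultimately show ?thesis using A.quadratic_add[OF sV hV[of n]] d by simp
  qed
  have "decseq (\<lambda>n. A (h n) (h n))"
    unfolding decseq_def using dec A.nonneg[OF A.diff_mem[OF hV hV]] by (metis le_add_same_cancel1)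
  have "convergent (\<lambda>n. A (h n) (h n))"
    using \<open>decseq _\<close> A.nonneg[OF hV] by (intro Bseq_monoseq_convergent decseq_imp_monoseq decseq_bounded) auto
  then have CA: "Cauchy (\<lambda>n. A (h n) (h n))" by (rule convergent_Cauchy)
  have B0: "(\<lambda>n. B (h n) (h n)) \<longlonglongrightarrow> 0"
  proof (rule tendsto_sandwich[OF _ _ tendsto_const])
    show "(\<lambda>n. A f f / lam n) \<longlonglongrightarrow> 0"
      using tendsto_divide_0[OF tendsto_const filterlim_at_top_imp_at_infinity[OF lam_at_top]] .
    show "\<forall>\<^sub>F n in sequentially. B (h n) (h n) \<le> A f f / lam n"
    proof (rule always_eventually, rule allI)
      fix n
      have h0: "h 0 = f" by (simp add: h_def)
      have "lam n * B (h n) (h n) \<le> A (h n) (h n)" by (rule lam_min[OF hV pe(3)])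
      also have "\<dots> \<le> A f f" using \<open>decseq _\<close> h0 unfolding decseq_def by (metis le0)
      finally show "B (h n) (h n) \<le> A f f / lam n" using lam_pos by (simp add: field_simps)
    qed
  qed (use B.nonneg[OF hV] in auto)
  have Cauchy: "\<exists>M. \<forall>m\<ge>M. \<forall>n\<ge>M. N (\<lambda>x. h m x - h n x) < e" if e: "e > 0" for e
  proof -
    obtain M1 where M1: "\<And>m n. m \<ge> M1 \<Longrightarrow> n \<ge> M1 \<Longrightarrow> \<bar>A (h m) (h m) - A (h n) (h n)\<bar> < e / 2"
      using CA e unfolding Cauchy_def dist_real_def by (meson half_gt_zero)
    obtain M2 where M2: "\<And>n. n \<ge> M2 \<Longrightarrow> B (h n) (h n) < e / 8"
      using order_tendstoD(2)[OF B0, of "e / 8"] e unfolding eventually_sequentially by auto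
    have "N (\<lambda>x. h m x - h n x) < e" if "m \<ge> max M1 M2" "n \<ge> max M1 M2" for m n
    proof -
      have "A (\<lambda>x. h m x - h n x) (\<lambda>x. h m x - h n x) = \<bar>A (h m) (h m) - A (h n) (h n)\<bar>"
      proof (cases "m \<le> n")
        case True
        then show ?thesis using dec[OF True] A.nonneg[OF A.diff_mem[OF hV hV], of m n] by simp
      next
        case False
        then show ?thesis using dec[of n m] A.nonneg[OF A.diff_mem[OF hV hV], of n m]
            A.quadratic_diff[OF hV hV, of n m] A.quadratic_diff[OF hV hV, of m n] A.sym[OF hV hV, of n m] by simp
      qed
      then have 1: "A (\<lambda>x. h m x - h n x) (\<lambda>x. h m x - h n x) < e / 2" using M1 that by simp
      have "B (\<lambda>x. h m x - h n x) (\<lambda>x. h m x - h n x) \<le> 2 * B (h m) (h m) + 2 * B (h n) (h n)"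
        using B.quadratic_diff[OF hV hV, of m n] B.quadratic_add[OF hV hV, of m n]
          B.nonneg[OF A.add_mem[OF hV hV], of m n] by simp
      also have "\<dots> < e / 2" using M2[of m] M2[of n] that by simp
      finally show ?thesis using 1 by simp
    qed
    then show ?thesis by blast
  qed
  from complete[OF hV Cauchy] obtain g where g: "g \<in> V"
    and lim: "(\<lambda>n. N (\<lambda>x. h n x - g x)) \<longlonglongrightarrow> 0" by blast
  have "B g g = 0"
    using B.tendsto_quadratic[OF hV g tendsto_parts(2)[OF hV g lim]] B0 LIMSEQ_unique by blast
  then have "A g g = 0" using null_iff[OF g] by simp
  then have "(\<lambda>n. A (h n) (h n)) \<longlonglongrightarrow> 0"
    using A.tendsto_quadratic[OF hV g tendsto_parts(1)[OF hV g lim]] by simp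
  from tendsto_add[OF this B0] show ?thesis by (simp add: h_def)
qed

text \<open>Evaluating \<open>A u (ev i)\<close> by both eigenvalue equations shows that an
  eigenvector for a value outside the range is orthogonal to every \<open>ev i\<close>; all partial
  sums of its expansion are then 0.\<close>

lemma eigenvalue_iff:
  "(\<exists>u\<in>V. (\<forall>v\<in>V. A u v = l * B u v) \<and> B u u \<noteq> 0) \<longleftrightarrow> l \<in> range lam"
proof
  assume "\<exists>u\<in>V. (\<forall>v\<in>V. A u v = l * B u v) \<and> B u u \<noteq> 0"
  then obtain u where u: "u \<in> V" "\<forall>v\<in>V. A u v = l * B u v" "B u u \<noteq> 0" by blast
  show "l \<in> range lam"
  proof (rule ccontr)
    assume "l \<notin> range lam"
    then have "B u (ev i) = 0" for i
      using u(2) ev_props(1)[of i] ev_eigen[OF u(1), of i] A.sym[OF u(1) ev_props(1), of i]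
        B.sym[OF u(1) ev_props(1), of i] by auto
    then have "(\<lambda>n::nat. N u) \<longlonglongrightarrow> 0" using ev_expansion[OF u(1)] by simp
    then have "N u = 0" by (simp add: LIMSEQ_const_iff)
    then show False using u A.nonneg B.nonneg by (metis add_nonneg_eq_0_iff)
  qed
next
  assume "l \<in> range lam"
  then obtain k where "l = lam k" by blast
  then show "\<exists>u\<in>V. (\<forall>v\<in>V. A u v = l * B u v) \<and> B u u \<noteq> 0"
    using ev_props(1) ev_eigen ev_orthonormal[of k k] by (intro bexI[of _ "ev k"]) auto
qed

lemma finite_lam: "finite {j. lam j = l}"
proof -
  obtain n where "\<And>j. j \<ge> n \<Longrightarrow> lam j > l"
    using lam_at_top unfolding filterlim_at_top_dense eventually_sequentially by blast
  then have "{j. lam j = l} \<subseteq> {..<n}" by (force simp: not_le[symmetric])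
  then show ?thesis using finite_subset by blast
qed

text \<open>Coefficients belonging to other eigenvalues vanish, so the expansion is eventually
  constant and its limit statement becomes an identity, up to a null vector.\<close>

lemma eigenvector_expansion:
  assumes u: "u \<in> V" and eig: "\<forall>v\<in>V. A u v = l * B u v"
    and e: "bij_betw e {..<m::nat} {j. lam j = l}"
  shows "B (\<lambda>x. u x - (\<Sum>i<m. B u (ev (e i)) * ev (e i) x))
    (\<lambda>x. u x - (\<Sum>i<m. B u (ev (e i)) * ev (e i) x)) = 0"
proof -
  let ?J = "{j. lam j = l}"
  have z: "B u (ev j) = 0" if "j \<notin> ?J" for j
    using eig ev_props(1)[of j] ev_eigen[OF u, of j] A.sym[OF u ev_props(1), of j]
      B.sym[OF u ev_props(1), of j] that by auto
  obtain K where K: "?J \<subseteq> {..<K}" using finite_lam finite_nat_iff_bounded by blast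
  have eq: "(\<Sum>i<m. B u (ev (e i)) * ev (e i) x) = (\<Sum>i<n. B u (ev i) * ev i x)" if "n \<ge> K" for n x
  proof -
    have "(\<Sum>i<m. B u (ev (e i)) * ev (e i) x) = (\<Sum>j\<in>?J. B u (ev j) * ev j x)"
      using sum.reindex_bij_betw[OF e, of "\<lambda>j. B u (ev j) * ev j x"] .
    also have "\<dots> = (\<Sum>i<n. B u (ev i) * ev i x)"
      using K that z by (intro sum.mono_neutral_left) auto
    finally show ?thesis .
  qed
  let ?g = "\<lambda>x. u x - (\<Sum>i<m. B u (ev (e i)) * ev (e i) x)"
  have "(\<lambda>n. N ?g) \<longlonglongrightarrow> 0"
    by (rule Lim_transform_eventually[OF ev_expansion[OF u]])
      (use eq in \<open>auto simp: eventually_sequentially intro!: exI[of _ K]\<close>)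
  then have N0: "N ?g = 0" by (simp add: LIMSEQ_const_iff)
  have "?g \<in> V" using A.diff_mem[OF u A.sum_mem[of m "\<lambda>i. ev (e i)"]] ev_props(1) by simp
  from A.nonneg[OF this] B.nonneg[OF this] N0 show ?thesis by linarith
qed

end

section \<open>Smooth functions\<close>

lemma C_k_SucI:
  assumes "\<And>x. (f has_derivative D x) (at x)" and "\<And>b. b \<in> Basis \<Longrightarrow> C_k k (\<lambda>x. D x b)"
  shows "C_k (Suc k) f"
proof -
  have "frechet_derivative f (at x) = D x" for x using frechet_derivative_at[OF assms(1)] by simp
  then show ?thesis
    using assms by (auto simp: differentiable_on_def differentiable_def intro: has_derivative_at_withinI)
qed

lemma C_k_SucD:
  assumes "C_k (Suc k) f"
  shows "(f has_derivative frechet_derivative f (at x)) (at x)"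
    and "b \<in> Basis \<Longrightarrow> C_k k (\<lambda>x. frechet_derivative f (at x) b)"
  using assms by (auto simp: differentiable_on_def frechet_derivative_works[symmetric])

lemma C_k_Suc_imp: "C_k (Suc k) f \<Longrightarrow> C_k k f"
proof (induction k arbitrary: f)
  case 0
  then show ?case using differentiable_imp_continuous_on by auto
next
  case (Suc k)
  show ?case by (rule C_k_SucI[OF C_k_SucD(1)[OF Suc.prems] Suc.IH[OF C_k_SucD(2)[OF Suc.prems]]])
qed

lemma C_k_const: "C_k k (\<lambda>x. c)"
proof (induction k arbitrary: c)
  case (Suc k)
  show ?case by (rule C_k_SucI[where D = "\<lambda>x y. 0"]) (auto intro: Suc)
qed auto

lemma C_k_add: "C_k k f \<Longrightarrow> C_k k g \<Longrightarrow> C_k k (\<lambda>x. f x + g x)"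
proof (induction k arbitrary: f g)
  case 0
  then show ?case by (auto intro: continuous_on_add)
next
  case (Suc k)
  show ?case
    by (rule C_k_SucI[OF has_derivative_add[OF C_k_SucD(1)[OF Suc.prems(1)] C_k_SucD(1)[OF Suc.prems(2)]]])
      (intro Suc.IH C_k_SucD(2) Suc.prems)
qed

lemma C_k_mult: "C_k k f \<Longrightarrow> C_k k g \<Longrightarrow> C_k k (\<lambda>x. f x * g x)"
proof (induction k arbitrary: f g)
  case 0
  then show ?case by (auto intro: continuous_on_mult)
next
  case (Suc k)
  show ?case
    by (rule C_k_SucI[OF has_derivative_mult[OF C_k_SucD(1)[OF Suc.prems(1)] C_k_SucD(1)[OF Suc.prems(2)]]])
      (intro C_k_add Suc.IH C_k_SucD(2)[OF Suc.prems(1)] C_k_SucD(2)[OF Suc.prems(2)]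
        C_k_Suc_imp[OF Suc.prems(1)] C_k_Suc_imp[OF Suc.prems(2)])
qed

lemma C_k_prod: "finite S \<Longrightarrow> (\<And>i. i \<in> S \<Longrightarrow> C_k k (f i)) \<Longrightarrow> C_k k (\<lambda>x. \<Prod>i\<in>S. f i x)"
  by (induction S rule: finite_induct) (auto intro: C_k_const C_k_mult)

lemma C_k_compose_inner:
  fixes \<rho> :: "real \<Rightarrow> real" and b :: "'a::euclidean_space"
  shows "C_k k \<rho> \<Longrightarrow> C_k k (\<lambda>x. \<rho> (c * (x \<bullet> b) + d))"
proof (induction k arbitrary: \<rho>)
  case 0
  then show ?case by (auto intro!: continuous_intros elim: continuous_on_compose2)
next
  case (Suc k)
  let ?D = "\<lambda>t. frechet_derivative \<rho> (at t)"
  have lin: "?D t s = s * ?D t 1" for t s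
    using linear_cmul[OF has_derivative_linear[OF C_k_SucD(1)[OF Suc.prems]], of t s 1] by simp
  have der: "((\<lambda>x. \<rho> (c * (x \<bullet> b) + d)) has_derivative (\<lambda>h. c * (h \<bullet> b) * ?D (c * (x \<bullet> b) + d) 1)) (at x)" for x
  proof -
    have "((\<lambda>x. c * (x \<bullet> b) + d) has_derivative (\<lambda>h. c * (h \<bullet> b))) (at x)"
      by (auto intro!: derivative_eq_intros)
    from has_derivative_compose[OF this C_k_SucD(1)[OF Suc.prems]]
    show ?thesis by (subst (asm) lin) simp
  qed
  show ?case
    by (rule C_k_SucI[OF der]) (intro C_k_mult C_k_const Suc.IH C_k_SucD(2)[OF Suc.prems]; simp)
qed

text \<open>A family containing exp(-1/t) that is closed under differentiation, so that one
  induction over all \<open>p\<close> proves smoothness.\<close>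

definition flat_exp :: "real poly \<Rightarrow> real \<Rightarrow> real" where
  "flat_exp p t = (if t > 0 then poly p (1 / t) * exp (- (1 / t)) else 0)"

lemma poly_times_exp_tendsto_0: "((\<lambda>s. poly p s * exp (- s)) \<longlongrightarrow> (0::real)) at_top"
proof -
  have "((\<lambda>s. \<Sum>i\<le>degree p. coeff p i * (s ^ i / exp s)) \<longlongrightarrow> (\<Sum>i\<le>degree p. coeff p i * 0)) at_top"
    by (intro tendsto_intros tendsto_power_div_exp_0)
  then show ?thesis by (simp add: poly_altdef sum_distrib_right exp_minus divide_inverse mult.assoc)
qed

text \<open>With s = 1/t the derivative in t is -s^2 times the derivative in s, which sends p(s)
  exp(-s) to s^2 (p - p')(s) exp(-s); the polynomial \<open>[:0, 0, 1:]\<close> is s^2.\<close>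

lemma flat_exp_deriv:
  "(flat_exp p has_real_derivative flat_exp ([:0, 0, 1:] * (p - pderiv p)) t) (at t)"
proof -
  consider "t < 0" | "t > 0" | "t = 0" by linarith
  then show ?thesis
  proof cases
    case 1
    have ev: "eventually (\<lambda>s. s \<in> {..<0}) (nhds t)" using 1 by (intro eventually_nhds_in_open) auto
    have "(flat_exp p has_real_derivative 0) (at t) \<longleftrightarrow> ((\<lambda>s. 0) has_real_derivative 0) (at t)"
      by (intro DERIV_cong_ev refl eventually_mono[OF ev]) (auto simp: flat_exp_def)
    then show ?thesis using 1 by (simp add: flat_exp_def)
  next
    case 2
    have ev: "eventually (\<lambda>s. s \<in> {0<..}) (nhds t)" using 2 by (intro eventually_nhds_in_open) auto
    let ?d = "poly (pderiv p) (1 / t) * (- (1 / t\<^sup>2)) * exp (- (1 / t)) + poly p (1 / t) * (exp (- (1 / t)) * (1 / t\<^sup>2))"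
    have i: "((\<lambda>s. 1 / s) has_real_derivative - (1 / t\<^sup>2)) (at t)"
      using 2 by (auto intro!: derivative_eq_intros simp: power2_eq_square)
    have "((\<lambda>s. poly p (1 / s)) has_real_derivative poly (pderiv p) (1 / t) * (- (1 / t\<^sup>2))) (at t)"
      by (rule DERIV_chain2[OF poly_DERIV i])
    moreover have "((\<lambda>s. exp (- (1 / s))) has_real_derivative exp (- (1 / t)) * (1 / t\<^sup>2)) (at t)"
      using DERIV_chain2[OF DERIV_exp DERIV_minus[OF i]] by simp
    ultimately have "((\<lambda>s. poly p (1 / s) * exp (- (1 / s))) has_real_derivative ?d) (at t)"
      by (rule DERIV_cong[OF DERIV_mult]) (simp add: algebra_simps)
    moreover have "(flat_exp p has_real_derivative ?d) (at t) \<longleftrightarrow>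
      ((\<lambda>s. poly p (1 / s) * exp (- (1 / s))) has_real_derivative ?d) (at t)"
      by (intro DERIV_cong_ev refl eventually_mono[OF ev]) (auto simp: flat_exp_def)
    moreover have "?d = flat_exp ([:0, 0, 1:] * (p - pderiv p)) t"
      using 2 by (simp add: flat_exp_def algebra_simps power2_eq_square)
    ultimately show ?thesis by simp
  next
    case 3
    have r: "((\<lambda>s. (flat_exp p s - flat_exp p 0) / s) \<longlongrightarrow> 0) (at_right 0)"
    proof -
      \<comment> \<open>Dividing by t multiplies by s = 1/t, hence the shift
        \<open>pCons 0 p\<close>; exponential decay beats every polynomial.\<close>
      have "((\<lambda>s. poly (pCons 0 p) (inverse s) * exp (- inverse s)) \<longlongrightarrow> 0) (at_right (0::real))"
        by (rule filterlim_compose[OF poly_times_exp_tendsto_0 filterlim_inverse_at_top_right])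
      then show ?thesis
        by (rule Lim_transform_eventually)
          (auto simp: flat_exp_def eventually_at_right_less field_simps intro!: eventually_mono[OF eventually_at_right_less[of 0]])
    qed
    have l: "((\<lambda>s. (flat_exp p s - flat_exp p 0) / s) \<longlongrightarrow> 0) (at_left 0)"
      by (rule Lim_transform_eventually[OF tendsto_const])
        (auto simp: flat_exp_def eventually_at_filter)
    have "((\<lambda>s. (flat_exp p s - flat_exp p 0) / s) \<longlongrightarrow> 0) (at 0)"
      using l r by (simp add: filterlim_split_at)
    then show ?thesis using 3 by (simp add: has_field_derivative_iff flat_exp_def)
  qed
qed

lemma C_k_flat_exp: "C_k k (flat_exp p)"
proof (induction k arbitrary: p)
  case 0
  show ?case using DERIV_isCont[OF flat_exp_deriv] by (auto simp: continuous_on_eq_continuous_at)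
next
  case (Suc k)
  have "(flat_exp p has_derivative (\<lambda>h. flat_exp ([:0, 0, 1:] * (p - pderiv p)) x * h)) (at x)" for x
    using flat_exp_deriv[of p x] by (simp add: has_field_derivative_def)
  then show ?case by (rule C_k_SucI) (use Suc in auto)
qed

definition smooth_step :: "real \<Rightarrow> real" where "smooth_step = flat_exp 1"

lemma smooth_step_props: "0 \<le> smooth_step t" "smooth_step t \<le> 1" "smooth_step t \<noteq> 0 \<longleftrightarrow> t > 0"
  by (auto simp: smooth_step_def flat_exp_def)

lemma smooth_step_limit: "t > 0 \<Longrightarrow> (\<lambda>m. smooth_step (real (Suc m) * t)) \<longlonglongrightarrow> 1"
proof -
  assume t: "t > 0"
  have "(\<lambda>m. exp (- (1 / t * inverse (real (Suc m))))) \<longlonglongrightarrow> exp (- (1 / t * 0))"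
    by (intro tendsto_intros LIMSEQ_inverse_real_of_nat)
  moreover have "smooth_step (real (Suc m) * t) = exp (- (1 / t * inverse (real (Suc m))))" for m
    using t by (simp add: smooth_step_def flat_exp_def divide_inverse mult.commute)
  ultimately show ?thesis by simp
qed

text \<open>A smooth approximation of the indicator of a box. The factor \<open>Suc m\<close>
  steepens the flanks while the set of nonzero values is exactly the open box for every
  \<open>m\<close>, so the support never leaves the closed box.\<close>

definition bump :: "'a::euclidean_space \<Rightarrow> 'a \<Rightarrow> nat \<Rightarrow> 'a \<Rightarrow> real" where
  "bump a b m x = (\<Prod>i\<in>Basis. smooth_step (real (Suc m) * (x \<bullet> i - a \<bullet> i)) * smooth_step (real (Suc m) * (b \<bullet> i - x \<bullet> i)))"

lemma C_k_bump: "C_k k (bump a b m)"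
proof -
  have "C_k k (\<lambda>x. smooth_step (c * (x \<bullet> i) + d))" for c d :: real and i :: 'a
    unfolding smooth_step_def by (rule C_k_compose_inner[OF C_k_flat_exp])
  from this[of "real (Suc m)" _ "- (real (Suc m) * (a \<bullet> _))"] this[of "- real (Suc m)" _ "real (Suc m) * (b \<bullet> _)"]
  have "C_k k (\<lambda>x. smooth_step (real (Suc m) * (x \<bullet> i - a \<bullet> i)))" "C_k k (\<lambda>x. smooth_step (real (Suc m) * (b \<bullet> i - x \<bullet> i)))" for i :: 'a
    by (simp_all add: algebra_simps)
  then show ?thesis unfolding bump_def by (intro C_k_prod C_k_mult) auto
qed

lemma bump_nonzero: "bump a b m x \<noteq> 0 \<longleftrightarrow> x \<in> box a b"
  by (auto simp: bump_def smooth_step_props mem_box zero_less_mult_iff)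

lemma bump_bounds: "0 \<le> bump a b m x" "bump a b m x \<le> 1"
  unfolding bump_def by (auto intro!: prod_nonneg prod_le_1 mult_nonneg_nonneg mult_le_one smooth_step_props)

lemma bump_limit: "(\<lambda>m. bump a b m x) \<longlonglongrightarrow> indicator (box a b) x"
proof (cases "x \<in> box a b")
  case True
  have "(\<lambda>m. bump a b m x) \<longlonglongrightarrow> (\<Prod>i\<in>(Basis::'a set). 1 * 1)"
    unfolding bump_def using True by (intro tendsto_intros smooth_step_limit) (auto simp: mem_box)
  then show ?thesis using True by simp
next
  case False
  then have "bump a b m x = 0" for m using bump_nonzero by blast
  then show ?thesis using False by simp
qed

lemma bump_test_function:
  assumes "cbox a b \<subseteq> \<Omega>" shows "bump a b m \<in> test_functions \<Omega>"
proof -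
  have "{x. bump a b m x \<noteq> 0} = box a b" using bump_nonzero by auto
  moreover have "closure (box a b) \<subseteq> cbox a b"
    by (intro closure_minimal box_subset_cbox closed_cbox)
  ultimately show ?thesis using assms C_k_bump bounded_box
    by (auto simp: test_functions_def compact_eq_bounded_closed bounded_closure)
qed

section \<open>Test functions and integration by parts\<close>

lemma test_function_has_derivative:
  assumes "\<phi> \<in> test_functions \<Omega>"
  shows "(\<phi> has_derivative frechet_derivative \<phi> (at x)) (at x)"
proof -
  have "C_k (Suc 0) \<phi>" using assms unfolding test_functions_def by blast
  from C_k_SucD(1)[OF this] show ?thesis .
qed

lemma test_function_continuous: "\<phi> \<in> test_functions \<Omega> \<Longrightarrow> continuous_on UNIV \<phi>"
  unfolding test_functions_def using C_k.simps(1) by blast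

lemma test_function_derivative_components:
  assumes "\<phi> \<in> test_functions \<Omega>"
  shows "frechet_derivative \<phi> (at x) v = (\<Sum>b\<in>Basis. (v \<bullet> b) * frechet_derivative \<phi> (at x) b)"
proof -
  have l: "linear (frechet_derivative \<phi> (at x))"
    using has_derivative_linear[OF test_function_has_derivative[OF assms]] .
  have "frechet_derivative \<phi> (at x) v = frechet_derivative \<phi> (at x) (\<Sum>b\<in>Basis. (v \<bullet> b) *\<^sub>R b)"
    by (simp add: euclidean_representation)
  then show ?thesis by (simp add: linear_sum[OF l] linear_scale[OF l])
qed

lemma test_function_derivative_continuous:
  assumes "\<phi> \<in> test_functions \<Omega>"
  shows "continuous_on UNIV (\<lambda>x. frechet_derivative \<phi> (at x) v)"
proof -
  have c: "continuous_on UNIV (\<lambda>x. frechet_derivative \<phi> (at x) b)" if "b \<in> Basis" for b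
    using assms C_k_SucD(2)[of 0 \<phi> b] that by (auto simp: test_functions_def)
  show ?thesis
    unfolding test_function_derivative_components[OF assms, of _ v] using c by (auto intro!: continuous_intros)
qed

lemma test_function_support:
  assumes "\<phi> \<in> test_functions \<Omega>"
  obtains K where "compact K" "K \<subseteq> \<Omega>" "\<And>x. x \<notin> K \<Longrightarrow> \<phi> x = 0"
    "\<And>x v. x \<notin> K \<Longrightarrow> frechet_derivative \<phi> (at x) v = 0"
proof
  let ?K = "closure {x. \<phi> x \<noteq> 0}"
  show "compact ?K" "?K \<subseteq> \<Omega>" using assms unfolding test_functions_def by blast+
  show z: "\<phi> x = 0" if "x \<notin> ?K" for x
    using that closure_subset[of "{x. \<phi> x \<noteq> 0}"] by blast
  show "frechet_derivative \<phi> (at x) v = 0" if x: "x \<notin> ?K" for x v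
  proof -
    have "((\<lambda>x. 0) has_derivative (\<lambda>v. 0)) (at x)" by simp
    then have "(\<phi> has_derivative (\<lambda>v. 0)) (at x)"
    proof (rule has_derivative_transform_within_open)
      show "open (- ?K)" by (intro open_Compl closed_closure)
      show "x \<in> - ?K" using x by blast
      show "0 = \<phi> y" if "y \<in> - ?K" for y using z[of y] that by simp
    qed
    from frechet_derivative_at[OF this] show ?thesis by (metis)
  qed
qed

lemma continuous_compact_support_bounded:
  fixes f :: "'a::euclidean_space \<Rightarrow> real"
  assumes "continuous_on UNIV f" "compact K" "\<And>x. x \<notin> K \<Longrightarrow> f x = 0"
  obtains M where "M \<ge> 0" "\<And>x. \<bar>f x\<bar> \<le> M"
proof -
  have "compact (f ` K)" using assms continuous_on_subset compact_continuous_image by blast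
  then obtain M where M: "\<And>x. x \<in> K \<Longrightarrow> \<bar>f x\<bar> \<le> M"
    using compact_imp_bounded[OF \<open>compact (f ` K)\<close>] unfolding bounded_iff by auto
  have "\<bar>f x\<bar> \<le> \<bar>M\<bar>" for x using M[of x] assms(3)[of x] by (cases "x \<in> K") auto
  then show ?thesis using that[of "\<bar>M\<bar>"] by auto
qed

lemma test_function_bounded:
  assumes "\<phi> \<in> test_functions \<Omega>"
  obtains M where "M \<ge> 0" "\<And>x. \<bar>\<phi> x\<bar> \<le> M"
  using continuous_compact_support_bounded[OF test_function_continuous[OF assms]] test_function_support[OF assms]
  by metis

lemma test_function_derivative_bounded:
  assumes "\<phi> \<in> test_functions \<Omega>"
  obtains M where "M \<ge> 0" "\<And>x. \<bar>frechet_derivative \<phi> (at x) v\<bar> \<le> M"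
  using continuous_compact_support_bounded[OF test_function_derivative_continuous[OF assms]] test_function_support[OF assms]
  by metis

lemma integrable_continuous_compact_support:
  fixes f :: "'a::euclidean_space \<Rightarrow> real"
  assumes "continuous_on UNIV f" "compact K" "\<And>x. x \<notin> K \<Longrightarrow> f x = 0"
  shows "integrable lborel f"
proof -
  have "integrable lborel (\<lambda>x. indicator K x *\<^sub>R f x)"
    using borel_integrable_compact[OF assms(2) continuous_on_subset[OF assms(1)]]
    by (simp add: if_distrib indicator_scaleR_eq_if)
  moreover have "(\<lambda>x. indicator K x *\<^sub>R f x) = f"
    using assms(3) by (auto simp: indicator_def fun_eq_iff)
  ultimately show ?thesis by simp
qed

lemma integral_lborel_shift:
  fixes f :: "'a::euclidean_space \<Rightarrow> real"
  assumes "f \<in> borel_measurable borel"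
  shows "(LINT x|lborel. f (x + v)) = (LINT x|lborel. f x)"
  using integral_distr[of "(+) v" lborel borel f] assms lborel_distr_plus[of v] by (simp add: add.commute)

lemma difference_bound:
  fixes f :: "'a::euclidean_space \<Rightarrow> real"
  assumes "\<And>x. (f has_derivative D x) (at x)" and "\<And>x. \<bar>D x v\<bar> \<le> M"
  shows "\<bar>f (x + t *\<^sub>R v) - f x\<bar> \<le> \<bar>t\<bar> * M"
proof -
  have der: "((\<lambda>s. f (x + s *\<^sub>R v)) has_real_derivative D (x + s *\<^sub>R v) v) (at s)" for s
  proof -
    have "((\<lambda>s. x + s *\<^sub>R v) has_derivative (\<lambda>h. h *\<^sub>R v)) (at s)"
      by (auto intro!: derivative_eq_intros)
    from has_derivative_compose[OF this assms(1)]
    have "((\<lambda>s. f (x + s *\<^sub>R v)) has_derivative (\<lambda>h. D (x + s *\<^sub>R v) (h *\<^sub>R v))) (at s)" .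
    moreover have "D (x + s *\<^sub>R v) (h *\<^sub>R v) = D (x + s *\<^sub>R v) v * h" for h
      using linear_scale[OF has_derivative_linear[OF assms(1)]] by (simp add: mult.commute)
    ultimately show ?thesis by (simp add: has_field_derivative_def)
  qed
  have "norm (f (x + t *\<^sub>R v) - f (x + 0 *\<^sub>R v)) \<le> M * norm (t - 0)"
    by (rule field_differentiable_bound[OF convex_UNIV, where f' = "\<lambda>s. D (x + s *\<^sub>R v) v"])
      (use der assms(2) in \<open>auto intro: has_field_derivative_at_within\<close>)
  then show ?thesis by (simp add: mult.commute)
qed

lemma difference_quotient_tendsto:
  fixes f :: "'a::euclidean_space \<Rightarrow> real"
  assumes "(f has_derivative D) (at x)" and t: "t \<longlonglongrightarrow> 0" "\<And>n. t n \<noteq> 0"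
  shows "(\<lambda>n. (f (x + t n *\<^sub>R v) - f x) / t n) \<longlonglongrightarrow> D v"
proof -
  have "((\<lambda>s. x + s *\<^sub>R v) has_derivative (\<lambda>h. h *\<^sub>R v)) (at 0)"
    by (auto intro!: derivative_eq_intros)
  then have "((\<lambda>s. f (x + s *\<^sub>R v)) has_derivative (\<lambda>h. D (h *\<^sub>R v))) (at 0)"
    using has_derivative_compose[of "\<lambda>s. x + s *\<^sub>R v" _ 0 UNIV f D] assms(1) by simp
  moreover have "D (h *\<^sub>R v) = D v * h" for h
    using linear_scale[OF has_derivative_linear[OF assms(1)]] by (simp add: mult.commute)
  ultimately have "((\<lambda>s. f (x + s *\<^sub>R v)) has_real_derivative D v) (at 0)"
    by (simp add: has_field_derivative_def)
  then have "((\<lambda>s. (f (x + s *\<^sub>R v) - f x) / s) \<longlongrightarrow> D v) (at 0)"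
    by (simp add: has_field_derivative_iff)
  then show ?thesis
    using t unfolding tendsto_at_iff_sequentially by (auto simp: o_def)
qed

text \<open>Difference quotients have integral 0 by translation invariance of Lebesgue measure, and
  dominated convergence carries this to the directional derivative.\<close>

lemma integral_derivative_eq_0:
  fixes f :: "'a::euclidean_space \<Rightarrow> real"
  assumes der: "\<And>x. (f has_derivative D x) (at x)" and cont: "continuous_on UNIV (\<lambda>x. D x v)"
    and K: "compact K" "\<And>x. x \<notin> K \<Longrightarrow> f x = 0" "\<And>x. x \<notin> K \<Longrightarrow> D x v = 0"
  shows "(LINT x|lborel. D x v) = 0"
proof -
  obtain M where M: "M \<ge> 0" "\<And>x. \<bar>D x v\<bar> \<le> M"
    using continuous_compact_support_bounded[OF cont K(1,3)] by blast
  obtain R where R: "\<And>x. x \<in> K \<Longrightarrow> norm x \<le> R" using compact_imp_bounded[OF K(1)] unfolding bounded_iff by blast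
  have fc: "continuous_on UNIV f" using has_derivative_continuous[OF der] by (simp add: continuous_on_eq_continuous_within)
  have fi: "integrable lborel f" by (rule integrable_continuous_compact_support[OF fc K(1,2)])
  define t where "t n = inverse (real (Suc n))" for n
  have t0: "t \<longlonglongrightarrow> 0" unfolding t_def using LIMSEQ_inverse_real_of_nat .
  have tn: "t n \<noteq> 0" "\<bar>t n\<bar> \<le> 1" for n by (auto simp: t_def inverse_le_1_iff)
  let ?q = "\<lambda>n x. (f (x + t n *\<^sub>R v) - f x) / t n"
  have [measurable]: "f \<in> borel_measurable borel" "(\<lambda>x. D x v) \<in> borel_measurable borel"
    using fc cont by (auto intro: borel_measurable_continuous_onI)
  have "(\<lambda>n. LINT x|lborel. ?q n x) \<longlonglongrightarrow> (LINT x|lborel. D x v)"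
  \<comment> \<open>The steps satisfy \<open>\<bar>t n\<bar> \<le> 1\<close>, so every quotient
    vanishes outside the ball of radius \<open>R + norm v\<close>; inside it is bounded by the mean
    value estimate.\<close>
  proof (rule integral_dominated_convergence[where w = "\<lambda>x. M * indicator (cball 0 (R + norm v)) x"])
    show "integrable lborel (\<lambda>x::'a. M * indicator (cball 0 (R + norm v)) x)"
      using emeasure_bounded_finite[of "cball 0 (R + norm v) :: 'a set"] by (intro integrable_mult_right integrable_real_indicator) auto
    show "AE x in lborel. (\<lambda>n. ?q n x) \<longlonglongrightarrow> D x v"
      using difference_quotient_tendsto[OF der t0 tn(1)] by simp
    show "AE x in lborel. norm (?q n x) \<le> M * indicator (cball 0 (R + norm v)) x" for n
    proof (rule AE_I2)
      fix x
      show "norm (?q n x) \<le> M * indicator (cball 0 (R + norm v)) x"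
      proof (cases "x \<in> cball 0 (R + norm v)")
        case True
        have "\<bar>f (x + t n *\<^sub>R v) - f x\<bar> \<le> \<bar>t n\<bar> * M" by (rule difference_bound[OF der M(2)])
        then show ?thesis using True tn(1)[of n] by (simp add: field_simps abs_divide)
      next
        case False
        have "norm (t n *\<^sub>R v) \<le> norm v" using tn(2)[of n] by (simp add: mult_left_le_one_le)
        then have "norm x \<le> norm (x + t n *\<^sub>R v) + norm v"
          using norm_triangle_ineq4[of "x + t n *\<^sub>R v" "t n *\<^sub>R v"] by simp
        moreover have "norm x > R + norm v" using False by simp
        ultimately have "x + t n *\<^sub>R v \<notin> K" "x \<notin> K"
          using R[of x] R[of "x + t n *\<^sub>R v"] norm_ge_zero[of v] by linarith+
        then show ?thesis using K(2) M(1) by (simp add: indicator_def)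
      qed
    qed
  qed measurable
  moreover have "(LINT x|lborel. ?q n x) = 0" for n
  proof -
    have "integrable lborel (\<lambda>x. f (x + t n *\<^sub>R v))"
    proof (rule integrable_continuous_compact_support[where K = "(\<lambda>x. x - t n *\<^sub>R v) ` K"])
      show "continuous_on UNIV (\<lambda>x. f (x + t n *\<^sub>R v))"
        using fc by (auto intro!: continuous_intros elim: continuous_on_compose2)
      show "compact ((\<lambda>x. x - t n *\<^sub>R v) ` K)"
        using K(1) by (intro compact_continuous_image continuous_intros)
      show "f (x + t n *\<^sub>R v) = 0" if "x \<notin> (\<lambda>x. x - t n *\<^sub>R v) ` K" for x
      proof (rule K(2), rule notI)
        assume "x + t n *\<^sub>R v \<in> K"
        then have "(x + t n *\<^sub>R v) - t n *\<^sub>R v \<in> (\<lambda>x. x - t n *\<^sub>R v) ` K" by (rule imageI)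
        then show False using that by simp
      qed
    qed
    then show ?thesis using fi integral_lborel_shift[of f "t n *\<^sub>R v"] by simp
  qed
  ultimately show ?thesis by (simp only: LIMSEQ_const_iff)
qed

lemma integral_lebesgue_on_eq_lborel:
  fixes F :: "'a::euclidean_space \<Rightarrow> real"
  assumes "F \<in> borel_measurable borel" "\<And>x. x \<notin> \<Omega> \<Longrightarrow> F x = 0" "\<Omega> \<in> sets lebesgue"
  shows "(LINT x|lebesgue_on \<Omega>. F x) = (LINT x|lborel. F x)"
    and "integrable (lebesgue_on \<Omega>) F \<longleftrightarrow> integrable lborel F"
proof -
  have eq: "(\<lambda>x. indicator \<Omega> x *\<^sub>R F x) = F"
    using assms(2) by (auto simp: indicator_def fun_eq_iff)
  have F: "F \<in> borel_measurable lborel" using assms(1) by simp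
  show "(LINT x|lebesgue_on \<Omega>. F x) = (LINT x|lborel. F x)"
    using assms(3) eq integral_restrict_space[of \<Omega> lebesgue F] integral_completion[OF F] by simp
  show "integrable (lebesgue_on \<Omega>) F \<longleftrightarrow> integrable lborel F"
    using assms(3) eq integrable_restrict_space[of \<Omega> lebesgue F] integrable_completion[OF F] by simp
qed

lemma test_function_integration_by_parts:
  assumes \<phi>: "\<phi> \<in> test_functions \<Omega>" and \<psi>: "\<psi> \<in> test_functions \<Omega>" and \<Omega>: "\<Omega> \<in> sets lebesgue"
  shows "(LINT x|lebesgue_on \<Omega>. \<phi> x * frechet_derivative \<psi> (at x) b)
    = - (LINT x|lebesgue_on \<Omega>. frechet_derivative \<phi> (at x) b * \<psi> x)"
proof -
  obtain K where K: "compact K" "K \<subseteq> \<Omega>" "\<And>x. x \<notin> K \<Longrightarrow> \<phi> x = 0"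
    "\<And>x v. x \<notin> K \<Longrightarrow> frechet_derivative \<phi> (at x) v = 0" using test_function_support[OF \<phi>] by blast
  note c = test_function_continuous[OF \<phi>] test_function_continuous[OF \<psi>]
    test_function_derivative_continuous[OF \<phi>, of b] test_function_derivative_continuous[OF \<psi>, of b]
  let ?f = "\<lambda>x. \<phi> x * frechet_derivative \<psi> (at x) b" and ?g = "\<lambda>x. frechet_derivative \<phi> (at x) b * \<psi> x"
  have i: "integrable lborel ?f" "integrable lborel ?g"
    by (rule integrable_continuous_compact_support[OF _ K(1)]; use c K in \<open>auto intro!: continuous_intros\<close>)+
  have "(LINT x|lborel. ?f x + ?g x) = 0"
    by (rule integral_derivative_eq_0[OF has_derivative_mult[OF
        test_function_has_derivative[OF \<phi>] test_function_has_derivative[OF \<psi>]], of b K])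
      (use c K in \<open>auto intro!: continuous_intros\<close>)
  then have "(LINT x|lborel. ?f x) = - (LINT x|lborel. ?g x)" using i by simp
  moreover have "(LINT x|lebesgue_on \<Omega>. ?f x) = (LINT x|lborel. ?f x)" "(LINT x|lebesgue_on \<Omega>. ?g x) = (LINT x|lborel. ?g x)"
    using K borel_measurable_integrable[OF i(1)] borel_measurable_integrable[OF i(2)] \<Omega>
    by (intro integral_lebesgue_on_eq_lborel(1); fastforce)+
  ultimately show ?thesis by simp
qed

section \<open>The fundamental lemma of the calculus of variations\<close>

text \<open>Dynkin argument: boxes are stable under intersection and generate the Borel sets, so all
  Borel integrals of \<open>f\<close> vanish and the density \<open>f\<close> agrees with 0.\<close>

lemma AE_zero_if_box_integrals_zero:
  fixes f :: "'a::euclidean_space \<Rightarrow> real"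
  assumes f: "integrable lborel f" and box: "\<And>a b. (LINT x|lborel. indicator (box a b) x * f x) = 0"
  shows "AE x in lborel. f x = 0"
proof -
  have [measurable]: "f \<in> borel_measurable borel" using f by (simp add: borel_measurable_integrable)
  have fi: "integrable lborel (\<lambda>x. indicator A x * f x)" if "A \<in> sets borel" for A
    using integrable_mult_indicator[of A lborel f] f that by simp
  \<comment> \<open>The complement case of the induction needs the integral over the whole space,
    which is reached by exhausting it with boxes.\<close>
  have tot: "(LINT x|lborel. f x) = 0"
  proof -
    have "(\<lambda>n. LINT x|lborel. indicator (box (- (real n *\<^sub>R One)) (real n *\<^sub>R One)) x * f x) \<longlonglongrightarrow> (LINT x|lborel. f x)"
    proof (rule integral_dominated_convergence[where w = "\<lambda>x. \<bar>f x\<bar>"])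
      show "AE x in lborel. (\<lambda>n. indicator (box (- (real n *\<^sub>R One)) (real n *\<^sub>R One)) x * f x) \<longlonglongrightarrow> f x"
      proof (rule AE_I2, rule tendsto_eventually)
        fix x :: 'a
        have "\<exists>N::nat. \<forall>i\<in>Basis. \<bar>x \<bullet> i\<bar> < real N"
        proof -
          obtain N where "norm x < real N" using reals_Archimedean2 by blast
          then show ?thesis by (intro exI[of _ N]) (meson Basis_le_norm order_le_less_trans)
        qed
        then obtain N :: nat where N: "\<And>i. i \<in> Basis \<Longrightarrow> \<bar>x \<bullet> i\<bar> < real N" by blast
        have "x \<in> box (- (real n *\<^sub>R One)) (real n *\<^sub>R One)" if "n \<ge> N" for n
          using N that by (fastforce simp: mem_box abs_less_iff)
        then show "\<forall>\<^sub>F n in sequentially. indicator (box (- (real n *\<^sub>R One)) (real n *\<^sub>R One)) x * f x = f x"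
          unfolding eventually_sequentially by (metis indicator_simps(1) mult_1)
      qed
    qed (use f in \<open>auto simp: indicator_def\<close>)
    then show ?thesis using box by (simp add: LIMSEQ_const_iff)
  qed
  have main: "(LINT x|lborel. indicator A x * f x) = 0" if "A \<in> sigma_sets UNIV (range (\<lambda>(a, b). box a b))" for A :: "'a set"
  proof (rule sigma_sets_induct_disjoint[OF _ _ that])
    show "Int_stable (range (\<lambda>(a, b). box a b :: 'a set))"
      by (auto simp: Int_stable_def box_Int_box)
    have sb: "B \<in> sets borel" if "B \<in> sigma_sets UNIV (range (\<lambda>(a, b). box a b))" for B :: "'a set"
      using that by (simp add: borel_eq_box)
    show "(LINT x|lborel. indicator (UNIV - B) x * f x) = 0"
      if "B \<in> sigma_sets UNIV (range (\<lambda>(a, b). box a b))" "(LINT x|lborel. indicator B x * f x) = 0" for B :: "'a set"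
    proof -
      have "(\<lambda>x. indicator (UNIV - B) x * f x) = (\<lambda>x. f x - indicator B x * f x)"
        by (auto simp: indicator_def)
      then show ?thesis using that f fi[OF sb[OF that(1)]] tot by simp
    qed
    show "(LINT x|lborel. indicator (\<Union>i. B i) x * f x) = 0"
      if B: "disjoint_family B" "range B \<subseteq> sigma_sets UNIV (range (\<lambda>(a, b). box a b))"
        "\<And>i::nat. (LINT x|lborel. indicator (B i) x * f x) = 0" for B :: "nat \<Rightarrow> 'a set"
    proof -
      have "\<And>i. B i \<in> sets lborel" using sb B(2) by auto
      moreover have "set_integrable lborel (\<Union>i. B i) f"
        unfolding set_integrable_def using calculation by (intro integrable_mult_indicator f) auto
      ultimately have "(LINT x:(\<Union>i. B i)|lborel. f x) = (\<Sum>i. (LINT x:(B i)|lborel. f x))"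
        using B(1) by (intro lebesgue_integral_countable_add) (auto simp: disjoint_family_on_def)
      then show ?thesis using B(3) by (simp add: set_lebesgue_integral_def)
    qed
  qed (use box in auto)
  show ?thesis
    by (rule density_unique_real[OF f, of "\<lambda>x. 0"])
      (use main in \<open>auto simp: set_lebesgue_integral_def borel_eq_box\<close>)
qed

text \<open>Inside one closed box contained in \<open>\<Omega>\<close> the global version applies,
  because intersections with further boxes are again boxes inside \<open>\<Omega>\<close>. Countably
  many such boxes cover \<open>\<Omega>\<close>, and their faces are null.\<close>

lemma AE_zero_if_box_integrals_zero_on:
  fixes f :: "'a::euclidean_space \<Rightarrow> real"
  assumes \<Omega>: "open \<Omega>" and f: "integrable (lebesgue_on \<Omega>) f"
    and box: "\<And>a b. cbox a b \<subseteq> \<Omega> \<Longrightarrow> (LINT x|lebesgue_on \<Omega>. indicator (box a b) x * f x) = 0"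
  shows "AE x in lebesgue_on \<Omega>. f x = 0"
proof -
  have \<Omega>s: "\<Omega> \<in> sets lebesgue" using \<Omega> by auto
  have fl: "integrable lebesgue (\<lambda>x. indicator \<Omega> x * f x)"
    using f \<Omega>s integrable_restrict_space[of \<Omega> lebesgue f] by simp
  obtain g where g[measurable]: "g \<in> borel_measurable lborel" and gf: "AE x in lborel. indicator \<Omega> x * f x = g x"
    using completion_ex_borel_measurable_real[OF borel_measurable_integrable[OF fl]] by blast
  have gf': "AE x in lebesgue. indicator \<Omega> x * f x = g x" using gf by (rule AE_completion)
  have gi: "integrable lborel g"
  proof -
    have "integrable lebesgue g"
      using gf' fl integrable_cong_AE_imp[OF fl measurable_completion[OF g]] by (metis (mono_tags, lifting) AE_mp AE_I2)
    then show ?thesis using integrable_completion[OF g] by simp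
  qed
  have z: "AE x in lborel. indicator (box c d) x * g x = 0" if cd: "cbox c d \<subseteq> \<Omega>" for c d
  proof (rule AE_zero_if_box_integrals_zero)
    show "integrable lborel (\<lambda>x. indicator (box c d) x * g x)"
      using integrable_mult_indicator[of "box c d" lborel g] gi by simp
    fix a b
    obtain p q where pq: "box a b \<inter> box c d = box p q" "cbox a b \<inter> cbox c d = cbox p q"
      using Int_interval[of a b c d] box_Int_box[of a b c d] by blast
    have "(LINT x|lborel. indicator (box a b) x * (indicator (box c d) x * g x))
      = (LINT x|lborel. indicator (box p q) x * g x)"
      by (intro arg_cong[of _ _ "integral\<^sup>L lborel"] ext) (auto simp: pq(1)[symmetric] indicator_def)
    also have "\<dots> = (LINT x|lebesgue. indicator (box p q) x * g x)"
      by (rule integral_completion[symmetric]) measurable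
    also have "\<dots> = (LINT x|lebesgue. indicator \<Omega> x *\<^sub>R (indicator (box p q) x * f x))"
    proof (rule integral_cong_AE)
      have "(\<lambda>x. indicator (box p q) x * (indicator \<Omega> x * f x)) \<in> borel_measurable lebesgue"
        by (intro borel_measurable_times[OF borel_measurable_indicator borel_measurable_integrable[OF fl]]) auto
      then show "(\<lambda>x. indicator \<Omega> x *\<^sub>R (indicator (box p q) x * f x)) \<in> borel_measurable lebesgue"
        by (simp add: mult.left_commute)
      show "(\<lambda>x. indicator (box p q) x * g x) \<in> borel_measurable lebesgue"
        by (intro measurable_completion) measurable
      show "AE x in lebesgue. indicator (box p q) x * g x = indicator \<Omega> x *\<^sub>R (indicator (box p q) x * f x)"
        using gf' by eventually_elim auto
    qed
    also have "\<dots> = (LINT x|lebesgue_on \<Omega>. indicator (box p q) x * f x)"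
      using \<Omega>s by (intro integral_restrict_space[symmetric]) simp
    also have "\<dots> = 0" using pq cd by (intro box) blast
    finally show "(LINT x|lborel. indicator (box a b) x * (indicator (box c d) x * g x)) = 0" .
  qed
  obtain \<D> where D: "countable \<D>" "\<D> \<subseteq> Pow \<Omega>" "\<And>X. X \<in> \<D> \<Longrightarrow> \<exists>a b. X = cbox a b" "\<Union>\<D> = \<Omega>"
    using open_countable_Union_open_cbox[OF \<Omega>] by blast
  have "AE x in lebesgue. \<forall>X\<in>\<D>. x \<in> X \<longrightarrow> g x = 0"
  proof (subst AE_ball_countable[OF D(1)], rule ballI)
    fix X assume X: "X \<in> \<D>"
    then obtain c d where cd: "X = cbox c d" "cbox c d \<subseteq> \<Omega>" using D by blast
    have "cbox c d - box c d \<in> null_sets lebesgue"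
      using negligible_frontier_interval negligible_iff_null_sets by blast
    then have "AE x in lebesgue. x \<notin> cbox c d - box c d" by (rule AE_not_in)
    with AE_completion[OF z[OF cd(2)]] show "AE x in lebesgue. x \<in> X \<longrightarrow> g x = 0"
      by eventually_elim (auto simp: cd)
  qed
  with gf' have "AE x in lebesgue. x \<in> \<Omega> \<longrightarrow> f x = 0"
    by eventually_elim (metis D(4) Union_iff indicator_simps(1) mult_1)
  then show ?thesis using \<Omega>s AE_restrict_space_iff[of \<Omega> lebesgue] by simp
qed

lemma bump_integral_limit:
  assumes u: "integrable (lebesgue_on \<Omega>) u" and ab: "cbox a b \<subseteq> \<Omega>"
  shows "(\<lambda>m. LINT x|lebesgue_on \<Omega>. u x * bump a b m x) \<longlonglongrightarrow> (LINT x|lebesgue_on \<Omega>. u x * indicator (box a b) x)"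
proof (rule integral_dominated_convergence[where w = "\<lambda>x. \<bar>u x\<bar>"])
  have [measurable]: "u \<in> borel_measurable (lebesgue_on \<Omega>)" using u by auto
  have [measurable]: "indicator (box a b) \<in> borel_measurable (lebesgue_on \<Omega>)"
    by (intro measurable_restrict_space1 measurable_completion borel_measurable_indicator) auto
  have [measurable]: "bump a b m \<in> borel_measurable (lebesgue_on \<Omega>)" for m
    using borel_measurable_continuous_onI[OF test_function_continuous[OF bump_test_function[OF ab, of m]]]
    by (intro measurable_restrict_space1 measurable_completion) simp
  show "(\<lambda>x. u x * indicator (box a b) x) \<in> borel_measurable (lebesgue_on \<Omega>)" by measurable
  show "(\<lambda>x. u x * bump a b m x) \<in> borel_measurable (lebesgue_on \<Omega>)" for m by measurable
  show "AE x in lebesgue_on \<Omega>. (\<lambda>m. u x * bump a b m x) \<longlonglongrightarrow> u x * indicator (box a b) x"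
    by (intro AE_I2 tendsto_mult tendsto_const bump_limit)
  show "AE x in lebesgue_on \<Omega>. norm (u x * bump a b m x) \<le> \<bar>u x\<bar>" for m
    by (intro AE_I2) (simp add: abs_mult mult_left_le bump_bounds)
qed (use u in simp)

lemma fundamental_lemma:
  fixes f :: "'a::euclidean_space \<Rightarrow> real"
  assumes \<Omega>: "open \<Omega>" and f: "integrable (lebesgue_on \<Omega>) f"
    and test: "\<And>\<phi>. \<phi> \<in> test_functions \<Omega> \<Longrightarrow> (LINT x|lebesgue_on \<Omega>. f x * \<phi> x) = 0"
  shows "AE x in lebesgue_on \<Omega>. f x = 0"
proof (rule AE_zero_if_box_integrals_zero_on[OF \<Omega> f])
  fix a b assume ab: "cbox a b \<subseteq> \<Omega>"
  have "(LINT x|lebesgue_on \<Omega>. f x * indicator (box a b) x) = 0"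
    using bump_integral_limit[OF f ab] test[OF bump_test_function[OF ab]] by (simp add: LIMSEQ_const_iff)
  then show "(LINT x|lebesgue_on \<Omega>. indicator (box a b) x * f x) = 0" by (simp add: mult.commute)
qed

section \<open>The Hilbert space of square integrable functions\<close>

text \<open>The weighted inequality of arithmetic and geometric means; the free parameter
  \<open>t\<close> takes the place of the square root in Hoelder's inequality.\<close>

lemma integrable_abs_if_square_integrable:
  fixes h :: "'b \<Rightarrow> real"
  assumes "finite_measure M" "h \<in> borel_measurable M" "integrable M (\<lambda>x. (h x)\<^sup>2)"
  shows "integrable M h" and "t > 0 \<Longrightarrow> (LINT x|M. \<bar>h x\<bar>) \<le> t * (LINT x|M. (h x)\<^sup>2) + measure M (space M) / t"
proof -
  interpret finite_measure M by fact
  have amgm: "\<bar>y\<bar> \<le> t * y\<^sup>2 + 1 / t" if t: "t > 0" for t y :: real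
  proof -
    have "0 \<le> (t * \<bar>y\<bar> - 1)\<^sup>2" by simp
    then have "2 * (t * \<bar>y\<bar>) \<le> t\<^sup>2 * y\<^sup>2 + 1" by (simp add: power2_diff power_mult_distrib)
    moreover have "0 \<le> t * \<bar>y\<bar>" using t by simp
    ultimately have "t * \<bar>y\<bar> \<le> t\<^sup>2 * y\<^sup>2 + 1" by linarith
    also have "\<dots> = t * (t * y\<^sup>2 + 1 / t)" using t by (simp add: algebra_simps power2_eq_square)
    finally have "t * \<bar>y\<bar> \<le> t * (t * y\<^sup>2 + 1 / t)" .
    then show ?thesis using t by simp
  qed
  show i: "integrable M h"
    by (rule Bochner_Integration.integrable_bound[of M "\<lambda>x. 1 * (h x)\<^sup>2 + 1 / 1"])
      (use assms amgm[of 1] in \<open>auto intro!: AE_I2 order_trans[OF amgm[of 1]]\<close>)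
  show "(LINT x|M. \<bar>h x\<bar>) \<le> t * (LINT x|M. (h x)\<^sup>2) + measure M (space M) / t" if t: "t > 0"
  proof -
    have "(LINT x|M. \<bar>h x\<bar>) \<le> (LINT x|M. t * (h x)\<^sup>2 + 1 / t)"
      using i assms(3) by (intro integral_mono amgm t) auto
    also have "\<dots> = t * (LINT x|M. (h x)\<^sup>2) + measure M (space M) / t"
      using assms(3) by simp
    finally show ?thesis .
  qed
qed

lemma integrable_mult_if_square_integrable:
  fixes f g :: "'b \<Rightarrow> real"
  assumes "f \<in> borel_measurable M" "integrable M (\<lambda>x. (f x)\<^sup>2)"
    and "g \<in> borel_measurable M" "integrable M (\<lambda>x. (g x)\<^sup>2)"
  shows "integrable M (\<lambda>x. f x * g x)"
proof (rule Bochner_Integration.integrable_bound[of M "\<lambda>x. (f x)\<^sup>2 + (g x)\<^sup>2"])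
  show "AE x in M. norm (f x * g x) \<le> norm ((f x)\<^sup>2 + (g x)\<^sup>2)"
  proof (rule AE_I2)
    fix x
    have "0 \<le> (\<bar>f x\<bar> - \<bar>g x\<bar>)\<^sup>2" by simp
    then have "2 * (\<bar>f x\<bar> * \<bar>g x\<bar>) \<le> (f x)\<^sup>2 + (g x)\<^sup>2" by (simp add: power2_diff)
    moreover have "0 \<le> \<bar>f x\<bar> * \<bar>g x\<bar>" by simp
    ultimately have "\<bar>f x\<bar> * \<bar>g x\<bar> \<le> (f x)\<^sup>2 + (g x)\<^sup>2" by linarith
    then show "norm (f x * g x) \<le> norm ((f x)\<^sup>2 + (g x)\<^sup>2)" by (simp add: abs_mult)
  qed
qed (use assms in auto)

lemma square_integrable_lin:
  fixes f g :: "'b \<Rightarrow> real"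
  assumes "f \<in> borel_measurable M" "integrable M (\<lambda>x. (f x)\<^sup>2)"
    and "g \<in> borel_measurable M" "integrable M (\<lambda>x. (g x)\<^sup>2)"
  shows "integrable M (\<lambda>x. (f x + c * g x)\<^sup>2)"
proof -
  have "(\<lambda>x. (f x + c * g x)\<^sup>2) = (\<lambda>x. (f x)\<^sup>2 + 2 * c * (f x * g x) + c\<^sup>2 * (g x)\<^sup>2)"
    by (auto simp: power2_eq_square algebra_simps)
  then show ?thesis using integrable_mult_if_square_integrable[OF assms] assms by simp
qed

text \<open>Riesz-Fischer: on a finite measure space the sequence is Cauchy in the mean, a
  subsequence converges almost everywhere, and Fatou's lemma transfers the quadratic estimates to
  the limit.\<close>

lemma square_integrable_complete:
  fixes f :: "nat \<Rightarrow> 'b \<Rightarrow> real"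
  assumes fin: "finite_measure M"
    and f[measurable]: "\<And>n. f n \<in> borel_measurable M" and sq: "\<And>n. integrable M (\<lambda>x. (f n x)\<^sup>2)"
    and Cauchy: "\<And>e. e > 0 \<Longrightarrow> \<exists>K. \<forall>m\<ge>K. \<forall>n\<ge>K. (LINT x|M. (f m x - f n x)\<^sup>2) < e"
  shows "\<exists>g. g \<in> borel_measurable M \<and> integrable M (\<lambda>x. (g x)\<^sup>2) \<and> (\<lambda>n. LINT x|M. (f n x - g x)\<^sup>2) \<longlonglongrightarrow> 0"
proof -
  interpret finite_measure M by fact
  have dsq: "integrable M (\<lambda>x. (f m x - f n x)\<^sup>2)" for m n
    using square_integrable_lin[OF f sq f sq, of m "-1" n] by simp
  have "\<exists>K. \<forall>i\<ge>K. \<forall>j\<ge>K. (LINT x|M. norm (f i x - f j x)) < e" if e: "e > 0" for e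
  proof -
    \<comment> \<open>This makes the term \<open>measure M (space M) / t\<close> at most
      \<open>e / 2\<close>; the summand 1 keeps \<open>t\<close> positive for a null
      measure.\<close>
    define t where "t = 2 * (measure M (space M) + 1) / e"
    have t: "t > 0" using e measure_nonneg[of M "space M"] unfolding t_def
      by (intro divide_pos_pos mult_pos_pos add_nonneg_pos) auto
    obtain K where K: "\<forall>m\<ge>K. \<forall>n\<ge>K. (LINT x|M. (f m x - f n x)\<^sup>2) < e / (2 * t)"
      using Cauchy[of "e / (2 * t)"] e t by auto
    have "(LINT x|M. norm (f i x - f j x)) < e" if "i \<ge> K" "j \<ge> K" for i j
    proof -
      have "(LINT x|M. \<bar>f i x - f j x\<bar>) \<le> t * (LINT x|M. (f i x - f j x)\<^sup>2) + measure M (space M) / t"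
        using dsq by (intro integrable_abs_if_square_integrable(2) fin t) auto
      moreover have "t * (LINT x|M. (f i x - f j x)\<^sup>2) < t * (e / (2 * t))"
        using K that t by (intro mult_strict_left_mono) auto
      moreover have "measure M (space M) / t \<le> e / 2"
      proof -
        have "p / (2 * (p + 1) / e) \<le> e / 2" if "p \<ge> 0" for p :: real
        proof -
          have "p / (2 * (p + 1) / e) = e / 2 * (p / (p + 1))" by simp
          also have "\<dots> \<le> e / 2 * 1" using e that by (intro mult_left_mono) auto
          finally show ?thesis by simp
        qed
        then show ?thesis unfolding t_def by simp
      qed
      moreover have "t * (e / (2 * t)) = e / 2" using t by simp
      ultimately have "(LINT x|M. \<bar>f i x - f j x\<bar>) < e" by linarith
      then show ?thesis by simp
    qed
    then show ?thesis by blast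
  qed
  moreover have "integrable M (f n)" for n
    by (rule integrable_abs_if_square_integrable(1)[OF fin f sq])
  ultimately obtain r where r: "strict_mono r" "AE x in M. Cauchy (\<lambda>i. f (r i) x)"
    using cauchy_L1_AE_cauchy_subseq[of M f] by blast
  define g where "g x = lim (\<lambda>i. f (r i) x)" for x
  have [measurable]: "g \<in> borel_measurable M" unfolding g_def by measurable
  have conv: "AE x in M. (\<lambda>i. f (r i) x) \<longlonglongrightarrow> g x"
    using r(2) by eventually_elim (simp add: g_def Cauchy_convergent_iff convergent_LIMSEQ_iff)
  have bound: "(\<integral>\<^sup>+ x. ennreal ((f n x - g x)\<^sup>2) \<partial>M) \<le> ennreal e"
    if K: "\<And>m. m \<ge> K \<Longrightarrow> (LINT x|M. (f n x - f m x)\<^sup>2) < e" for n K e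
  proof -
    have "(\<integral>\<^sup>+ x. ennreal ((f n x - g x)\<^sup>2) \<partial>M) = (\<integral>\<^sup>+ x. liminf (\<lambda>i. ennreal ((f n x - f (r i) x)\<^sup>2)) \<partial>M)"
    proof (rule nn_integral_cong_AE)
      show "AE x in M. ennreal ((f n x - g x)\<^sup>2) = liminf (\<lambda>i. ennreal ((f n x - f (r i) x)\<^sup>2))"
        using conv
      proof eventually_elim
        case (elim x)
        have "(\<lambda>i. ennreal ((f n x - f (r i) x)\<^sup>2)) \<longlonglongrightarrow> ennreal ((f n x - g x)\<^sup>2)"
          by (intro tendsto_ennrealI tendsto_intros elim)
        from lim_imp_Liminf[OF _ this] show ?case by simp
      qed
    qed
    also have "\<dots> \<le> liminf (\<lambda>i. \<integral>\<^sup>+ x. ennreal ((f n x - f (r i) x)\<^sup>2) \<partial>M)"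
      by (rule nn_integral_liminf) measurable
    also have "\<dots> \<le> ennreal e"
    proof (rule Liminf_le)
      have "(\<integral>\<^sup>+ x. ennreal ((f n x - f (r i) x)\<^sup>2) \<partial>M) \<le> ennreal e" if "i \<ge> K" for i
      proof -
        have "r i \<ge> K" using that strict_mono_imp_increasing[OF r(1), of i] by linarith
        then show ?thesis using K[of "r i"] dsq by (simp add: nn_integral_eq_integral ennreal_leI)
      qed
      then show "\<forall>\<^sub>F i in sequentially. (\<integral>\<^sup>+ x. ennreal ((f n x - f (r i) x)\<^sup>2) \<partial>M) \<le> ennreal e"
        unfolding eventually_sequentially by blast
    qed simp
    finally show ?thesis .
  qed
  have fg: "integrable M (\<lambda>x. (f n x - g x)\<^sup>2)" if "\<And>m. m \<ge> K \<Longrightarrow> (LINT x|M. (f n x - f m x)\<^sup>2) < e" for n K e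
    using bound[OF that] by (intro integrableI_bounded) (auto simp: top_unique less_top[symmetric])
  obtain K1 where K1: "\<forall>m\<ge>K1. \<forall>n\<ge>K1. (LINT x|M. (f m x - f n x)\<^sup>2) < 1" using Cauchy[of 1] by auto
  have g2: "integrable M (\<lambda>x. (g x)\<^sup>2)"
    using square_integrable_lin[of "f K1" M "\<lambda>x. f K1 x - g x" "-1"] sq fg[of K1 K1 1] K1 by simp
  have fg': "integrable M (\<lambda>x. (f n x - g x)\<^sup>2)" for n
    using square_integrable_lin[of "f n" M g "-1"] sq g2 by simp
  have "(\<lambda>n. LINT x|M. (f n x - g x)\<^sup>2) \<longlonglongrightarrow> 0"
  proof (rule LIMSEQ_I)
    fix e :: real assume e: "e > 0"
    obtain K where K: "\<forall>m\<ge>K. \<forall>n\<ge>K. (LINT x|M. (f m x - f n x)\<^sup>2) < e / 2" using Cauchy[of "e / 2"] e by auto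
    have "norm ((LINT x|M. (f n x - g x)\<^sup>2) - 0) < e" if "n \<ge> K" for n
    proof -
      have "ennreal (LINT x|M. (f n x - g x)\<^sup>2) \<le> ennreal (e / 2)"
        using bound[of K n "e / 2"] K that fg' by (simp add: nn_integral_eq_integral)
      then have "(LINT x|M. (f n x - g x)\<^sup>2) \<le> e / 2" using e by simp
      then show ?thesis using e by (simp add: integral_nonneg_AE)
    qed
    then show "\<exists>K. \<forall>n\<ge>K. norm ((LINT x|M. (f n x - g x)\<^sup>2) - 0) < e" by blast
  qed
  then show ?thesis using g2 \<open>g \<in> borel_measurable M\<close> by (intro exI[of _ g] conjI)
qed

lemma L2D: "f \<in> L2 \<Omega> \<Longrightarrow> f \<in> borel_measurable (lebesgue_on \<Omega>)"
  "f \<in> L2 \<Omega> \<Longrightarrow> integrable (lebesgue_on \<Omega>) (\<lambda>x. (f x)\<^sup>2)"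
  by (auto simp: L2_def)

lemma L2_inner_self: "L2_inner \<Omega> f f = (LINT x|lebesgue_on \<Omega>. (f x)\<^sup>2)"
  by (simp add: L2_inner_def power2_eq_square)

lemma L2_mult_integrable: "f \<in> L2 \<Omega> \<Longrightarrow> g \<in> L2 \<Omega> \<Longrightarrow> integrable (lebesgue_on \<Omega>) (\<lambda>x. f x * g x)"
  by (intro integrable_mult_if_square_integrable L2D)

lemma psd_form_L2: "psd_form (L2 \<Omega>) (L2_inner \<Omega>)"
proof
  show "(\<lambda>x. 0) \<in> L2 \<Omega>" by (simp add: L2_def)
  show "(\<lambda>x. u x + c * v x) \<in> L2 \<Omega>" if "u \<in> L2 \<Omega>" "v \<in> L2 \<Omega>" for u v c
    unfolding L2_def using square_integrable_lin[OF L2D[OF that(1)] L2D[OF that(2)], of c] L2D(1)[OF that(1)] L2D(1)[OF that(2)]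
    by simp
  show "L2_inner \<Omega> (\<lambda>x. u x + c * v x) w = L2_inner \<Omega> u w + c * L2_inner \<Omega> v w"
    if "u \<in> L2 \<Omega>" "v \<in> L2 \<Omega>" "w \<in> L2 \<Omega>" for u v w c
    unfolding L2_inner_def using L2_mult_integrable[OF that(1,3)] L2_mult_integrable[OF that(2,3)]
    by (simp add: distrib_right mult.assoc)
qed (auto simp: L2_inner_def mult.commute)

lemma L2_inner_zero_iff:
  assumes "f \<in> L2 \<Omega>"
  shows "L2_inner \<Omega> f f = 0 \<longleftrightarrow> (AE x in lebesgue_on \<Omega>. f x = 0)"
  unfolding L2_inner_self using integral_nonneg_eq_0_iff_AE[OF L2D(2)[OF assms]] by simp

lemma finite_measure_lebesgue_on:
  assumes "bounded \<Omega>" "\<Omega> \<in> sets lebesgue" shows "finite_measure (lebesgue_on \<Omega>)"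
proof
  have "\<Omega> \<in> lmeasurable" using assms bounded_set_imp_lmeasurable by blast
  then show "emeasure (lebesgue_on \<Omega>) (space (lebesgue_on \<Omega>)) \<noteq> \<infinity>"
    using assms(2) by (simp add: emeasure_restrict_space fmeasurable_def space_restrict_space)
qed

lemma L2_bounded_function:
  assumes "bounded \<Omega>" "\<Omega> \<in> sets lebesgue" "f \<in> borel_measurable borel" "\<And>x. \<bar>f x\<bar> \<le> M"
  shows "f \<in> L2 \<Omega>"
proof -
  interpret finite_measure "lebesgue_on \<Omega>" using finite_measure_lebesgue_on assms by blast
  have [measurable]: "f \<in> borel_measurable (lebesgue_on \<Omega>)"
    using assms(3) by (intro measurable_restrict_space1 measurable_completion) simp
  have "norm ((f x)\<^sup>2) \<le> M\<^sup>2" for x using power_mono[OF assms(4)[of x], of 2] by simp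
  then have "integrable (lebesgue_on \<Omega>) (\<lambda>x. (f x)\<^sup>2)" by (intro integrable_const_bound[of _ "M\<^sup>2"]) auto
  then show ?thesis by (simp add: L2_def)
qed

lemma L2_complete:
  assumes "bounded \<Omega>" "\<Omega> \<in> sets lebesgue" and f: "\<And>n. f n \<in> L2 \<Omega>"
    and Cauchy: "\<And>e. e > 0 \<Longrightarrow> \<exists>K. \<forall>m\<ge>K. \<forall>n\<ge>K. L2_inner \<Omega> (\<lambda>x. f m x - f n x) (\<lambda>x. f m x - f n x) < e"
  shows "\<exists>g\<in>L2 \<Omega>. (\<lambda>n. L2_inner \<Omega> (\<lambda>x. f n x - g x) (\<lambda>x. f n x - g x)) \<longlonglongrightarrow> 0"
proof -
  from square_integrable_complete[of "lebesgue_on \<Omega>" f, OF finite_measure_lebesgue_on[OF assms(1,2)] L2D(1)[OF f] L2D(2)[OF f]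
    Cauchy[unfolded L2_inner_self]]
  obtain g where "g \<in> borel_measurable (lebesgue_on \<Omega>)" "integrable (lebesgue_on \<Omega>) (\<lambda>x. (g x)\<^sup>2)"
    "(\<lambda>n. LINT x|lebesgue_on \<Omega>. (f n x - g x)\<^sup>2) \<longlonglongrightarrow> 0" by blast
  then show ?thesis unfolding L2_inner_self by (intro bexI[of _ g]) (auto simp: L2_def)
qed

lemma L2_integrable:
  "bounded \<Omega> \<Longrightarrow> \<Omega> \<in> sets lebesgue \<Longrightarrow> f \<in> L2 \<Omega> \<Longrightarrow> integrable (lebesgue_on \<Omega>) f"
  by (rule integrable_abs_if_square_integrable(1)[OF finite_measure_lebesgue_on L2D])

lemma test_function_L2:
  assumes "bounded \<Omega>" "\<Omega> \<in> sets lebesgue" and \<phi>: "\<phi> \<in> test_functions \<Omega>'"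
  shows "\<phi> \<in> L2 \<Omega>" and "(\<lambda>x. frechet_derivative \<phi> (at x) v) \<in> L2 \<Omega>"
proof -
  obtain M where "\<And>x. \<bar>\<phi> x\<bar> \<le> M" using test_function_bounded[OF \<phi>] by blast
  then show "\<phi> \<in> L2 \<Omega>"
    using L2_bounded_function[OF assms(1,2) borel_measurable_continuous_onI[OF test_function_continuous[OF \<phi>]]] by blast
  obtain M' where "\<And>x. \<bar>frechet_derivative \<phi> (at x) v\<bar> \<le> M'"
    using test_function_derivative_bounded[OF \<phi>] by blast
  then show "(\<lambda>x. frechet_derivative \<phi> (at x) v) \<in> L2 \<Omega>"
    using L2_bounded_function[OF assms(1,2) borel_measurable_continuous_onI[OF test_function_derivative_continuous[OF \<phi>]]] by blast
qed

section \<open>The space \<open>H\<^sup>1\<close>\<close>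

lemma integrable_components:
  fixes g :: "'b \<Rightarrow> 'a::euclidean_space"
  assumes "\<And>b. b \<in> Basis \<Longrightarrow> integrable M (\<lambda>x. g x \<bullet> b)"
  shows "integrable M g"
proof -
  have "integrable M (\<lambda>x. \<Sum>b\<in>Basis. (g x \<bullet> b) *\<^sub>R b)" using assms by auto
  then show ?thesis by (simp add: euclidean_representation)
qed

lemma locally_integrable_if_integrable:
  fixes f :: "'a::euclidean_space \<Rightarrow> 'b::euclidean_space"
  assumes "integrable (lebesgue_on \<Omega>) f" "\<Omega> \<in> sets lebesgue"
  shows "locally_integrable \<Omega> f"
  unfolding locally_integrable_def
proof (intro allI impI)
  fix K assume K: "compact K \<and> K \<subseteq> \<Omega>"
  have "f absolutely_integrable_on \<Omega>"
    using assms integrable_restrict_space[of \<Omega> lebesgue f] by (simp add: set_integrable_def)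
  then show "f absolutely_integrable_on K"
    by (rule set_integrable_subset) (use K in \<open>auto simp: compact_imp_closed\<close>)
qed

locale bounded_open =
  fixes \<Omega> :: "'a::euclidean_space set"
  assumes bounded_dom: "bounded \<Omega>" and open_dom: "open \<Omega>"
begin

lemma sets_dom: "\<Omega> \<in> sets lebesgue" using open_dom by auto

lemmas bs = bounded_dom sets_dom

sublocale L2: psd_form "L2 \<Omega>" "L2_inner \<Omega>" by (rule psd_form_L2)

text \<open>On a bounded set square integrable functions are integrable, so the local integrability
  demands hold automatically and only identities between L2 products remain.\<close>

lemma has_L2_gradientI:
  assumes u: "u \<in> L2 \<Omega>" and g: "\<And>b. b \<in> Basis \<Longrightarrow> (\<lambda>x. g x \<bullet> b) \<in> L2 \<Omega>"
    and weak: "\<And>\<phi> b. \<phi> \<in> test_functions \<Omega> \<Longrightarrow> b \<in> Basis \<Longrightarrow>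
      L2_inner \<Omega> u (\<lambda>x. frechet_derivative \<phi> (at x) b) = - L2_inner \<Omega> (\<lambda>x. g x \<bullet> b) \<phi>"
  shows "has_L2_gradient \<Omega> u g"
proof -
  have "locally_integrable \<Omega> g"
    by (rule locally_integrable_if_integrable[OF integrable_components[OF L2_integrable[OF bs g]] sets_dom])
  moreover have "locally_integrable \<Omega> u"
    by (rule locally_integrable_if_integrable[OF L2_integrable[OF bs u] sets_dom])
  ultimately show ?thesis
    using g weak unfolding has_L2_gradient_def has_weak_gradient_def L2_inner_def by auto
qed

lemma has_L2_gradientD:
  assumes "has_L2_gradient \<Omega> u g"
  shows "b \<in> Basis \<Longrightarrow> (\<lambda>x. g x \<bullet> b) \<in> L2 \<Omega>"
    and "\<phi> \<in> test_functions \<Omega> \<Longrightarrow> b \<in> Basis \<Longrightarrow>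
      L2_inner \<Omega> u (\<lambda>x. frechet_derivative \<phi> (at x) b) = - L2_inner \<Omega> (\<lambda>x. g x \<bullet> b) \<phi>"
  using assms unfolding has_L2_gradient_def has_weak_gradient_def L2_inner_def by auto

lemma has_L2_gradient_lin:
  assumes u: "u \<in> L2 \<Omega>" "has_L2_gradient \<Omega> u g" and v: "v \<in> L2 \<Omega>" "has_L2_gradient \<Omega> v h"
  shows "has_L2_gradient \<Omega> (\<lambda>x. u x + c * v x) (\<lambda>x. g x + c *\<^sub>R h x)"
proof (rule has_L2_gradientI)
  note G = has_L2_gradientD(1)[OF u(2)] has_L2_gradientD(1)[OF v(2)]
  show "(\<lambda>x. u x + c * v x) \<in> L2 \<Omega>" by (rule L2.lin_mem[OF u(1) v(1)])
  show "(\<lambda>x. (g x + c *\<^sub>R h x) \<bullet> b) \<in> L2 \<Omega>" if "b \<in> Basis" for b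
    using L2.lin_mem[OF G[OF that], of c] by (simp add: inner_add_left)
  show "L2_inner \<Omega> (\<lambda>x. u x + c * v x) (\<lambda>x. frechet_derivative \<phi> (at x) b)
    = - L2_inner \<Omega> (\<lambda>x. (g x + c *\<^sub>R h x) \<bullet> b) \<phi>" if \<phi>: "\<phi> \<in> test_functions \<Omega>" and b: "b \<in> Basis" for \<phi> b
    using L2.lin[OF u(1) v(1) test_function_L2(2)[OF bs \<phi>], of c b] L2.lin[OF G[OF b] test_function_L2(1)[OF bs \<phi>], of c]
      has_L2_gradientD(2)[OF u(2) \<phi> b] has_L2_gradientD(2)[OF v(2) \<phi> b] by (simp add: inner_add_left)
qed

text \<open>The fundamental lemma applied to each component; it makes the arbitrary choice in
  \<open>weak_grad\<close> immaterial.\<close>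

lemma has_L2_gradient_unique:
  assumes g: "has_L2_gradient \<Omega> u g" and h: "has_L2_gradient \<Omega> u h"
  shows "AE x in lebesgue_on \<Omega>. g x = h x"
proof -
  have "AE x in lebesgue_on \<Omega>. g x \<bullet> b = h x \<bullet> b" if b: "b \<in> Basis" for b
  proof -
    note G = has_L2_gradientD(1)[OF g b] and H = has_L2_gradientD(1)[OF h b]
    have "AE x in lebesgue_on \<Omega>. g x \<bullet> b - h x \<bullet> b = 0"
    proof (rule fundamental_lemma[OF open_dom])
      show "integrable (lebesgue_on \<Omega>) (\<lambda>x. g x \<bullet> b - h x \<bullet> b)"
        using L2_integrable[OF bs G] L2_integrable[OF bs H] by simp
      fix \<phi> assume \<phi>: "\<phi> \<in> test_functions \<Omega>"
      show "(LINT x|lebesgue_on \<Omega>. (g x \<bullet> b - h x \<bullet> b) * \<phi> x) = 0"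
        using L2.diff_left[OF G H test_function_L2(1)[OF bs \<phi>]] has_L2_gradientD(2)[OF g \<phi> b]
          has_L2_gradientD(2)[OF h \<phi> b] unfolding L2_inner_def by simp
    qed
    then show ?thesis by simp
  qed
  then have "AE x in lebesgue_on \<Omega>. \<forall>b\<in>Basis. g x \<bullet> b = h x \<bullet> b"
    by (subst AE_ball_countable) (auto intro: countable_finite)
  then show ?thesis by eventually_elim (auto intro: euclidean_eqI)
qed

lemma H1D: "u \<in> H1 \<Omega> \<Longrightarrow> u \<in> L2 \<Omega>" "u \<in> H1 \<Omega> \<Longrightarrow> has_L2_gradient \<Omega> u (weak_grad \<Omega> u)"
  unfolding H1_def weak_grad_def using someI_ex by (metis (mono_tags, lifting) mem_Collect_eq)+

lemma H1_weak_grad_L2: "u \<in> H1 \<Omega> \<Longrightarrow> b \<in> Basis \<Longrightarrow> (\<lambda>x. weak_grad \<Omega> u x \<bullet> b) \<in> L2 \<Omega>"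
  using has_L2_gradientD(1) H1D by blast

lemma H1_lin: "u \<in> H1 \<Omega> \<Longrightarrow> v \<in> H1 \<Omega> \<Longrightarrow> (\<lambda>x. u x + c * v x) \<in> H1 \<Omega>"
  using has_L2_gradient_lin H1D L2.lin_mem unfolding H1_def by blast

text \<open>All products with test functions vanish, so 0 is a weak gradient. This supplies one half
  of the comparison of null vectors in \<open>Tr_null_iff\<close>.\<close>

lemma H1_if_AE_zero:
  assumes "u \<in> L2 \<Omega>" "AE x in lebesgue_on \<Omega>. u x = 0"
  shows "u \<in> H1 \<Omega>" "AE x in lebesgue_on \<Omega>. weak_grad \<Omega> u x = 0"
proof -
  have "has_L2_gradient \<Omega> u (\<lambda>x. 0)"
  proof (rule has_L2_gradientI)
    show "L2_inner \<Omega> u (\<lambda>x. frechet_derivative \<phi> (at x) b) = - L2_inner \<Omega> (\<lambda>x. 0 \<bullet> b) \<phi>"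
      if "\<phi> \<in> test_functions \<Omega>" for \<phi> b
      using L2.null_left[OF assms(1) test_function_L2(2)[OF bs that]] assms L2_inner_zero_iff[OF assms(1)]
        L2.zero_left[OF test_function_L2(1)[OF bs that]] by simp
  qed (use assms L2.zero_mem in auto)
  then show "u \<in> H1 \<Omega>" using assms by (auto simp: H1_def)
  then show "AE x in lebesgue_on \<Omega>. weak_grad \<Omega> u x = 0"
    using has_L2_gradient_unique[OF H1D(2)] \<open>has_L2_gradient \<Omega> u (\<lambda>x. 0)\<close> by blast
qed

lemma grad_inner_components:
  assumes "u \<in> H1 \<Omega>" "v \<in> H1 \<Omega>"
  shows "grad_inner \<Omega> u v = (\<Sum>b\<in>Basis. L2_inner \<Omega> (\<lambda>x. weak_grad \<Omega> u x \<bullet> b) (\<lambda>x. weak_grad \<Omega> v x \<bullet> b))"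
    and "integrable (lebesgue_on \<Omega>) (\<lambda>x. weak_grad \<Omega> u x \<bullet> weak_grad \<Omega> v x)"
proof -
  have i: "integrable (lebesgue_on \<Omega>) (\<lambda>x. (weak_grad \<Omega> u x \<bullet> b) * (weak_grad \<Omega> v x \<bullet> b))" if "b \<in> Basis" for b
    using that by (intro L2_mult_integrable H1_weak_grad_L2 assms)
  have eq: "(\<lambda>x. weak_grad \<Omega> u x \<bullet> weak_grad \<Omega> v x) = (\<lambda>x. \<Sum>b\<in>Basis. (weak_grad \<Omega> u x \<bullet> b) * (weak_grad \<Omega> v x \<bullet> b))"
    by (rule ext, rule euclidean_inner)
  show "grad_inner \<Omega> u v = (\<Sum>b\<in>Basis. L2_inner \<Omega> (\<lambda>x. weak_grad \<Omega> u x \<bullet> b) (\<lambda>x. weak_grad \<Omega> v x \<bullet> b))"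
    unfolding grad_inner_def L2_inner_def eq using i
    by (rule Bochner_Integration.integral_sum)
  show "integrable (lebesgue_on \<Omega>) (\<lambda>x. weak_grad \<Omega> u x \<bullet> weak_grad \<Omega> v x)"
    unfolding eq using i by (rule Bochner_Integration.integrable_sum)
qed

text \<open>The chosen gradient of a sum need not be the sum of the chosen gradients; replacing it
  by any other gradient gives linearity of \<open>grad_inner\<close>.\<close>

lemma grad_inner_cong_left:
  assumes "u \<in> H1 \<Omega>" "w \<in> H1 \<Omega>" "has_L2_gradient \<Omega> u g"
  shows "grad_inner \<Omega> u w = (LINT x|lebesgue_on \<Omega>. g x \<bullet> weak_grad \<Omega> w x)"
proof -
  have m: "(\<lambda>x. h x \<bullet> weak_grad \<Omega> w x) \<in> borel_measurable (lebesgue_on \<Omega>)" if "has_L2_gradient \<Omega> u h" for h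
  proof -
    have eq: "(\<lambda>x. h x \<bullet> weak_grad \<Omega> w x) = (\<lambda>x. \<Sum>b\<in>Basis. (h x \<bullet> b) * (weak_grad \<Omega> w x \<bullet> b))"
      by (rule ext, rule euclidean_inner)
    show ?thesis
      unfolding eq using L2D(1)[OF has_L2_gradientD(1)[OF that]] L2D(1)[OF H1_weak_grad_L2[OF assms(2)]]
      by (intro borel_measurable_sum borel_measurable_times)
  qed
  show ?thesis unfolding grad_inner_def
    by (intro integral_cong_AE m H1D(2) assms)
      (use has_L2_gradient_unique[OF H1D(2)[OF assms(1)] assms(3)] in eventually_elim, simp)
qed

lemma psd_form_grad: "psd_form (H1 \<Omega>) (grad_inner \<Omega>)"
proof
  show "(\<lambda>x. 0) \<in> H1 \<Omega>" using H1_if_AE_zero(1)[OF L2.zero_mem] by simp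
  show "(\<lambda>x. u x + c * v x) \<in> H1 \<Omega>" if "u \<in> H1 \<Omega>" "v \<in> H1 \<Omega>" for u v c
    using H1_lin that .
  show "grad_inner \<Omega> u v = grad_inner \<Omega> v u" for u v
    unfolding grad_inner_def by (simp add: inner_commute)
  show "grad_inner \<Omega> (\<lambda>x. u x + c * v x) w = grad_inner \<Omega> u w + c * grad_inner \<Omega> v w"
    if "u \<in> H1 \<Omega>" "v \<in> H1 \<Omega>" "w \<in> H1 \<Omega>" for u v w c
    using grad_inner_cong_left[OF H1_lin[OF that(1,2)] that(3) has_L2_gradient_lin[OF H1D[OF that(1)] H1D[OF that(2)]], of c]
      grad_inner_components(2)[OF that(1,3)] grad_inner_components(2)[OF that(2,3)]
    by (simp add: inner_add_left grad_inner_def)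
  show "0 \<le> grad_inner \<Omega> u u" for u
    unfolding grad_inner_def by simp
qed

sublocale grad: psd_form "H1 \<Omega>" "grad_inner \<Omega>" by (rule psd_form_grad)

lemma psd_form_H1_L2: "psd_form (H1 \<Omega>) (L2_inner \<Omega>)"
proof
  show "L2_inner \<Omega> u v = L2_inner \<Omega> v u" if "u \<in> H1 \<Omega>" "v \<in> H1 \<Omega>" for u v
    by (rule L2.sym[OF H1D(1)[OF that(1)] H1D(1)[OF that(2)]])
  show "L2_inner \<Omega> (\<lambda>x. u x + c * v x) w = L2_inner \<Omega> u w + c * L2_inner \<Omega> v w"
    if "u \<in> H1 \<Omega>" "v \<in> H1 \<Omega>" "w \<in> H1 \<Omega>" for u v w c
    using that by (intro L2.lin H1D(1))
  show "0 \<le> L2_inner \<Omega> u u" if "u \<in> H1 \<Omega>" for u by (rule L2.nonneg[OF H1D(1)[OF that]])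
qed (fact grad.zero_mem H1_lin)+

text \<open>The gradient \<open>h\<close> is left free so that the formula serves both for
  differences of sequence members and for the limit, whose gradient is constructed
  componentwise.\<close>

lemma grad_inner_diff:
  assumes "u \<in> H1 \<Omega>" "v \<in> H1 \<Omega>" "has_L2_gradient \<Omega> v h"
  shows "grad_inner \<Omega> (\<lambda>x. u x - v x) (\<lambda>x. u x - v x)
    = (\<Sum>b\<in>Basis. L2_inner \<Omega> (\<lambda>x. weak_grad \<Omega> u x \<bullet> b - h x \<bullet> b) (\<lambda>x. weak_grad \<Omega> u x \<bullet> b - h x \<bullet> b))"
proof -
  let ?w = "\<lambda>x. u x - v x"
  have w: "?w \<in> H1 \<Omega>" using grad.diff_mem assms by blast
  have g: "has_L2_gradient \<Omega> ?w (\<lambda>x. weak_grad \<Omega> u x - h x)"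
    using has_L2_gradient_lin[OF H1D[OF assms(1)] H1D(1)[OF assms(2)] assms(3), of "-1"] by simp
  have ae: "AE x in lebesgue_on \<Omega>. weak_grad \<Omega> ?w x = weak_grad \<Omega> u x - h x"
    by (rule has_L2_gradient_unique[OF H1D(2)[OF w] g])
  have "L2_inner \<Omega> (\<lambda>x. weak_grad \<Omega> ?w x \<bullet> b) (\<lambda>x. weak_grad \<Omega> ?w x \<bullet> b)
    = L2_inner \<Omega> (\<lambda>x. weak_grad \<Omega> u x \<bullet> b - h x \<bullet> b) (\<lambda>x. weak_grad \<Omega> u x \<bullet> b - h x \<bullet> b)" if b: "b \<in> Basis" for b
    unfolding L2_inner_self
  proof (rule integral_cong_AE)
    show "(\<lambda>x. (weak_grad \<Omega> ?w x \<bullet> b)\<^sup>2) \<in> borel_measurable (lebesgue_on \<Omega>)"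
      using L2D(1)[OF H1_weak_grad_L2[OF w b]] by simp
    show "(\<lambda>x. (weak_grad \<Omega> u x \<bullet> b - h x \<bullet> b)\<^sup>2) \<in> borel_measurable (lebesgue_on \<Omega>)"
      using L2D(1)[OF has_L2_gradientD(1)[OF g b]] by (simp add: inner_diff_left)
    show "AE x in lebesgue_on \<Omega>. (weak_grad \<Omega> ?w x \<bullet> b)\<^sup>2 = (weak_grad \<Omega> u x \<bullet> b - h x \<bullet> b)\<^sup>2"
      using ae by eventually_elim (simp add: inner_diff_left)
  qed
  then show ?thesis using grad_inner_components(1)[OF w w] by simp
qed

text \<open>The weak gradient is a closed operator: functions and gradient components converge
  separately in \<open>L2 \<Omega>\<close>, and both sides of the defining identity are continuous
  there for a fixed test function.\<close>

lemma H1_complete: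
  assumes u: "\<And>n. u n \<in> H1 \<Omega>"
    and Cauchy: "\<And>e. e > 0 \<Longrightarrow> \<exists>K. \<forall>m\<ge>K. \<forall>n\<ge>K. grad_inner \<Omega> (\<lambda>x. u m x - u n x) (\<lambda>x. u m x - u n x)
       + L2_inner \<Omega> (\<lambda>x. u m x - u n x) (\<lambda>x. u m x - u n x) < e"
  shows "\<exists>l\<in>H1 \<Omega>. (\<lambda>n. grad_inner \<Omega> (\<lambda>x. u n x - l x) (\<lambda>x. u n x - l x)) \<longlonglongrightarrow> 0
    \<and> (\<lambda>n. L2_inner \<Omega> (\<lambda>x. u n x - l x) (\<lambda>x. u n x - l x)) \<longlonglongrightarrow> 0"
proof -
  have dm: "(\<lambda>x. u m x - u n x) \<in> H1 \<Omega>" for m n using grad.diff_mem u by blast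
  have "\<exists>K. \<forall>m\<ge>K. \<forall>n\<ge>K. L2_inner \<Omega> (\<lambda>x. u m x - u n x) (\<lambda>x. u m x - u n x) < e" if "e > 0" for e
    using Cauchy[OF that] grad.nonneg[OF dm] by (smt (verit))
  from L2_complete[OF bs H1D(1)[OF u] this] obtain l where l: "l \<in> L2 \<Omega>"
    "(\<lambda>n. L2_inner \<Omega> (\<lambda>x. u n x - l x) (\<lambda>x. u n x - l x)) \<longlonglongrightarrow> 0" by blast
  have ex: "\<exists>h\<in>L2 \<Omega>. (\<lambda>n. L2_inner \<Omega> (\<lambda>x. weak_grad \<Omega> (u n) x \<bullet> b - h x) (\<lambda>x. weak_grad \<Omega> (u n) x \<bullet> b - h x)) \<longlonglongrightarrow> 0"
    if b: "b \<in> Basis" for b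
  proof (rule L2_complete[OF bs H1_weak_grad_L2[OF u b]])
    fix e :: real assume "e > 0"
    then obtain K where K: "\<forall>m\<ge>K. \<forall>n\<ge>K. grad_inner \<Omega> (\<lambda>x. u m x - u n x) (\<lambda>x. u m x - u n x)
       + L2_inner \<Omega> (\<lambda>x. u m x - u n x) (\<lambda>x. u m x - u n x) < e" using Cauchy by blast
    have "L2_inner \<Omega> (\<lambda>x. weak_grad \<Omega> (u m) x \<bullet> b - weak_grad \<Omega> (u n) x \<bullet> b)
      (\<lambda>x. weak_grad \<Omega> (u m) x \<bullet> b - weak_grad \<Omega> (u n) x \<bullet> b)
      \<le> grad_inner \<Omega> (\<lambda>x. u m x - u n x) (\<lambda>x. u m x - u n x)" for m n
      unfolding grad_inner_diff[OF u u H1D(2)[OF u]]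
      by (rule member_le_sum[OF b]) (auto simp: L2_inner_self)
    then show "\<exists>K. \<forall>m\<ge>K. \<forall>n\<ge>K. L2_inner \<Omega> (\<lambda>x. weak_grad \<Omega> (u m) x \<bullet> b - weak_grad \<Omega> (u n) x \<bullet> b)
      (\<lambda>x. weak_grad \<Omega> (u m) x \<bullet> b - weak_grad \<Omega> (u n) x \<bullet> b) < e"
      using K L2.nonneg[OF H1D(1)[OF dm]] by (intro exI[of _ K]) (smt (verit))
  qed
  define P where "P b h \<longleftrightarrow> h \<in> L2 \<Omega> \<and>
    (\<lambda>n. L2_inner \<Omega> (\<lambda>x. weak_grad \<Omega> (u n) x \<bullet> b - h x) (\<lambda>x. weak_grad \<Omega> (u n) x \<bullet> b - h x)) \<longlonglongrightarrow> 0" for b h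
  have "\<forall>b\<in>Basis. \<exists>h. P b h" using ex unfolding P_def by blast
  from bchoice[OF this] obtain h where "\<forall>b\<in>Basis. P b (h b)" by blast
  then have h: "\<And>b. b \<in> Basis \<Longrightarrow> h b \<in> L2 \<Omega>" "\<And>b. b \<in> Basis \<Longrightarrow>
    (\<lambda>n. L2_inner \<Omega> (\<lambda>x. weak_grad \<Omega> (u n) x \<bullet> b - h b x) (\<lambda>x. weak_grad \<Omega> (u n) x \<bullet> b - h b x)) \<longlonglongrightarrow> 0"
    unfolding P_def by blast+
  define g where "g x = (\<Sum>b\<in>Basis. h b x *\<^sub>R b)" for x
  have gb: "g x \<bullet> b = h b x" if "b \<in> Basis" for x b
    unfolding g_def using that by (simp add: inner_sum_left inner_Basis if_distrib sum.delta cong: if_cong)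
  have G: "has_L2_gradient \<Omega> l g"
  proof (rule has_L2_gradientI[OF l(1)])
    show "(\<lambda>x. g x \<bullet> b) \<in> L2 \<Omega>" if "b \<in> Basis" for b using h(1)[OF that] gb[OF that] by simp
    fix \<phi> b assume \<phi>: "\<phi> \<in> test_functions \<Omega>" and b: "b \<in> (Basis :: 'a set)"
    have 1: "(\<lambda>n. L2_inner \<Omega> (u n) (\<lambda>x. frechet_derivative \<phi> (at x) b)) \<longlonglongrightarrow> L2_inner \<Omega> l (\<lambda>x. frechet_derivative \<phi> (at x) b)"
      by (rule L2.tendsto_left[OF H1D(1)[OF u] l(1) test_function_L2(2)[OF bs \<phi>] l(2)])
    have 2: "(\<lambda>n. - L2_inner \<Omega> (\<lambda>x. weak_grad \<Omega> (u n) x \<bullet> b) \<phi>) \<longlonglongrightarrow> - L2_inner \<Omega> (h b) \<phi>"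
      by (intro tendsto_minus L2.tendsto_left[OF H1_weak_grad_L2[OF u b] h(1)[OF b] test_function_L2(1)[OF bs \<phi>] h(2)[OF b]])
    show "L2_inner \<Omega> l (\<lambda>x. frechet_derivative \<phi> (at x) b) = - L2_inner \<Omega> (\<lambda>x. g x \<bullet> b) \<phi>"
      unfolding gb[OF b] using LIMSEQ_unique[OF 1] 2 has_L2_gradientD(2)[OF H1D(2)[OF u] \<phi> b] by simp
  qed
  then have lH: "l \<in> H1 \<Omega>" using l(1) by (auto simp: H1_def)
  have "(\<lambda>n. \<Sum>b\<in>Basis. L2_inner \<Omega> (\<lambda>x. weak_grad \<Omega> (u n) x \<bullet> b - h b x) (\<lambda>x. weak_grad \<Omega> (u n) x \<bullet> b - h b x)) \<longlonglongrightarrow> (\<Sum>b\<in>(Basis::'a set). 0)"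
    by (intro tendsto_sum h(2))
  then have "(\<lambda>n. grad_inner \<Omega> (\<lambda>x. u n x - l x) (\<lambda>x. u n x - l x)) \<longlonglongrightarrow> 0"
    unfolding grad_inner_diff[OF u lH G] by (simp add: gb)
  then show ?thesis using lH l(2) by blast
qed

lemma test_function_H1:
  assumes \<phi>: "\<phi> \<in> test_functions \<Omega>" shows "\<phi> \<in> H1 \<Omega>"
proof -
  let ?g = "\<lambda>x. \<Sum>b\<in>Basis. frechet_derivative \<phi> (at x) b *\<^sub>R b"
  have gb: "?g x \<bullet> b = frechet_derivative \<phi> (at x) b" if "b \<in> Basis" for x b
    using that by (simp add: inner_sum_left inner_Basis if_distrib sum.delta cong: if_cong)
  have "has_L2_gradient \<Omega> \<phi> ?g"
    by (rule has_L2_gradientI)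
      (use test_function_L2[OF bs \<phi>] test_function_integration_by_parts[OF \<phi> _ sets_dom] in \<open>auto simp: gb L2_inner_def\<close>)
  then show ?thesis using test_function_L2[OF bs \<phi>] by (auto simp: H1_def)
qed

text \<open>Bump functions in disjoint small balls converging to a point.\<close>

lemma ex_orthonormal_family:
  assumes "\<Omega> \<noteq> {}"
  shows "\<exists>\<phi> :: nat \<Rightarrow> 'a \<Rightarrow> real. (\<forall>i. \<phi> i \<in> H1 \<Omega>) \<and> (\<forall>i j. L2_inner \<Omega> (\<phi> i) (\<phi> j) = (if i = j then 1 else 0))"
proof -
  obtain p where "p \<in> \<Omega>" using assms by blast
  then obtain r where r: "r > 0" "ball p r \<subseteq> \<Omega>" using open_dom open_contains_ball by blast
  obtain e :: 'a where e: "e \<in> Basis" using nonempty_Basis by blast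
  define q where "q k = p + (r / 2 ^ Suc k) *\<^sub>R e" for k :: nat
  have dq: "dist p (q k) = r / 2 ^ Suc k" for k using r e by (simp add: q_def dist_norm)
  \<comment> \<open>For \<open>i < j\<close> the centres are at distance at least
    \<open>r / 2 ^ (i + 2)\<close>, whereas the two radii add up to at most
    \<open>r / 2 ^ (i + 3)\<close>; hence the balls are disjoint.\<close>
  have "\<exists>a b. q k \<in> box a b \<and> cbox a b \<subseteq> ball (q k) (r / 2 ^ (k + 4))" for k
  proof -
    have "q k \<in> ball (q k) (r / 2 ^ (k + 4))" using r by simp
    from open_contains_cbox[OF open_ball this] obtain a b where "cbox a b \<subseteq> ball (q k) (r / 2 ^ (k + 4))" "q k \<in> box a b"
      by metis
    then show ?thesis by blast
  qed
  then obtain a b where ab: "\<And>k. q k \<in> box (a k) (b k)" "\<And>k. cbox (a k) (b k) \<subseteq> ball (q k) (r / 2 ^ (k + 4))" by metis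
  have sub: "cbox (a k) (b k) \<subseteq> \<Omega>" for k
  proof -
    have "r / 2 ^ Suc k + r / 2 ^ (k + 4) \<le> r"
    proof -
      have "r / 2 ^ Suc k \<le> r / 2" "r / 2 ^ (k + 4) \<le> r / 2"
        using r power_increasing[of 1 "Suc k" "2::real"] power_increasing[of 1 "k + 4" "2::real"]
        by (intro divide_left_mono; simp)+
      then show ?thesis by linarith
    qed
    then have "dist p x < r" if "dist (q k) x < r / 2 ^ (k + 4)" for x
      using dist_triangle[of p x "q k"] dq[of k] that by linarith
    then have "ball (q k) (r / 2 ^ (k + 4)) \<subseteq> ball p r" by auto
    then show ?thesis using ab(2)[of k] r(2) by blast
  qed
  have disj: "box (a i) (b i) \<inter> box (a j) (b j) = {}" if "i < j" for i j
  proof (rule ccontr)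
    assume "\<not> ?thesis"
    then obtain x where "x \<in> box (a i) (b i)" "x \<in> box (a j) (b j)" by blast
    from subsetD[OF box_subset_cbox this(1)] subsetD[OF box_subset_cbox this(2)] have x: "dist (q i) x < r / 2 ^ (i + 4)" "dist (q j) x < r / 2 ^ (j + 4)"
      using ab(2)[of i] ab(2)[of j] by (auto simp: subset_eq)
    have "dist p (q i) \<le> dist p (q j) + dist (q j) x + dist (q i) x"
      by (smt (verit) dist_commute dist_triangle)
    then have "r / 2 ^ Suc i < r / 2 ^ Suc j + r / 2 ^ (j + 4) + r / 2 ^ (i + 4)" using x dq by simp
    moreover have "r / 2 ^ Suc j \<le> r / 2 ^ Suc (Suc i)" "r / 2 ^ (j + 4) \<le> r / 2 ^ (i + 4)"
      using that r by (auto intro!: divide_left_mono mult_left_mono power_increasing simp del: power_Suc)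
    moreover have "r / 2 ^ Suc (Suc i) + r / 2 ^ (i + 4) + r / 2 ^ (i + 4) \<le> r / 2 ^ Suc i"
      using r by (simp add: field_simps power_add)
    ultimately show False by linarith
  qed
  define \<psi> where "\<psi> k = bump (a k) (b k) 0" for k
  have tf: "\<psi> k \<in> test_functions \<Omega>" for k unfolding \<psi>_def by (rule bump_test_function[OF sub])
  have \<psi>H: "\<psi> k \<in> H1 \<Omega>" for k by (rule test_function_H1[OF tf])
  have orth: "L2_inner \<Omega> (\<psi> i) (\<psi> j) = 0" if "i \<noteq> j" for i j
  proof -
    have z: "\<psi> i x * \<psi> j x = 0" for x
    proof (rule ccontr)
      assume "\<psi> i x * \<psi> j x \<noteq> 0"
      then have "x \<in> box (a i) (b i)" "x \<in> box (a j) (b j)" using bump_nonzero unfolding \<psi>_def by auto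
      then show False using disj[of i j] disj[of j i] that by (cases i j rule: linorder_cases) auto
    qed
    show ?thesis by (simp only: L2_inner_def z Bochner_Integration.integral_zero)
  qed
  have pos: "L2_inner \<Omega> (\<psi> k) (\<psi> k) > 0" for k
  proof (rule ccontr)
    assume "\<not> ?thesis"
    then have "L2_inner \<Omega> (\<psi> k) (\<psi> k) = 0" using L2.nonneg[OF H1D(1)[OF \<psi>H[of k]]] by simp
    then have "AE x in lebesgue_on \<Omega>. \<psi> k x = 0" using L2_inner_zero_iff[OF H1D(1)[OF \<psi>H]] by simp
    then have "AE x in lebesgue. x \<in> \<Omega> \<longrightarrow> \<psi> k x = 0"
      using AE_restrict_space_iff[of \<Omega> lebesgue] sets_dom by simp
    then have "AE x in lebesgue. x \<notin> box (a k) (b k)"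
    proof eventually_elim
      case (elim x)
      show ?case
      proof
        assume x: "x \<in> box (a k) (b k)"
        then have "\<psi> k x \<noteq> 0" unfolding \<psi>_def bump_nonzero .
        then show False using elim x sub[of k] box_subset_cbox by blast
      qed
    qed
    then have "negligible (box (a k) (b k))"
      by (simp add: negligible_iff_null_sets AE_iff_null_sets)
    then show False using open_not_negligible[OF open_box] ab(1)[of k] by blast
  qed
  define cc where "cc k = 1 / sqrt (L2_inner \<Omega> (\<psi> k) (\<psi> k))" for k
  define \<phi> where "\<phi> k = (\<lambda>x. cc k * \<psi> k x)" for k
  have \<phi>H: "\<phi> k \<in> H1 \<Omega>" for k unfolding \<phi>_def using grad.scale_mem[OF \<psi>H] .
  moreover have "L2_inner \<Omega> (\<phi> i) (\<phi> j) = (if i = j then 1 else 0)" for i j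
  proof -
    have "L2_inner \<Omega> (\<phi> i) (\<phi> j) = cc i * L2_inner \<Omega> (\<psi> i) (\<phi> j)"
      unfolding \<phi>_def[of i] by (rule L2.scale_left[OF H1D(1)[OF \<psi>H] H1D(1)[OF \<phi>H]])
    also have "L2_inner \<Omega> (\<psi> i) (\<phi> j) = L2_inner \<Omega> (\<phi> j) (\<psi> i)"
      by (rule L2.sym[OF H1D(1)[OF \<psi>H] H1D(1)[OF \<phi>H]])
    also have "\<dots> = cc j * L2_inner \<Omega> (\<psi> j) (\<psi> i)"
      unfolding \<phi>_def[of j] by (rule L2.scale_left[OF H1D(1)[OF \<psi>H] H1D(1)[OF \<psi>H]])
    finally have "L2_inner \<Omega> (\<phi> i) (\<phi> j) = cc i * (cc j * L2_inner \<Omega> (\<psi> j) (\<psi> i))" .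
    then show ?thesis using orth[of j i] pos[of i] by (cases "i = j") (auto simp: cc_def)
  qed
  ultimately show ?thesis by blast
qed

end

section \<open>Ball averages and the sharp maximal function\<close>

lemma integrable_lebesgue_on_subset:
  fixes f :: "'a::euclidean_space \<Rightarrow> real"
  assumes "integrable (lebesgue_on T) f" "S \<subseteq> T" "S \<in> sets lebesgue" "T \<in> sets lebesgue"
  shows "integrable (lebesgue_on S) f"
proof -
  have "integrable lebesgue (\<lambda>x. indicator S x *\<^sub>R (indicator T x *\<^sub>R f x))"
  proof (rule integrable_mult_indicator)
    show "integrable lebesgue (\<lambda>x. indicator T x *\<^sub>R f x)"
      using assms integrable_restrict_space[of T lebesgue f] by simp
  qed (use assms in simp)
  moreover have "(\<lambda>x. indicator S x *\<^sub>R (indicator T x *\<^sub>R f x)) = (\<lambda>x. indicator S x *\<^sub>R f x)"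
    using assms(2) by (auto simp: fun_eq_iff split: split_indicator)
  ultimately show ?thesis using assms(3) integrable_restrict_space[of S lebesgue f] by simp
qed

text \<open>The average over the smaller set is compared with the oscillation over the larger one,
  so that averages over different sets can be compared with the same constant.\<close>

lemma average_minus_const_le:
  fixes f :: "'a::euclidean_space \<Rightarrow> real"
  assumes f: "integrable (lebesgue_on T) f" and T: "T \<in> lmeasurable" and S: "S \<subseteq> T" "S \<in> sets lebesgue"
    and m: "measure lebesgue S > 0"
  shows "\<bar>(LINT x|lebesgue_on S. f x) / measure lebesgue S - P\<bar> \<le> (LINT x|lebesgue_on T. \<bar>f x - P\<bar>) / measure lebesgue S"
proof -
  have Ts: "T \<in> sets lebesgue" using T by blast
  have Sm: "S \<in> lmeasurable" using S T fmeasurableI2 by blast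
  interpret T: finite_measure "lebesgue_on T" using T finite_measure_lebesgue_on by (intro finite_measureI) (auto simp: emeasure_restrict_space fmeasurable_def)
  interpret S: finite_measure "lebesgue_on S" using Sm by (intro finite_measureI) (auto simp: emeasure_restrict_space fmeasurable_def)
  have fP: "integrable (lebesgue_on T) (\<lambda>x. \<bar>f x - P\<bar>)" using f by auto
  have fS: "integrable (lebesgue_on S) f" by (rule integrable_lebesgue_on_subset[OF f S Ts])
  have "(LINT x|lebesgue_on S. f x - P) = (LINT x|lebesgue_on S. f x) - P * measure lebesgue S"
    using fS S(2) by (simp add: measure_restrict_space space_restrict_space)
  then have "(LINT x|lebesgue_on S. f x) / measure lebesgue S - P = (LINT x|lebesgue_on S. f x - P) / measure lebesgue S"
    using m by (simp add: field_simps)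
  then have "\<bar>(LINT x|lebesgue_on S. f x) / measure lebesgue S - P\<bar> = \<bar>LINT x|lebesgue_on S. f x - P\<bar> / measure lebesgue S"
    using m by (simp add: abs_divide)
  also have "\<bar>LINT x|lebesgue_on S. f x - P\<bar> \<le> (LINT x|lebesgue_on S. \<bar>f x - P\<bar>)"
    using integral_norm_bound[of "lebesgue_on S" "\<lambda>x. f x - P"] by simp
  also have "\<dots> \<le> (LINT x|lebesgue_on T. \<bar>f x - P\<bar>)"
  proof -
    have iS: "integrable lebesgue (\<lambda>x. indicator S x *\<^sub>R \<bar>f x - P\<bar>)"
      using integrable_lebesgue_on_subset[OF fP S Ts] S(2) integrable_restrict_space[of S lebesgue "\<lambda>x. \<bar>f x - P\<bar>"] by simp
    have iT: "integrable lebesgue (\<lambda>x. indicator T x *\<^sub>R \<bar>f x - P\<bar>)"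
      using fP Ts integrable_restrict_space[of T lebesgue "\<lambda>x. \<bar>f x - P\<bar>"] by simp
    have "(LINT x|lebesgue. indicator S x *\<^sub>R \<bar>f x - P\<bar>) \<le> (LINT x|lebesgue. indicator T x *\<^sub>R \<bar>f x - P\<bar>)"
      using S(1) by (intro integral_mono iS iT) (auto split: split_indicator)
    then show ?thesis using S(2) Ts by (simp add: integral_restrict_space)
  qed
  finally show ?thesis using m by (simp add: divide_right_mono)
qed

text \<open>The density bound is demanded on the closure because averages are also taken at boundary
  points; \<open>n_set_closure_density\<close> provides it.\<close>

locale n_set_domain = bounded_open \<Omega> for \<Omega> :: "'a::euclidean_space set" +
  fixes c0 :: real
  assumes c0: "c0 > 0"
    and density: "x \<in> closure \<Omega> \<Longrightarrow> 0 < r \<Longrightarrow> r \<le> 1 \<Longrightarrow> c0 * r ^ DIM('a) \<le> measure lebesgue (\<Omega> \<inter> ball x r)"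
begin

definition unit_vol :: real where "unit_vol = measure lebesgue (ball (0::'a) 1)"

text \<open>The factor 2 counts the two averages compared, the power of 4 comes from radii as small
  as \<open>R / 4\<close>, and the quotient arises because \<open>sharp_maximal\<close> divides by
  the volume of the full ball while the averages divide by at least \<open>c0\<close> times a power
  of the radius.\<close>

definition K_sharp :: real where "K_sharp = 2 * 4 ^ DIM('a) * unit_vol / c0"

lemma measure_ball: "r \<ge> 0 \<Longrightarrow> measure lebesgue (ball (x::'a) r) = r ^ DIM('a) * unit_vol"
  unfolding unit_vol_def using content_ball_conv_unit_ball[of r x] by simp

lemma emeasure_ball: "r \<ge> 0 \<Longrightarrow> emeasure lebesgue (ball (x::'a) r) = ennreal (r ^ DIM('a) * unit_vol)"
  using measure_ball[of r x] emeasure_eq_measure2[OF lmeasurable_ball, of x r] by simp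

lemma unit_vol_pos: "unit_vol > 0"
  unfolding unit_vol_def using content_ball_pos[of 1 "0::'a"] by simp

lemma K_sharp_pos: "K_sharp > 0"
  unfolding K_sharp_def using unit_vol_pos c0 by simp

lemma measure_dom_ball_pos: "x \<in> closure \<Omega> \<Longrightarrow> r > 0 \<Longrightarrow> measure lebesgue (\<Omega> \<inter> ball x r) > 0"
proof -
  assume x: "x \<in> closure \<Omega>" and r: "r > 0"
  have "0 < c0 * (min r 1) ^ DIM('a)" using c0 r by simp
  also have "\<dots> \<le> measure lebesgue (\<Omega> \<inter> ball x (min r 1))" using x r by (intro density) auto
  also have "\<dots> \<le> measure lebesgue (\<Omega> \<inter> ball x r)"
    using sets_dom by (intro measure_mono_fmeasurable) (auto intro!: bounded_set_imp_lmeasurable bounded_Int)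
  finally show ?thesis .
qed

text \<open>Both averages are compared with the same arbitrary constant \<open>P\<close>, and then
  the infimum over \<open>P\<close> is taken. The ratio \<open>R / 4\<close> allows radius r/2
  inside a ball of radius 2r around another point, as needed at the boundary. Values stay in
  \<open>ennreal\<close> because the maximal function may be infinite.\<close>

lemma average_diff_sharp:
  assumes u: "u \<in> L2 \<Omega>" and x: "x \<in> closure \<Omega>" "x' \<in> closure \<Omega>" and R: "R > 0"
    and b: "ball x \<rho> \<subseteq> ball y R" "ball x' \<rho>' \<subseteq> ball y R"
    and \<rho>: "R / 4 \<le> \<rho>" "\<rho> \<le> 1" "R / 4 \<le> \<rho>'" "\<rho>' \<le> 1"
  shows "ennreal \<bar>ball_average \<Omega> u x \<rho> - ball_average \<Omega> u x' \<rho>'\<bar> \<le> ennreal (K_sharp * R) * sharp_maximal \<Omega> u y"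
proof -
  let ?n = "DIM('a)" and ?T = "ball y R \<inter> \<Omega>"
  let ?D = "\<bar>ball_average \<Omega> u x \<rho> - ball_average \<Omega> u x' \<rho>'\<bar>"
  define J where "J P = (LINT z|lebesgue_on ?T. \<bar>u z - P\<bar>)" for P
  define C where "C = 2 * 4 ^ ?n / (c0 * R ^ ?n)"
  define l where "l = R ^ ?n * unit_vol"
  have C: "C > 0" and l: "l > 0" using c0 R unit_vol_pos by (auto simp: C_def l_def)
  have Tm: "?T \<in> lmeasurable" using sets_dom bounded_dom by (intro bounded_set_imp_lmeasurable) auto
  have Ts: "?T \<in> sets lebesgue" using Tm by blast
  interpret T: finite_measure "lebesgue_on ?T"
    using Tm Ts by (intro finite_measureI) (auto simp: emeasure_restrict_space fmeasurable_def)
  have uT: "integrable (lebesgue_on ?T) u"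
    by (rule integrable_lebesgue_on_subset[OF L2_integrable[OF bs u] _ Ts sets_dom]) auto
  have J0: "0 \<le> J P" for P unfolding J_def by simp
  have one: "\<bar>ball_average \<Omega> u z s - P\<bar> \<le> C / 2 * J P"
    if z: "z \<in> closure \<Omega>" "ball z s \<subseteq> ball y R" "R / 4 \<le> s" "s \<le> 1" for z s P
  proof -
    have s: "s > 0" using z R by linarith
    have "c0 * (R / 4) ^ ?n \<le> c0 * s ^ ?n" using c0 R z by (intro mult_left_mono power_mono) auto
    also have "\<dots> \<le> measure lebesgue (\<Omega> \<inter> ball z s)" by (rule density[OF z(1) s z(4)])
    finally have m: "c0 * (R / 4) ^ ?n \<le> measure lebesgue (\<Omega> \<inter> ball z s)" .
    have m0: "0 < c0 * (R / 4) ^ ?n" using c0 R by simp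
    have "\<bar>ball_average \<Omega> u z s - P\<bar> \<le> J P / measure lebesgue (\<Omega> \<inter> ball z s)"
      unfolding ball_average_def J_def
      using z(2) sets_dom m m0 by (intro average_minus_const_le uT Tm) auto
    also have "\<dots> \<le> J P / (c0 * (R / 4) ^ ?n)" using m m0 J0 by (intro divide_left_mono) auto
    also have "\<dots> = C / 2 * J P" by (simp add: C_def power_divide)
    finally show ?thesis .
  qed
  have D: "?D \<le> C * J P" for P
    using one[OF x(1) b(1) \<rho>(1,2), of P] one[OF x(2) b(2) \<rho>(3,4), of P] by linarith
  have "ennreal (?D / (C * l)) \<le> (\<integral>\<^sup>+ z. ennreal \<bar>u z - P\<bar> \<partial>lebesgue_on ?T) / emeasure lebesgue (ball y R)" for P
  proof -
    have "(\<integral>\<^sup>+ z. ennreal \<bar>u z - P\<bar> \<partial>lebesgue_on ?T) = ennreal (J P)"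
      unfolding J_def using uT by (intro nn_integral_eq_integral) auto
    then have eq: "(\<integral>\<^sup>+ z. ennreal \<bar>u z - P\<bar> \<partial>lebesgue_on ?T) / emeasure lebesgue (ball y R) = ennreal (J P / l)"
      using emeasure_ball[of R y] R l J0 divide_ennreal[of "J P" l] by (simp add: l_def)
    have "?D / (C * l) \<le> J P / l"
      using divide_right_mono[OF D[of P], of "C * l"] C l by simp
    then show ?thesis unfolding eq by (rule ennreal_leI)
  qed
  then have "ennreal (?D / (C * l)) \<le> (INF P\<in>UNIV. (\<integral>\<^sup>+ z. ennreal \<bar>u z - P\<bar> \<partial>lebesgue_on ?T) / emeasure lebesgue (ball y R))"
    by (intro INF_greatest) auto
  then have "ennreal (?D / (C * l)) / ennreal R
    \<le> (INF P\<in>UNIV. (\<integral>\<^sup>+ z. ennreal \<bar>u z - P\<bar> \<partial>lebesgue_on ?T) / emeasure lebesgue (ball y R)) / ennreal R"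
    by (rule divide_right_mono_ennreal)
  also have "\<dots> \<le> sharp_maximal \<Omega> u y"
    unfolding sharp_maximal_def by (rule SUP_upper2[of R]) (use R in auto)
  finally have "ennreal (?D / (C * l * R)) \<le> sharp_maximal \<Omega> u y"
    using R C l by (simp add: divide_ennreal field_simps)
  then have "ennreal (C * l * R) * ennreal (?D / (C * l * R)) \<le> ennreal (C * l * R) * sharp_maximal \<Omega> u y"
    by (rule mult_left_mono) simp
  moreover have "ennreal (C * l * R) * ennreal (?D / (C * l * R)) = ennreal ?D"
    using C l R by (simp add: ennreal_mult[symmetric])
  moreover have "C * l * R = K_sharp * R" unfolding C_def l_def K_sharp_def using R c0 by simp
  ultimately show ?thesis by simp
qed

subsection \<open>Measurability and continuity of ball averages\<close>

text \<open>Measurability in the centre of the ball and Fubini's theorem need a Borel integrand on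
  the product space, whereas elements of \<open>L2 \<Omega>\<close> are only Lebesgue
  measurable.\<close>

lemma borel_representative:
  assumes u: "integrable (lebesgue_on \<Omega>) u"
  obtains w where "w \<in> borel_measurable borel" "integrable lborel w" "\<And>x. x \<notin> \<Omega> \<Longrightarrow> w x = (0::real)"
    "AE x in lebesgue_on \<Omega>. u x = w x"
proof -
  have fl: "integrable lebesgue (\<lambda>x. indicator \<Omega> x * u x)"
    using u sets_dom integrable_restrict_space[of \<Omega> lebesgue u] by simp
  obtain g where g[measurable]: "g \<in> borel_measurable lborel" and gf: "AE x in lborel. indicator \<Omega> x * u x = g x"
    using completion_ex_borel_measurable_real[OF borel_measurable_integrable[OF fl]] by blast
  let ?w = "\<lambda>x. indicator \<Omega> x * g x"
  have [measurable]: "\<Omega> \<in> sets borel" using open_dom by simp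
  have wm: "?w \<in> borel_measurable lborel" by measurable
  have ae: "AE x in lebesgue. indicator \<Omega> x * u x = ?w x"
    using AE_completion[OF gf] by eventually_elim (auto split: split_indicator)
  have "integrable lebesgue ?w"
    using integrable_cong_AE_imp[OF fl measurable_completion[OF wm] ae] .
  then have "integrable lborel ?w" using integrable_completion[OF wm] by simp
  moreover have "AE x in lebesgue_on \<Omega>. u x = ?w x"
    using sets_dom ae AE_restrict_space_iff[of \<Omega> lebesgue] by (auto elim!: eventually_mono split: split_indicator)
  ultimately show ?thesis using that[of ?w] wm by simp
qed

lemma set_integral_representative:
  assumes u: "integrable (lebesgue_on \<Omega>) u"
    and w: "w \<in> borel_measurable borel" "AE x in lebesgue_on \<Omega>. u x = w x"
    and S: "S \<in> sets borel" "S \<subseteq> \<Omega>"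
  shows "(LINT x|lebesgue_on S. u x) = (LINT x|lborel. indicator S x * (w x :: real))"
proof -
  have Ss: "S \<in> sets lebesgue" using S(1) by auto
  have "AE x in lebesgue. x \<in> \<Omega> \<longrightarrow> u x = w x"
    using w(2) sets_dom AE_restrict_space_iff[of \<Omega> lebesgue] by simp
  then have ae: "AE x in lebesgue. indicator S x *\<^sub>R u x = indicator S x * w x"
    by eventually_elim (use S(2) in \<open>auto split: split_indicator\<close>)
  have [measurable]: "S \<in> sets borel" "w \<in> borel_measurable borel" by fact+
  have wm: "(\<lambda>x. indicator S x * w x) \<in> borel_measurable lborel" by measurable
  have "integrable lebesgue (\<lambda>x. indicator S x *\<^sub>R u x)"
    using integrable_lebesgue_on_subset[OF u S(2) Ss sets_dom] integrable_restrict_space[of S lebesgue u] Ss by simp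
  then have "(LINT x|lebesgue. indicator S x *\<^sub>R u x) = (LINT x|lebesgue. indicator S x * w x)"
    by (intro integral_cong_AE ae measurable_completion[OF wm]) auto
  then show ?thesis using Ss integral_restrict_space[of S lebesgue u] integral_completion[OF wm] by simp
qed

lemma ball_average_representative:
  assumes u: "integrable (lebesgue_on \<Omega>) u"
    and w: "w \<in> borel_measurable borel" "\<And>x. x \<notin> \<Omega> \<Longrightarrow> w x = 0" "AE x in lebesgue_on \<Omega>. u x = w x"
  shows "ball_average \<Omega> u x r = (LINT z|lborel. indicator (ball x r) z * w z) / (LINT z|lborel. indicator (\<Omega> \<inter> ball x r) z)"
proof -
  have [measurable]: "\<Omega> \<in> sets borel" using open_dom by simp
  have "(LINT z|lebesgue_on (\<Omega> \<inter> ball x r). u z) = (LINT z|lborel. indicator (\<Omega> \<inter> ball x r) z * w z)"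
    by (rule set_integral_representative[OF u w(1,3)]) auto
  also have "(\<lambda>z. indicator (\<Omega> \<inter> ball x r) z * w z) = (\<lambda>z. indicator (ball x r) z * w z)"
    using w(2) by (auto simp: fun_eq_iff split: split_indicator)
  finally show ?thesis unfolding ball_average_def by simp
qed

lemma borel_measurable_ball_integral:
  fixes w :: "'a \<Rightarrow> real"
  assumes [measurable]: "w \<in> borel_measurable borel"
  shows "(\<lambda>x. LINT z|lborel. indicator (ball x r) z * w z) \<in> borel_measurable borel"
proof -
  have "(\<lambda>(x, z). (if dist x z < r then w z else 0)) \<in> borel_measurable (borel \<Otimes>\<^sub>M lborel)"
    by measurable
  then have "(\<lambda>x. LINT z|lborel. (if dist x z < r then w z else 0)) \<in> borel_measurable borel"
    by (rule lborel.borel_measurable_lebesgue_integral)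
  moreover have "(\<lambda>z. if dist x z < r then w z else 0) = (\<lambda>z. indicator (ball x r) z * w z)" for x
    by (auto simp: fun_eq_iff)
  ultimately show ?thesis by simp
qed

lemma borel_measurable_ball_average:
  assumes u: "integrable (lebesgue_on \<Omega>) u"
  shows "(\<lambda>x. ball_average \<Omega> u x r) \<in> borel_measurable borel"
proof -
  obtain w where w: "w \<in> borel_measurable borel" "integrable lborel w" "\<And>x. x \<notin> \<Omega> \<Longrightarrow> w x = (0::real)"
    "AE x in lebesgue_on \<Omega>. u x = w x" by (rule borel_representative[OF u]) blast
  have [measurable]: "\<Omega> \<in> sets borel" using open_dom by simp
  have "(\<lambda>x. LINT z|lborel. indicator (ball x r) z * (indicator \<Omega> z :: real)) \<in> borel_measurable borel"
    by (rule borel_measurable_ball_integral) measurable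
  moreover have "(\<lambda>z. indicator (ball x r) z * (indicator \<Omega> z :: real)) = indicator (\<Omega> \<inter> ball x r)" for x
    by (auto simp: fun_eq_iff split: split_indicator)
  moreover have "ball_average \<Omega> u x r = (LINT z|lborel. indicator (ball x r) z * w z) / (LINT z|lborel. indicator (\<Omega> \<inter> ball x r) z)" for x
    by (rule ball_average_representative[OF u w(1) _ w(4)]) (rule w(3))
  ultimately show ?thesis
    using borel_measurable_ball_integral[OF w(1), of r] by simp
qed

text \<open>Open balls increase to the open ball as the radius increases to \<open>\<rho>\<close>;
  from the right one would obtain the closed ball. Left continuity suffices for passing from
  rational to arbitrary radii.\<close>

lemma ball_integral_left_continuous:
  fixes w :: "'a \<Rightarrow> real"
  assumes w: "integrable lborel w"
  shows "((\<lambda>r. LINT z|lborel. indicator (ball x r) z * w z) \<longlongrightarrow> (LINT z|lborel. indicator (ball x \<rho>) z * w z)) (at_left \<rho>)"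
proof (rule tendsto_at_left_sequentially[of "\<rho> - 1"])
  fix S :: "nat \<Rightarrow> real" assume S: "\<And>n. S n < \<rho>" "S \<longlonglongrightarrow> \<rho>"
  have [measurable]: "w \<in> borel_measurable borel" using w by (simp add: borel_measurable_integrable)
  show "(\<lambda>n. LINT z|lborel. indicator (ball x (S n)) z * w z) \<longlonglongrightarrow> (LINT z|lborel. indicator (ball x \<rho>) z * w z)"
  proof (rule integral_dominated_convergence[where w = "\<lambda>z. \<bar>w z\<bar>"])
    show "AE z in lborel. (\<lambda>n. indicator (ball x (S n)) z * w z) \<longlonglongrightarrow> indicator (ball x \<rho>) z * w z"
    proof (rule AE_I2, rule tendsto_eventually)
      fix z
      show "\<forall>\<^sub>F n in sequentially. indicator (ball x (S n)) z * w z = indicator (ball x \<rho>) z * w z"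
      proof (cases "dist x z < \<rho>")
        case True
        then have "\<forall>\<^sub>F n in sequentially. dist x z < S n" using order_tendstoD(1)[OF S(2)] by blast
        then show ?thesis by eventually_elim (use True in auto)
      next
        case False
        then have "\<not> dist x z < S n" for n using S(1)[of n] by linarith
        then show ?thesis using False by simp
      qed
    qed
    show "(\<lambda>z. indicator (ball x r) z * w z) \<in> borel_measurable lborel" for r
      by (intro borel_measurable_times borel_measurable_indicator) auto
    then show "(\<lambda>z. indicator (ball x (S n)) z * w z) \<in> borel_measurable lborel" for n .
    show "AE z in lborel. norm (indicator (ball x (S n)) z * w z) \<le> \<bar>w z\<bar>" for n
      by (auto split: split_indicator)
  qed (use w in simp)
qed simp

lemma ball_average_left_continuous:
  assumes u: "integrable (lebesgue_on \<Omega>) u" and x: "x \<in> closure \<Omega>" and \<rho>: "\<rho> > 0"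
  shows "(ball_average \<Omega> u x \<longlongrightarrow> ball_average \<Omega> u x \<rho>) (at_left \<rho>)"
proof -
  obtain w where w: "w \<in> borel_measurable borel" "integrable lborel w" "\<And>x. x \<notin> \<Omega> \<Longrightarrow> w x = (0::real)"
    "AE x in lebesgue_on \<Omega>. u x = w x" by (rule borel_representative[OF u]) blast
  have \<Omega>b: "\<Omega> \<in> sets borel" using open_dom by simp
  have "integrable lborel (indicator \<Omega> :: 'a \<Rightarrow> real)"
    using emeasure_bounded_finite[OF bounded_dom] \<Omega>b by (intro integrable_real_indicator) auto
  note c = ball_integral_left_continuous[OF this, of x \<rho>]
  have eq: "(\<lambda>z. indicator (ball x r) z * (indicator \<Omega> z :: real)) = indicator (\<Omega> \<inter> ball x r)" for r
    by (auto simp: fun_eq_iff split: split_indicator)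
  have "(LINT z|lborel. (indicator (\<Omega> \<inter> ball x \<rho>) z :: real)) = measure lebesgue (\<Omega> \<inter> ball x \<rho>)"
    using \<Omega>b by simp
  then have "(LINT z|lborel. (indicator (\<Omega> \<inter> ball x \<rho>) z :: real)) \<noteq> 0"
    using measure_dom_ball_pos[OF x \<rho>] by simp
  moreover have "ball_average \<Omega> u x = (\<lambda>r. (LINT z|lborel. indicator (ball x r) z * w z) / (LINT z|lborel. indicator (\<Omega> \<inter> ball x r) z))"
    by (rule ext, rule ball_average_representative[OF u w(1) _ w(4)]) (rule w(3))
  ultimately show ?thesis
    by (simp only:) (intro tendsto_divide ball_integral_left_continuous[OF w(2)] c[unfolded eq])
qed

end

section \<open>Limits of ball averages\<close>

text \<open>Telescoping with ratio \<open>sqrt q\<close>, because the increments are controlled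
  through their squares. The hypothesis covers all radii within a dyadic interval, so the limit
  exists along all radii and not merely along the dyadic ones.\<close>

lemma dyadic_limit:
  fixes a :: "real \<Rightarrow> real"
  assumes r0: "r0 > 0" and q: "0 \<le> q" "q < 1" and S: "S \<ge> 0"
    and step: "\<And>k \<rho>. r0 / 2 ^ Suc k \<le> \<rho> \<Longrightarrow> \<rho> \<le> r0 / 2 ^ k \<Longrightarrow> (a (r0 / 2 ^ k) - a \<rho>)\<^sup>2 \<le> S * q ^ k"
  shows "\<exists>l. (a \<longlongrightarrow> l) (at_right 0) \<and> (l - a r0)\<^sup>2 \<le> S / (1 - sqrt q)\<^sup>2"
    and "0 < \<rho> \<Longrightarrow> \<rho> \<le> r0 \<Longrightarrow> \<bar>a \<rho> - a r0\<bar> \<le> 2 * sqrt S / (1 - sqrt q)"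
proof -
  define s where "s = sqrt q"
  define t where "t = sqrt S"
  define r where "r k = r0 / 2 ^ k" for k :: nat
  have s: "0 \<le> s" "s < 1" and t: "t \<ge> 0" using q S real_sqrt_less_mono[of q 1] by (auto simp: s_def t_def)
  have rpos: "r k > 0" for k using r0 by (simp add: r_def)
  have rS: "r (Suc k) \<le> r k" for k using r0 by (simp add: r_def field_simps)
  have r_anti: "r j \<le> r k" if "k \<le> j" for j k using lift_Suc_antimono_le[of r, OF rS that] .
  have st: "\<bar>a (r k) - a \<rho>\<bar> \<le> t * s ^ k" if "r (Suc k) \<le> \<rho>" "\<rho> \<le> r k" for k \<rho>
  proof -
    have "\<bar>a (r k) - a \<rho>\<bar> \<le> sqrt (S * q ^ k)" using step[of k \<rho>] that unfolding r_def
      by (metis real_sqrt_abs real_sqrt_le_mono)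
    then show ?thesis by (simp add: s_def t_def real_sqrt_mult real_sqrt_power)
  qed
  have ind: "\<bar>a (r k) - a (r (k + i))\<bar> \<le> t * (s ^ k - s ^ (k + i)) / (1 - s)" for k i
  proof (induction i)
    case (Suc i)
    have "\<bar>a (r (k + i)) - a (r (k + Suc i))\<bar> \<le> t * s ^ (k + i)" using st[of "k + i" "r (Suc (k + i))"] rS by simp
    also have "\<dots> = t * (s ^ (k + i) - s ^ (k + Suc i)) / (1 - s)" using s by (simp add: field_simps)
    finally have "\<bar>a (r k) - a (r (k + Suc i))\<bar> \<le> t * (s ^ k - s ^ (k + i)) / (1 - s) + t * (s ^ (k + i) - s ^ (k + Suc i)) / (1 - s)"
      using Suc by linarith
    also have "\<dots> = t * (s ^ k - s ^ (k + Suc i)) / (1 - s)" by (simp add: add_divide_distrib[symmetric] algebra_simps)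
    finally show ?case .
  qed simp
  have ind': "\<bar>a (r k) - a (r j)\<bar> \<le> t * s ^ k / (1 - s)" if "k \<le> j" for k j
  proof -
    have "t * (s ^ k - s ^ j) / (1 - s) \<le> t * s ^ k / (1 - s)"
      using s t by (intro divide_right_mono mult_left_mono) auto
    then show ?thesis using ind[of k "j - k"] that by simp
  qed
  have s0: "(\<lambda>k. C * s ^ k) \<longlonglongrightarrow> 0" for C
    using tendsto_mult_right_zero[OF LIMSEQ_realpow_zero[OF s]] .
  have "Cauchy (\<lambda>k. a (r k))"
  proof (rule CauchyI)
    fix e :: real assume e: "e > 0"
    then obtain K where K: "\<And>k. k \<ge> K \<Longrightarrow> 2 * t / (1 - s) * s ^ k < e"
      using order_tendstoD(2)[OF s0[of "2 * t / (1 - s)"] e] unfolding eventually_sequentially by blast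
    have "norm (a (r m) - a (r n)) < e" if "m \<ge> K" "n \<ge> K" for m n
    proof -
      have "2 * (t * s ^ K / (1 - s)) < e" using K[of K] by (simp add: mult.assoc)
      then show ?thesis using ind'[of K m] ind'[of K n] that unfolding real_norm_def by linarith
    qed
    then show "\<exists>K. \<forall>m\<ge>K. \<forall>n\<ge>K. norm (a (r m) - a (r n)) < e" by blast
  qed
  then obtain l where l: "(\<lambda>k. a (r k)) \<longlonglongrightarrow> l" using Cauchy_convergent convergent_def by blast
  have lim: "\<bar>a (r k) - l\<bar> \<le> t * s ^ k / (1 - s)" for k
  proof (rule LIMSEQ_le_const2)
    show "(\<lambda>j. \<bar>a (r k) - a (r j)\<bar>) \<longlonglongrightarrow> \<bar>a (r k) - l\<bar>" by (intro tendsto_intros l)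
    show "\<exists>N. \<forall>n\<ge>N. \<bar>a (r k) - a (r n)\<bar> \<le> t * s ^ k / (1 - s)" using ind' by blast
  qed
  \<comment> \<open>Locates an arbitrary radius in its dyadic interval, using the first dyadic
    radius below it.\<close>
  have ex: "\<exists>k\<ge>K. r (Suc k) \<le> \<rho> \<and> \<rho> \<le> r k" if \<rho>: "0 < \<rho>" "\<rho> \<le> r K" for \<rho> K
  proof -
    have "(\<lambda>k. r0 * (1/2) ^ k) \<longlonglongrightarrow> 0" by (intro tendsto_mult_right_zero LIMSEQ_realpow_zero) auto
    then have "(\<lambda>k. r k) \<longlonglongrightarrow> 0" by (simp add: r_def power_divide)
    from order_tendstoD(2)[OF this \<rho>(1)] obtain j where "r j < \<rho>" unfolding eventually_sequentially by auto
    define i where "i = (LEAST i. r i < \<rho>)"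
    have i: "r i < \<rho>" unfolding i_def using \<open>r j < \<rho>\<close> by (rule LeastI)
    have "i > K" using r_anti[of i K] i \<rho> by (metis leI order_less_le_trans order_less_le not_less)
    then obtain k where k: "i = Suc k" "k \<ge> K" by (cases i) auto
    have "\<not> r k < \<rho>" using not_less_Least[of k "\<lambda>i. r i < \<rho>"] k unfolding i_def by simp
    then show ?thesis using i k by (intro exI[of _ k]) auto
  qed
  have near: "\<bar>a \<rho> - l\<bar> \<le> 2 * t / (1 - s) * s ^ k" if "r (Suc k) \<le> \<rho>" "\<rho> \<le> r k" for k \<rho>
  proof -
    have "t * s ^ k * (1 - s) \<le> t * s ^ k * 1" using s t by (intro mult_left_mono) auto
    then have "t * s ^ k \<le> t * s ^ k / (1 - s)" using s by (simp add: pos_le_divide_eq)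
    moreover have "2 * t / (1 - s) * s ^ k = 2 * (t * s ^ k / (1 - s))" by simp
    ultimately show ?thesis using st[OF that] lim[of k] by linarith
  qed
  have "(a \<longlongrightarrow> l) (at_right 0)"
  proof (rule tendstoI)
    fix e :: real assume e: "e > 0"
    then obtain K where K: "\<And>k. k \<ge> K \<Longrightarrow> 2 * t / (1 - s) * s ^ k < e"
      using order_tendstoD(2)[OF s0[of "2 * t / (1 - s)"] e] unfolding eventually_sequentially by blast
    have "dist (a \<rho>) l < e" if \<rho>: "0 < \<rho>" "\<rho> < r K" for \<rho>
    proof -
      obtain k where "k \<ge> K" "r (Suc k) \<le> \<rho>" "\<rho> \<le> r k" using ex[of \<rho> K] \<rho> by auto
      then show ?thesis using near[of k \<rho>] K[of k] by (simp add: dist_real_def)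
    qed
    then show "\<forall>\<^sub>F \<rho> in at_right 0. dist (a \<rho>) l < e"
      unfolding eventually_at_right_field using rpos[of K] by blast
  qed
  moreover have "(l - a r0)\<^sup>2 \<le> S / (1 - sqrt q)\<^sup>2"
  proof -
    have "\<bar>l - a r0\<bar> \<le> t / (1 - s)" using lim[of 0] by (simp add: r_def abs_minus_commute)
    then have "\<bar>l - a r0\<bar>\<^sup>2 \<le> (t / (1 - s))\<^sup>2" by (intro power_mono) auto
    then show ?thesis using S by (simp add: t_def s_def power_divide)
  qed
  ultimately show "\<exists>l. (a \<longlongrightarrow> l) (at_right 0) \<and> (l - a r0)\<^sup>2 \<le> S / (1 - sqrt q)\<^sup>2" by blast
  show "\<bar>a \<rho> - a r0\<bar> \<le> 2 * sqrt S / (1 - sqrt q)" if \<rho>: "0 < \<rho>" "\<rho> \<le> r0" for \<rho>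
  proof -
    have "r 0 = r0" by (simp add: r_def)
    then obtain k where k: "r (Suc k) \<le> \<rho>" "\<rho> \<le> r k" using ex[of \<rho> 0] \<rho> by auto
    have "\<bar>a (r 0) - a (r k)\<bar> \<le> t / (1 - s)" using ind'[of 0 k] by simp
    moreover have "\<bar>a (r k) - a \<rho>\<bar> \<le> t / (1 - s)"
    proof -
      have "t * s ^ k \<le> t * 1" using s t by (intro mult_left_mono power_le_one) auto
      also have "\<dots> \<le> t / (1 - s)" using s t by (simp add: pos_le_divide_eq mult_left_le)
      finally show ?thesis using st[OF k] by linarith
    qed
    ultimately show ?thesis using \<open>r 0 = r0\<close> by (simp add: t_def s_def)
  qed
qed

context n_set_domain
begin

text \<open>The real-valued version is \<open>0\<close> where the maximal function is infinite; for functions in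
  \<open>C12 \<Omega>\<close> this only happens on a null set.\<close>

definition sharp_real :: "('a \<Rightarrow> real) \<Rightarrow> 'a \<Rightarrow> real" where
  "sharp_real u y = enn2real (sharp_maximal \<Omega> u y)"

definition sharp_energy :: "('a \<Rightarrow> real) \<Rightarrow> real" where
  "sharp_energy u = enn2real (\<integral>\<^sup>+ x. (sharp_maximal \<Omega> u x)\<^sup>2 \<partial>lebesgue_on \<Omega>)"

lemma C12_sharp:
  assumes u: "u \<in> C12 \<Omega>"
  shows "AE y in lebesgue_on \<Omega>. sharp_maximal \<Omega> u y < top"
    and "sharp_real u \<in> L2 \<Omega>" and "L2_inner \<Omega> (sharp_real u) (sharp_real u) = sharp_energy u"
    and "(\<integral>\<^sup>+ x. (sharp_maximal \<Omega> u x)\<^sup>2 \<partial>lebesgue_on \<Omega>) = ennreal (sharp_energy u)"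
proof -
  have [measurable]: "sharp_maximal \<Omega> u \<in> borel_measurable (lebesgue_on \<Omega>)"
    and fin: "(\<integral>\<^sup>+ x. (sharp_maximal \<Omega> u x)\<^sup>2 \<partial>lebesgue_on \<Omega>) < top" using u by (auto simp: C12_def)
  have "AE y in lebesgue_on \<Omega>. (sharp_maximal \<Omega> u y)\<^sup>2 \<noteq> \<infinity>"
    by (rule nn_integral_PInf_AE) (use fin in auto)
  then show ae: "AE y in lebesgue_on \<Omega>. sharp_maximal \<Omega> u y < top"
    by eventually_elim (auto simp: power2_eq_square less_top[symmetric] ennreal_mult_eq_top_iff)
  show E: "(\<integral>\<^sup>+ x. (sharp_maximal \<Omega> u x)\<^sup>2 \<partial>lebesgue_on \<Omega>) = ennreal (sharp_energy u)"
    using fin by (simp add: sharp_energy_def)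
  have [measurable]: "sharp_real u \<in> borel_measurable (lebesgue_on \<Omega>)"
    unfolding sharp_real_def by measurable
  have nn: "(\<integral>\<^sup>+ y. ennreal ((sharp_real u y)\<^sup>2) \<partial>lebesgue_on \<Omega>) = ennreal (sharp_energy u)"
    unfolding E[symmetric]
  proof (rule nn_integral_cong_AE)
    show "AE y in lebesgue_on \<Omega>. ennreal ((sharp_real u y)\<^sup>2) = (sharp_maximal \<Omega> u y)\<^sup>2"
      using ae by eventually_elim (simp add: sharp_real_def ennreal_power[symmetric])
  qed
  have i: "integrable (lebesgue_on \<Omega>) (\<lambda>y. (sharp_real u y)\<^sup>2)"
    by (rule integrableI_bounded) (use nn in auto)
  then show "sharp_real u \<in> L2 \<Omega>" by (simp add: L2_def)
  have "ennreal (LINT y|lebesgue_on \<Omega>. (sharp_real u y)\<^sup>2) = ennreal (sharp_energy u)"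
    using nn_integral_eq_integral[OF i] nn by simp
  then show "L2_inner \<Omega> (sharp_real u) (sharp_real u) = sharp_energy u"
    unfolding L2_inner_self by (simp add: sharp_energy_def)
qed

lemma average_diff_sharp_real:
  assumes "u \<in> L2 \<Omega>" "x \<in> closure \<Omega>" "x' \<in> closure \<Omega>" "R > 0"
    and "ball x \<rho> \<subseteq> ball y R" "ball x' \<rho>' \<subseteq> ball y R"
    and "R / 4 \<le> \<rho>" "\<rho> \<le> 1" "R / 4 \<le> \<rho>'" "\<rho>' \<le> 1" and fin: "sharp_maximal \<Omega> u y < top"
  shows "\<bar>ball_average \<Omega> u x \<rho> - ball_average \<Omega> u x' \<rho>'\<bar> \<le> K_sharp * R * sharp_real u y"
proof -
  have "ennreal \<bar>ball_average \<Omega> u x \<rho> - ball_average \<Omega> u x' \<rho>'\<bar> \<le> ennreal (K_sharp * R) * sharp_maximal \<Omega> u y"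
    by (rule average_diff_sharp) (use assms in auto)
  also have "\<dots> = ennreal (K_sharp * R) * ennreal (sharp_real u y)" using fin by (simp add: sharp_real_def)
  also have "\<dots> = ennreal (K_sharp * R * sharp_real u y)"
    using K_sharp_pos assms(4) by (simp add: ennreal_mult sharp_real_def)
  finally show ?thesis using K_sharp_pos assms(4) by (subst (asm) ennreal_le_iff) (auto simp: sharp_real_def)
qed

text \<open>The point \<open>y\<close> lies in all its own balls, so the single value of the maximal
  function at \<open>y\<close> controls every scale; increments are proportional to the radius,
  hence the ratio 1/4 for their squares.\<close>

lemma interior_average_limit:
  assumes u: "u \<in> L2 \<Omega>" and y: "y \<in> \<Omega>" and fin: "sharp_maximal \<Omega> u y < top" and r0: "0 < r0" "r0 \<le> 1"
  shows "\<exists>l. (ball_average \<Omega> u y \<longlongrightarrow> l) (at_right 0) \<and> \<bar>l - ball_average \<Omega> u y r0\<bar> \<le> 2 * K_sharp * r0 * sharp_real u y"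
    and "0 < \<rho> \<Longrightarrow> \<rho> \<le> r0 \<Longrightarrow> \<bar>ball_average \<Omega> u y \<rho> - ball_average \<Omega> u y r0\<bar> \<le> 4 * K_sharp * r0 * sharp_real u y"
proof -
  let ?S = "(K_sharp * r0 * sharp_real u y)\<^sup>2"
  have yc: "y \<in> closure \<Omega>" using y closure_subset by blast
  have Fr: "sharp_real u y \<ge> 0" by (simp add: sharp_real_def)
  have step: "(ball_average \<Omega> u y (r0 / 2 ^ k) - ball_average \<Omega> u y \<rho>)\<^sup>2 \<le> ?S * (1 / 4) ^ k"
    if \<rho>: "r0 / 2 ^ Suc k \<le> \<rho>" "\<rho> \<le> r0 / 2 ^ k" for k \<rho>
  proof -
    let ?R = "r0 / 2 ^ k"
    have R: "?R > 0" "?R \<le> r0" using r0 by (auto simp: divide_le_eq mult_le_cancel_left1)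
    have "\<bar>ball_average \<Omega> u y ?R - ball_average \<Omega> u y \<rho>\<bar> \<le> K_sharp * ?R * sharp_real u y"
    proof (rule average_diff_sharp_real[OF u yc yc R(1) _ _ _ _ _ _ fin])
      show "?R / 4 \<le> \<rho>" using \<rho>(1) r0 by (simp add: field_simps)
      show "?R \<le> 1" "\<rho> \<le> 1" using R r0 \<rho> by linarith+
    qed (use R \<rho> subset_ball[OF \<rho>(2), of y] in auto)
    then have "\<bar>ball_average \<Omega> u y ?R - ball_average \<Omega> u y \<rho>\<bar>\<^sup>2 \<le> (K_sharp * ?R * sharp_real u y)\<^sup>2"
      by (intro power_mono) auto
    also have "\<dots> = ?S * (1 / 4) ^ k"
      by (simp add: power_mult_distrib power_divide power_mult[symmetric] power_even_eq[symmetric] mult.commute[of k 2] power_mult)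
    finally show ?thesis by simp
  qed
  have q: "sqrt (1 / 4) = (1 / 2 :: real)" by (simp add: real_sqrt_divide)
  have sq: "sqrt ?S = K_sharp * r0 * sharp_real u y" using K_sharp_pos r0 Fr by simp
  note dl = dyadic_limit[OF r0(1), of "1/4" ?S "ball_average \<Omega> u y", OF _ _ _ step, simplified q sq]
  show "\<exists>l. (ball_average \<Omega> u y \<longlongrightarrow> l) (at_right 0) \<and> \<bar>l - ball_average \<Omega> u y r0\<bar> \<le> 2 * K_sharp * r0 * sharp_real u y"
  proof -
    obtain l where l: "(ball_average \<Omega> u y \<longlongrightarrow> l) (at_right 0)" "(l - ball_average \<Omega> u y r0)\<^sup>2 \<le> ?S / (1 - 1/2)\<^sup>2"
      using dl(1) by auto
    have "?S / (1 - 1/2)\<^sup>2 = (2 * K_sharp * r0 * sharp_real u y)\<^sup>2" by (simp add: power2_eq_square)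
    then have "\<bar>l - ball_average \<Omega> u y r0\<bar> \<le> \<bar>2 * K_sharp * r0 * sharp_real u y\<bar>"
      using l(2) by (simp add: abs_le_square_iff)
    then show ?thesis using l(1) K_sharp_pos r0 Fr by (auto simp: abs_mult)
  qed
  show "\<bar>ball_average \<Omega> u y \<rho> - ball_average \<Omega> u y r0\<bar> \<le> 4 * K_sharp * r0 * sharp_real u y" if "0 < \<rho>" "\<rho> \<le> r0"
    using dl(2)[of \<rho>] that by simp
qed

subsection \<open>Averages as \<open>L\<^sup>2\<close> functionals\<close>

text \<open>As a product with a normalised indicator, the average at a fixed radius is a bounded
  linear functional on \<open>L2 \<Omega>\<close>; finitely many of these serve as the functionals
  in \<open>Tr_compact\<close>.\<close>

lemma ball_average_L2_inner:
  assumes u: "u \<in> L2 \<Omega>"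
  shows "ball_average \<Omega> u x r = L2_inner \<Omega> u (\<lambda>z. indicator (ball x r) z / measure lebesgue (\<Omega> \<inter> ball x r))"
    and "(\<lambda>z. indicator (ball x r) z / measure lebesgue (\<Omega> \<inter> ball x r)) \<in> L2 \<Omega>"
proof -
  let ?m = "measure lebesgue (\<Omega> \<inter> ball x r)"
  have ae: "AE x in lebesgue_on \<Omega>. u x = u x" by simp
  have S: "\<Omega> \<inter> ball x r \<in> sets lebesgue" using sets_dom by auto
  have "(LINT z|lebesgue_on (\<Omega> \<inter> ball x r). u z) = (LINT z|lebesgue. indicator \<Omega> z *\<^sub>R (u z * indicator (ball x r) z))"
    unfolding integral_restrict_space[of "\<Omega> \<inter> ball x r" lebesgue, simplified, OF S]
    by (intro arg_cong[of _ _ "integral\<^sup>L lebesgue"]) (auto simp: fun_eq_iff split: split_indicator)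
  also have "\<dots> = (LINT z|lebesgue_on \<Omega>. u z * indicator (ball x r) z)"
    using sets_dom by (simp only: integral_restrict_space[of \<Omega> lebesgue, simplified])
  finally show "ball_average \<Omega> u x r = L2_inner \<Omega> u (\<lambda>z. indicator (ball x r) z / ?m)"
    unfolding ball_average_def L2_inner_def by simp
  show "(\<lambda>z. indicator (ball x r) z / ?m) \<in> L2 \<Omega>"
  proof (rule L2_bounded_function[OF bs, where M = "1 / ?m"])
    show "(\<lambda>z. indicator (ball x r) z / ?m) \<in> borel_measurable borel"
      by (intro borel_measurable_divide borel_measurable_indicator) auto
  qed (auto split: split_indicator)
qed

lemma ball_average_lin:
  "u \<in> L2 \<Omega> \<Longrightarrow> v \<in> L2 \<Omega> \<Longrightarrow>
    ball_average \<Omega> (\<lambda>x. u x + c * v x) x r = ball_average \<Omega> u x r + c * ball_average \<Omega> v x r"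
  by (simp add: ball_average_L2_inner(1) L2.lin_mem L2.lin ball_average_L2_inner(2))

lemma ball_average_bound:
  assumes u: "u \<in> L2 \<Omega>" and x: "x \<in> closure \<Omega>" and r: "0 < r" "r \<le> 1"
  shows "(ball_average \<Omega> u x r)\<^sup>2 \<le> L2_inner \<Omega> u u * (measure lebesgue \<Omega> / (c0 * r ^ DIM('a))\<^sup>2)"
proof -
  let ?m = "measure lebesgue (\<Omega> \<inter> ball x r)"
  let ?h = "\<lambda>z. indicator (ball x r) z / ?m"
  interpret finite_measure "lebesgue_on \<Omega>" using finite_measure_lebesgue_on[OF bs] .
  have m: "c0 * r ^ DIM('a) \<le> ?m" "0 < c0 * r ^ DIM('a)" using density[OF x r] c0 r by auto
  have "L2_inner \<Omega> ?h ?h \<le> (LINT z|lebesgue_on \<Omega>. 1 / (c0 * r ^ DIM('a))\<^sup>2)"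
    unfolding L2_inner_self
  proof (rule integral_mono)
    show "integrable (lebesgue_on \<Omega>) (\<lambda>z. (?h z)\<^sup>2)" using L2D(2)[OF ball_average_L2_inner(2)[OF u]] .
    have "0 < ?m" using m by linarith
    then show "(?h z)\<^sup>2 \<le> 1 / (c0 * r ^ DIM('a))\<^sup>2" for z
    proof (cases "z \<in> ball x r")
      case True
      have "1 / ?m\<^sup>2 \<le> 1 / (c0 * r ^ DIM('a))\<^sup>2"
        using m by (intro frac_le power_mono zero_less_power) auto
      then show ?thesis using True by (simp add: power_divide)
    qed simp
  qed simp
  also have "\<dots> = measure lebesgue \<Omega> / (c0 * r ^ DIM('a))\<^sup>2"
    using sets_dom by (simp add: measure_restrict_space space_restrict_space)
  finally have "L2_inner \<Omega> ?h ?h \<le> measure lebesgue \<Omega> / (c0 * r ^ DIM('a))\<^sup>2" .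
  then have "L2_inner \<Omega> u u * L2_inner \<Omega> ?h ?h \<le> L2_inner \<Omega> u u * (measure lebesgue \<Omega> / (c0 * r ^ DIM('a))\<^sup>2)"
    using L2.nonneg[OF u] by (rule mult_left_mono)
  then show ?thesis
    using L2.cauchy_schwarz[OF u ball_average_L2_inner(2)[OF u, of x r]] unfolding ball_average_L2_inner(1)[OF u] by simp
qed

subsection \<open>Lebesgue points\<close>

lemma box_ball_measure_limit:
  fixes a b z :: 'a
  assumes z: "z \<notin> cbox a b - box a b" and r0: "r0 > 0"
  shows "(\<lambda>k. measure lebesgue (box a b \<inter> ball z (r0 / 2 ^ k)) / measure lebesgue (ball z (r0 / 2 ^ k)))
    \<longlonglongrightarrow> indicator (box a b) z"
proof -
  have "(\<lambda>k. r0 * (1/2) ^ k) \<longlonglongrightarrow> 0" by (intro tendsto_mult_right_zero LIMSEQ_realpow_zero) auto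
  then have r: "(\<lambda>k. r0 / 2 ^ k) \<longlonglongrightarrow> 0" by (simp add: power_divide)
  show ?thesis
  proof (cases "z \<in> box a b")
    case zb: True
    then obtain e where e: "e > 0" "ball z e \<subseteq> box a b" using open_box open_contains_ball by blast
    have "\<forall>\<^sub>F k in sequentially. r0 / 2 ^ k < e" using order_tendstoD(2)[OF r e(1)] .
    then have "\<forall>\<^sub>F k in sequentially. measure lebesgue (box a b \<inter> ball z (r0 / 2 ^ k)) / measure lebesgue (ball z (r0 / 2 ^ k)) = 1"
    proof eventually_elim
      case (elim k)
      then have "box a b \<inter> ball z (r0 / 2 ^ k) = ball z (r0 / 2 ^ k)" using e(2) by fastforce
      moreover have "measure lebesgue (ball z (r0 / 2 ^ k)) > 0" using r0 content_ball_pos[of "r0 / 2 ^ k" z] by simp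
      ultimately show ?case by simp
    qed
    then show ?thesis using zb by (simp add: tendsto_eventually)
  next
    case False
    then have "z \<in> - cbox a b" using z by blast
    then obtain e where e: "e > 0" "ball z e \<subseteq> - cbox a b" using open_contains_ball open_Compl[OF closed_cbox] by metis
    have "\<forall>\<^sub>F k in sequentially. r0 / 2 ^ k < e" using order_tendstoD(2)[OF r e(1)] .
    then have "\<forall>\<^sub>F k in sequentially. measure lebesgue (box a b \<inter> ball z (r0 / 2 ^ k)) / measure lebesgue (ball z (r0 / 2 ^ k)) = 0"
    proof eventually_elim
      case (elim k)
      then have "ball z (r0 / 2 ^ k) \<subseteq> ball z e" by (intro subset_ball) simp
      then have "box a b \<inter> ball z (r0 / 2 ^ k) = {}" using e(2) box_subset_cbox[of a b] by blast
      then show ?case by simp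
    qed
    then show ?thesis using False by (simp add: tendsto_eventually)
  qed
qed

text \<open>Fubini moves the averaging from \<open>u\<close> to the indicator of the box, where
  convergence off the faces of the box is elementary and the averages are bounded by 1.\<close>

lemma average_weak_limit:
  assumes u: "integrable (lebesgue_on \<Omega>) u" and ab: "cbox a b \<subseteq> \<Omega>" and r0: "r0 > 0"
  shows "(\<lambda>k. LINT y|lebesgue_on \<Omega>. indicator (box a b) y * ball_average \<Omega> u y (r0 / 2 ^ k))
    \<longlonglongrightarrow> (LINT y|lebesgue_on \<Omega>. indicator (box a b) y * u y)"
proof -
  obtain w where w: "w \<in> borel_measurable borel" "integrable lborel w" "\<And>x. x \<notin> \<Omega> \<Longrightarrow> w x = (0::real)"
    "AE x in lebesgue_on \<Omega>. u x = w x" by (rule borel_representative[OF u]) blast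
  have [measurable]: "w \<in> borel_measurable borel" by fact
  have boxO: "box a b \<subseteq> \<Omega>" using ab box_subset_cbox by blast
  have "compact (cbox a b)" by simp
  from compact_subset_open_imp_ball_epsilon_subset[OF this open_dom ab]
  \<comment> \<open>For radii below \<open>d\<close> the balls around points of the box lie in
    \<open>\<Omega>\<close>, so the denominators of the averages are plain ball volumes, independent
    of the centre.\<close>
  obtain d where d: "d > 0" "\<And>y. y \<in> cbox a b \<Longrightarrow> ball y d \<subseteq> \<Omega>" by (metis UN_subset_iff)
  have "(\<lambda>k. r0 * (1/2) ^ k) \<longlonglongrightarrow> 0" by (intro tendsto_mult_right_zero LIMSEQ_realpow_zero) auto
  then have r: "(\<lambda>k. r0 / 2 ^ k) \<longlonglongrightarrow> 0" by (simp add: power_divide)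
  have rhs: "(LINT y|lebesgue_on \<Omega>. indicator (box a b) y * u y) = (LINT z|lborel. indicator (box a b) z * w z)"
  proof -
    have "(LINT y|lebesgue_on \<Omega>. indicator (box a b) y * u y) = (LINT y|lebesgue_on (box a b). u y)"
      using sets_dom boxO
      by (simp add: integral_restrict_space) (intro arg_cong[of _ _ "integral\<^sup>L lebesgue"], auto simp: fun_eq_iff split: split_indicator)
    also have "\<dots> = (LINT z|lborel. indicator (box a b) z * w z)"
      by (rule set_integral_representative[OF u w(1,4)]) (use boxO in auto)
    finally show ?thesis .
  qed
  let ?q = "\<lambda>k z. measure lebesgue (box a b \<inter> ball z (r0 / 2 ^ k)) / measure lebesgue (ball z (r0 / 2 ^ k))"
  have q01: "0 \<le> ?q k z" "?q k z \<le> 1" for k z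
  proof -
    have "measure lebesgue (box a b \<inter> ball z (r0 / 2 ^ k)) \<le> measure lebesgue (ball z (r0 / 2 ^ k))"
      by (intro measure_mono_fmeasurable) auto
    then show "0 \<le> ?q k z" "?q k z \<le> 1" by (auto simp: divide_le_eq)
  qed
  have Vr: "measure lebesgue (ball z s) = measure lebesgue (ball (0::'a) s)" if "s \<ge> 0" for z :: 'a and s
    using measure_ball[OF that] by simp
  have fub: "(LINT y|lebesgue_on \<Omega>. indicator (box a b) y * ball_average \<Omega> u y s)
    = (LINT z|lborel. measure lebesgue (box a b \<inter> ball z s) / measure lebesgue (ball z s) * w z)"
    if s: "0 < s" "s < d" for s
  proof -
    let ?V = "measure lebesgue (ball (0::'a) s)"
    let ?f = "\<lambda>y z. indicator (box a b) y * (if dist y z < s then w z else 0)"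
    have av: "indicator (box a b) y * ball_average \<Omega> u y s = (LINT z|lborel. ?f y z) / ?V" for y
    proof (cases "y \<in> box a b")
      case True
      then have "ball y s \<subseteq> \<Omega>" using d(2)[of y] box_subset_cbox[of a b] subset_ball[of s d y] s by fastforce
      then have "\<Omega> \<inter> ball y s = ball y s" by blast
      moreover have "ball_average \<Omega> u y s = (LINT z|lborel. indicator (ball y s) z * w z) / (LINT z|lborel. indicator (\<Omega> \<inter> ball y s) z)"
        by (rule ball_average_representative[OF u w(1) _ w(4)]) (rule w(3))
      moreover have "(\<lambda>z. indicator (ball y s) z * w z) = (\<lambda>z. if dist y z < s then w z else 0)" by (auto simp: fun_eq_iff)
      ultimately show ?thesis using True Vr[of s y] s by simp
    qed simp
    have m: "case_prod ?f \<in> borel_measurable (lborel \<Otimes>\<^sub>M lborel)" by measurable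
    have int: "integrable (lborel \<Otimes>\<^sub>M lborel) (case_prod ?f)"
    proof (rule lborel_pair.Fubini_integrable[OF m])
      have fz: "integrable lborel (\<lambda>z. ?f y z)" for y
        by (rule Bochner_Integration.integrable_bound[OF w(2)]) (auto split: split_indicator)
      show "AE y in lborel. integrable lborel (\<lambda>z. case_prod ?f (y, z))" using fz by simp
      show "integrable lborel (\<lambda>y. LINT z|lborel. norm (case_prod ?f (y, z)))"
      proof (rule Bochner_Integration.integrable_bound[where f = "\<lambda>y. indicator (box a b) y * (LINT z|lborel. \<bar>w z\<bar>)"])
        show "integrable lborel (\<lambda>y. indicator (box a b) y * (LINT z|lborel. \<bar>w z\<bar>))"
          using emeasure_lborel_box_finite[of a b] by (intro integrable_mult_left integrable_real_indicator) auto
        show "(\<lambda>y. LINT z|lborel. norm (case_prod ?f (y, z))) \<in> borel_measurable lborel"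
          by (intro lborel.borel_measurable_lebesgue_integral) measurable
        show "AE y in lborel. norm (LINT z|lborel. norm (case_prod ?f (y, z))) \<le> norm (indicator (box a b) y * (LINT z|lborel. \<bar>w z\<bar>))"
        proof (rule AE_I2)
          fix y
          have "(LINT z|lborel. norm (?f y z)) \<le> (LINT z|lborel. indicator (box a b) y * \<bar>w z\<bar>)"
            using w(2) fz by (intro integral_mono) (auto split: split_indicator)
          moreover have "0 \<le> (LINT z|lborel. norm (?f y z))" by simp
          ultimately show "norm (LINT z|lborel. norm (case_prod ?f (y, z))) \<le> norm (indicator (box a b) y * (LINT z|lborel. \<bar>w z\<bar>))"
            by simp
        qed
      qed
    qed
    have "(LINT y|lebesgue_on \<Omega>. indicator (box a b) y * ball_average \<Omega> u y s) = (LINT y|lborel. indicator (box a b) y * ball_average \<Omega> u y s)"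
      using borel_measurable_ball_average[OF u, of s] boxO sets_dom
      by (intro integral_lebesgue_on_eq_lborel(1)) (auto split: split_indicator)
    also have "\<dots> = (LINT y|lborel. LINT z|lborel. ?f y z) / ?V" unfolding av by simp
    also have "(LINT y|lborel. LINT z|lborel. ?f y z) = (LINT z|lborel. LINT y|lborel. ?f y z)"
      using lborel_pair.Fubini_integral[OF int] by simp
    also have "(\<lambda>z. LINT y|lborel. ?f y z) = (\<lambda>z. measure lebesgue (box a b \<inter> ball z s) * w z)"
    proof
      fix z
      have "(\<lambda>y. ?f y z) = (\<lambda>y. indicator (box a b \<inter> ball z s) y * w z)"
        by (auto simp: fun_eq_iff dist_commute split: split_indicator)
      then show "(LINT y|lborel. ?f y z) = measure lebesgue (box a b \<inter> ball z s) * w z" by simp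
    qed
    also have "(LINT z|lborel. measure lebesgue (box a b \<inter> ball z s) * w z) / ?V
      = (LINT z|lborel. measure lebesgue (box a b \<inter> ball z s) * w z / ?V)" by simp
    also have "(\<lambda>z. measure lebesgue (box a b \<inter> ball z s) * w z / ?V)
      = (\<lambda>z. measure lebesgue (box a b \<inter> ball z s) / measure lebesgue (ball z s) * w z)"
      by (rule ext) (subst Vr, use s in auto)
    finally show ?thesis .
  qed
  have qm: "(\<lambda>z. ?q k z * w z) \<in> borel_measurable lborel" for k
  proof -
    have "(\<lambda>z. LINT y|lborel. indicator (ball z (r0 / 2 ^ k)) y * (indicator (box a b) y :: real)) \<in> borel_measurable borel"
      by (rule borel_measurable_ball_integral) simp
    moreover have "(\<lambda>y. indicator (ball z (r0 / 2 ^ k)) y * (indicator (box a b) y :: real)) = indicator (box a b \<inter> ball z (r0 / 2 ^ k))" for z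
      by (auto simp: fun_eq_iff split: split_indicator)
    ultimately have "(\<lambda>z. measure lebesgue (box a b \<inter> ball z (r0 / 2 ^ k))) \<in> borel_measurable borel" by simp
    moreover have "(\<lambda>z. ?q k z * w z)
      = (\<lambda>z. measure lebesgue (box a b \<inter> ball z (r0 / 2 ^ k)) / measure lebesgue (ball (0::'a) (r0 / 2 ^ k)) * w z)"
      by (rule ext) (subst Vr, use r0 in auto)
    ultimately show ?thesis by simp
  qed
  have "(\<lambda>k. LINT z|lborel. ?q k z * w z) \<longlonglongrightarrow> (LINT z|lborel. indicator (box a b) z * w z)"
  proof (rule integral_dominated_convergence[where w = "\<lambda>z. \<bar>w z\<bar>"])
    have "cbox a b - box a b \<in> null_sets lborel"
      using negligible_frontier_interval[of a b] negligible_iff_null_sets null_sets_completion_iff2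
      by (metis Diff_eq borel_closed borel_open closed_cbox emeasure_completion lborel_eq_real null_setsD1 null_setsI null_sets_completion_iff open_box sets.Diff sets_lborel)
    then have "AE z in lborel. z \<notin> cbox a b - box a b" by (rule AE_not_in)
    then show "AE z in lborel. (\<lambda>k. ?q k z * w z) \<longlonglongrightarrow> indicator (box a b) z * w z"
      by eventually_elim (intro tendsto_mult tendsto_const box_ball_measure_limit r0)
    show "AE z in lborel. norm (?q k z * w z) \<le> \<bar>w z\<bar>" for k
    proof (rule AE_I2)
      fix z show "norm (?q k z * w z) \<le> \<bar>w z\<bar>"
        using mult_right_mono[OF q01(2)[of z k] abs_ge_zero[of "w z"]] q01(1)[of z k]
        unfolding real_norm_def abs_mult by simp
    qed
    show "(\<lambda>z. indicator (box a b) z * w z) \<in> borel_measurable lborel" by measurable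
  qed (use w(2) qm in auto)
  moreover have "\<forall>\<^sub>F k in sequentially. (LINT z|lborel. ?q k z * w z)
    = (LINT y|lebesgue_on \<Omega>. indicator (box a b) y * ball_average \<Omega> u y (r0 / 2 ^ k))"
    using order_tendstoD(2)[OF r d(1)] by eventually_elim (use fub r0 in simp)
  ultimately show ?thesis unfolding rhs by (rule Lim_transform_eventually)
qed

text \<open>Existence of the limit is already known wherever the maximal function is finite; what
  remains is to identify it with \<open>u\<close>. By dominated convergence it has the same
  integrals over boxes as the weak limit of the averages, which is \<open>u\<close>.\<close>

lemma Lebesgue_points:
  assumes u: "u \<in> C12 \<Omega>"
  shows "AE y in lebesgue_on \<Omega>. (ball_average \<Omega> u y \<longlongrightarrow> u y) (at_right 0)"
proof -
  have uL: "u \<in> L2 \<Omega>" using u by (simp add: C12_def)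
  have ui: "integrable (lebesgue_on \<Omega>) u" by (rule L2_integrable[OF bs uL])
  interpret finite_measure "lebesgue_on \<Omega>" using finite_measure_lebesgue_on[OF bs] .
  define A where "A k y = ball_average \<Omega> u y (1 / 2 ^ k)" for k :: nat and y
  define G where "G y = lim (\<lambda>k. A k y)" for y
  have [measurable]: "A k \<in> borel_measurable (lebesgue_on \<Omega>)" for k
    using borel_measurable_ball_average[OF ui] unfolding A_def
    by (intro measurable_restrict_space1 measurable_completion) simp
  have [measurable]: "G \<in> borel_measurable (lebesgue_on \<Omega>)" unfolding G_def by measurable
  have [measurable]: "u \<in> borel_measurable (lebesgue_on \<Omega>)" using L2D(1)[OF uL] .
  have ind[measurable]: "indicator (box a b) \<in> borel_measurable (lebesgue_on \<Omega>)" for a b :: 'a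
    by (intro measurable_restrict_space1 measurable_completion borel_measurable_indicator) auto
  have "(\<lambda>k. 1 * (1/2) ^ k) \<longlonglongrightarrow> (0::real)" by (intro tendsto_mult_right_zero LIMSEQ_realpow_zero) auto
  then have r: "filterlim (\<lambda>k. 1 / 2 ^ k) (at_right (0::real)) sequentially"
    by (auto simp: filterlim_at power_divide)
  have conv: "(ball_average \<Omega> u y \<longlongrightarrow> G y) (at_right 0)" "(\<lambda>k. A k y) \<longlonglongrightarrow> G y"
    if y: "y \<in> \<Omega>" "sharp_maximal \<Omega> u y < top" for y
  proof -
    obtain l where l: "(ball_average \<Omega> u y \<longlongrightarrow> l) (at_right 0)"
      using interior_average_limit(1)[OF uL y, of 1] by auto
    then have "(\<lambda>k. A k y) \<longlonglongrightarrow> l" unfolding A_def using filterlim_compose[OF _ r] by blast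
    then show "(ball_average \<Omega> u y \<longlongrightarrow> G y) (at_right 0)" "(\<lambda>k. A k y) \<longlonglongrightarrow> G y"
      using l limI[of "\<lambda>k. A k y" l] by (simp_all add: G_def)
  qed
  define M where "M = sqrt (L2_inner \<Omega> u u * (measure lebesgue \<Omega> / c0\<^sup>2))"
  \<comment> \<open>The average at radius 1 is bounded by \<open>M\<close>, and all smaller radii
    deviate from it by at most the second summand.\<close>
  define W where "W y = M + 4 * K_sharp * sharp_real u y" for y
  have Wi: "integrable (lebesgue_on \<Omega>) W"
    unfolding W_def using L2_integrable[OF bs C12_sharp(2)[OF u]] by simp
  have dom: "\<bar>A k y\<bar> \<le> W y" if "y \<in> \<Omega>" "sharp_maximal \<Omega> u y < top" for k y
  proof -
    have "(ball_average \<Omega> u y 1)\<^sup>2 \<le> L2_inner \<Omega> u u * (measure lebesgue \<Omega> / c0\<^sup>2)"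
      using ball_average_bound[OF uL, of y 1] that closure_subset by auto
    then have "\<bar>ball_average \<Omega> u y 1\<bar> \<le> M" unfolding M_def by (metis real_sqrt_abs real_sqrt_le_mono)
    moreover have "\<bar>A k y - ball_average \<Omega> u y 1\<bar> \<le> 4 * K_sharp * 1 * sharp_real u y"
      unfolding A_def by (rule interior_average_limit(2)[OF uL that]) auto
    ultimately show ?thesis unfolding W_def by (simp add: abs_le_iff)
  qed
  have yO: "AE y in lebesgue_on \<Omega>. y \<in> \<Omega>" by (rule AE_I2) (simp add: space_restrict_space)
  note fin = C12_sharp(1)[OF u]
  have Gi: "integrable (lebesgue_on \<Omega>) G"
  proof (rule integrable_dominated_convergence[where s = A and w = W])
    show "AE y in lebesgue_on \<Omega>. (\<lambda>k. A k y) \<longlonglongrightarrow> G y"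
      using fin yO by eventually_elim (rule conv(2))
    show "AE y in lebesgue_on \<Omega>. norm (A k y) \<le> W y" for k
      using fin yO by eventually_elim (use dom in simp)
  qed (use Wi in auto)
  have "AE y in lebesgue_on \<Omega>. G y - u y = 0"
  proof (rule AE_zero_if_box_integrals_zero_on[OF open_dom])
    show "integrable (lebesgue_on \<Omega>) (\<lambda>y. G y - u y)" using Gi ui by simp
    fix a b assume ab: "cbox a b \<subseteq> \<Omega>"
    have "(\<lambda>k. LINT y|lebesgue_on \<Omega>. indicator (box a b) y * A k y) \<longlonglongrightarrow> (LINT y|lebesgue_on \<Omega>. indicator (box a b) y * G y)"
    proof (rule integral_dominated_convergence[where w = W])
      show "AE y in lebesgue_on \<Omega>. (\<lambda>k. indicator (box a b) y * A k y) \<longlonglongrightarrow> indicator (box a b) y * G y"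
        using fin yO by eventually_elim (intro tendsto_mult tendsto_const conv(2))
      show "AE y in lebesgue_on \<Omega>. norm (indicator (box a b) y * A k y) \<le> W y" for k
        using fin yO by eventually_elim (use dom[of _ k] in \<open>fastforce split: split_indicator\<close>)
    qed (use Wi in auto)
    moreover have "(\<lambda>k. LINT y|lebesgue_on \<Omega>. indicator (box a b) y * A k y) \<longlonglongrightarrow> (LINT y|lebesgue_on \<Omega>. indicator (box a b) y * u y)"
      unfolding A_def by (rule average_weak_limit[OF ui ab]) simp
    ultimately have eq: "(LINT y|lebesgue_on \<Omega>. indicator (box a b) y * G y) = (LINT y|lebesgue_on \<Omega>. indicator (box a b) y * u y)"
      by (rule LIMSEQ_unique)
    have i: "integrable (lebesgue_on \<Omega>) (\<lambda>y. indicator (box a b) y * h y)" if "integrable (lebesgue_on \<Omega>) h" for h :: "'a \<Rightarrow> real"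
      by (rule Bochner_Integration.integrable_bound[OF that]) (use that in \<open>auto split: split_indicator\<close>)
    show "(LINT y|lebesgue_on \<Omega>. indicator (box a b) y * (G y - u y)) = 0"
      using eq i[OF Gi] i[OF ui] by (simp add: right_diff_distrib)
  qed
  with fin yO show ?thesis
  proof eventually_elim
    case (elim y)
    then show ?case using conv(1)[of y] by simp
  qed
qed

subsection \<open>The compactness estimate\<close>

text \<open>Going from \<open>u y\<close> to its average at radius \<open>r\<close>, and from there
  to the average at a centre \<open>p\<close>, costs \<open>2 * K_sharp * r\<close> each, times the
  maximal function. Squaring the sum gives 16, and splitting the square of a sum doubles it to
  32.\<close>

lemma compactness_estimate:
  assumes u: "u \<in> C12 \<Omega>" and r: "0 < r" "r \<le> 1"
    and P: "finite P" "P \<subseteq> \<Omega>" "\<Omega> \<subseteq> (\<Union>p\<in>P. ball p r)"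
  shows "L2_inner \<Omega> u u \<le> 32 * (K_sharp * r)\<^sup>2 * sharp_energy u
    + (\<Sum>p\<in>P. 2 * measure lebesgue \<Omega> * (ball_average \<Omega> u p r)\<^sup>2)"
proof -
  have uL: "u \<in> L2 \<Omega>" using u by (simp add: C12_def)
  interpret finite_measure "lebesgue_on \<Omega>" using finite_measure_lebesgue_on[OF bs] .
  let ?F = "sharp_real u"
  have yO: "AE y in lebesgue_on \<Omega>. y \<in> \<Omega>" by (rule AE_I2) (simp add: space_restrict_space)
  have "AE y in lebesgue_on \<Omega>. (u y)\<^sup>2 \<le> 32 * (K_sharp * r)\<^sup>2 * (?F y)\<^sup>2 + (\<Sum>p\<in>P. 2 * (ball_average \<Omega> u p r)\<^sup>2)"
    using Lebesgue_points[OF u] C12_sharp(1)[OF u] yO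
  proof eventually_elim
    case (elim y)
    obtain p where p: "p \<in> P" "dist p y < r" using P(3) elim(3) by auto
    have pc: "p \<in> closure \<Omega>" "y \<in> closure \<Omega>" using p P(2) elim(3) closure_subset by blast+
    obtain l where l: "(ball_average \<Omega> u y \<longlongrightarrow> l) (at_right 0)" "\<bar>l - ball_average \<Omega> u y r\<bar> \<le> 2 * K_sharp * r * ?F y"
      using interior_average_limit(1)[OF uL elim(3,2) r] by blast
    have "l = u y" using tendsto_unique[OF _ l(1) elim(1)] by simp
    have "\<bar>ball_average \<Omega> u y r - ball_average \<Omega> u p r\<bar> \<le> K_sharp * (2 * r) * ?F y"
    proof (rule average_diff_sharp_real[OF uL pc(2,1) _ _ _ _ _ _ _ elim(2)])
      show "ball p r \<subseteq> ball y (2 * r)"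
      proof
        fix z assume "z \<in> ball p r"
        then show "z \<in> ball y (2 * r)" using p(2) dist_triangle[of y z p] by (simp add: dist_commute)
      qed
    qed (use r in auto)
    then have "\<bar>u y - ball_average \<Omega> u p r\<bar> \<le> 4 * (K_sharp * r) * ?F y"
      using l(2) \<open>l = u y\<close> by (simp add: algebra_simps)
    then have "\<bar>u y - ball_average \<Omega> u p r\<bar>\<^sup>2 \<le> (4 * (K_sharp * r) * ?F y)\<^sup>2" by (intro power_mono) auto
    then have 1: "(u y - ball_average \<Omega> u p r)\<^sup>2 \<le> 16 * (K_sharp * r)\<^sup>2 * (?F y)\<^sup>2"
      by (simp add: power_mult_distrib)
    have "0 \<le> (u y - 2 * ball_average \<Omega> u p r)\<^sup>2" by simp
    then have "(u y)\<^sup>2 \<le> 2 * (u y - ball_average \<Omega> u p r)\<^sup>2 + 2 * (ball_average \<Omega> u p r)\<^sup>2"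
      by (simp add: power2_eq_square algebra_simps)
    also have "2 * (ball_average \<Omega> u p r)\<^sup>2 \<le> (\<Sum>p\<in>P. 2 * (ball_average \<Omega> u p r)\<^sup>2)"
      by (rule member_le_sum[OF p(1)]) (use P(1) in auto)
    finally show ?case using 1 by linarith
  qed
  then have "(LINT y|lebesgue_on \<Omega>. (u y)\<^sup>2)
    \<le> (LINT y|lebesgue_on \<Omega>. 32 * (K_sharp * r)\<^sup>2 * (?F y)\<^sup>2 + (\<Sum>p\<in>P. 2 * (ball_average \<Omega> u p r)\<^sup>2))"
    using L2D(2)[OF uL] L2D(2)[OF C12_sharp(2)[OF u]] by (intro integral_mono_AE) auto
  also have "\<dots> = 32 * (K_sharp * r)\<^sup>2 * sharp_energy u + measure lebesgue \<Omega> * (\<Sum>p\<in>P. 2 * (ball_average \<Omega> u p r)\<^sup>2)"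
    using L2D(2)[OF C12_sharp(2)[OF u]] C12_sharp(3)[OF u] sets_dom unfolding L2_inner_self
    by (simp add: measure_restrict_space space_restrict_space)
  finally show ?thesis unfolding L2_inner_self by (simp add: sum_distrib_left mult.left_commute mult.assoc)
qed

end

section \<open>The boundary trace\<close>

text \<open>The boundary integral of a function that is not Borel measurable is \<open>0\<close> by convention, so the
  measurability of the trace itself, including the set where the limit exists, has to be shown;
  quantification over rational radii makes this set Borel.\<close>

lemma tendsto_at_right_0_iff_rational_Cauchy:
  fixes a :: "real \<Rightarrow> real"
  assumes left: "\<And>\<rho>. \<rho> > 0 \<Longrightarrow> (a \<longlongrightarrow> a \<rho>) (at_left \<rho>)"
  shows "(\<exists>l. (a \<longlongrightarrow> l) (at_right 0)) \<longleftrightarrow>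
    (\<forall>m::nat. \<exists>k::nat. \<forall>p\<in>\<rat> \<inter> {0<..<1 / real (Suc k)}. \<forall>q\<in>\<rat> \<inter> {0<..<1 / real (Suc k)}. \<bar>a p - a q\<bar> \<le> 1 / real (Suc m))"
    (is "?L \<longleftrightarrow> ?R")
proof
  assume ?L
  then obtain l where l: "(a \<longlongrightarrow> l) (at_right 0)" by blast
  show ?R
  proof
    fix m :: nat
    define e where "e = 1 / (2 * real (Suc m))"
    have e: "e > 0" "2 * e = 1 / real (Suc m)" unfolding e_def by (simp, subst times_divide_eq_right, subst mult_divide_mult_cancel_left, simp_all)
    have "\<forall>\<^sub>F \<rho> in at_right 0. dist (a \<rho>) l < e" using tendstoD[OF l e(1)] .
    then obtain b where b: "b > 0" "\<And>\<rho>. 0 < \<rho> \<Longrightarrow> \<rho> < b \<Longrightarrow> dist (a \<rho>) l < e"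
      unfolding eventually_at_right_field by auto
    obtain k :: nat where k: "1 / real (Suc k) < b" using b(1) nat_approx_posE by blast
    have "\<bar>a p - a q\<bar> \<le> 1 / real (Suc m)" if "p \<in> \<rat> \<inter> {0<..<1 / real (Suc k)}" "q \<in> \<rat> \<inter> {0<..<1 / real (Suc k)}" for p q
    proof -
      have "dist (a p) l < e" "dist (a q) l < e"
        using that k b(2)[of p] b(2)[of q] by auto
      then show ?thesis unfolding dist_real_def e(2)[symmetric] by linarith
    qed
    then show "\<exists>k::nat. \<forall>p\<in>\<rat> \<inter> {0<..<1 / real (Suc k)}. \<forall>q\<in>\<rat> \<inter> {0<..<1 / real (Suc k)}. \<bar>a p - a q\<bar> \<le> 1 / real (Suc m)"
      by blast
  qed
next
  assume R: ?R
  \<comment> \<open>Left continuity is applied from below, so the approximating rational radius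
    stays inside the interval where the Cauchy estimate holds.\<close>
  have near: "\<exists>p\<in>\<rat>. 0 < p \<and> p < \<rho> \<and> \<bar>a p - a \<rho>\<bar> < e" if \<rho>: "\<rho> > 0" and e: "e > 0" for \<rho> e
  proof -
    have "\<forall>\<^sub>F p in at_left \<rho>. dist (a p) (a \<rho>) < e" using tendstoD[OF left[OF \<rho>] e] .
    then obtain b where b: "b < \<rho>" "\<And>p. b < p \<Longrightarrow> p < \<rho> \<Longrightarrow> dist (a p) (a \<rho>) < e"
      unfolding eventually_at_left_field by auto
    obtain p where "p \<in> \<rat>" "max b 0 < p" "p < \<rho>" using Rats_dense_in_real[of "max b 0" \<rho>] b(1) \<rho> by auto
    then show ?thesis using b(2)[of p] by (intro bexI[of _ p]) (auto simp: dist_real_def)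
  qed
  have cau: "\<exists>b>0. \<forall>x. \<forall>y. 0 < x \<and> x < b \<and> 0 < y \<and> y < b \<longrightarrow> dist (a x) (a y) < e" if e: "e > 0" for e
  proof -
    obtain m :: nat where m: "1 / real (Suc m) < e / 3" using nat_approx_posE[of "e / 3"] e by auto
    obtain k :: nat where k: "\<And>p q. p \<in> \<rat> \<Longrightarrow> q \<in> \<rat> \<Longrightarrow> 0 < p \<Longrightarrow> p < 1 / real (Suc k) \<Longrightarrow> 0 < q \<Longrightarrow> q < 1 / real (Suc k)
       \<Longrightarrow> \<bar>a p - a q\<bar> \<le> 1 / real (Suc m)" using R by (metis IntI greaterThanLessThan_iff)
    have "dist (a x) (a y) < e" if xy: "0 < x" "x < 1 / real (Suc k)" "0 < y" "y < 1 / real (Suc k)" for x y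
    proof -
      obtain p where p: "p \<in> \<rat>" "0 < p" "p < x" "\<bar>a p - a x\<bar> < e / 3" using near[OF xy(1), of "e / 3"] e by auto
      obtain q where q: "q \<in> \<rat>" "0 < q" "q < y" "\<bar>a q - a y\<bar> < e / 3" using near[OF xy(3), of "e / 3"] e by auto
      have "\<bar>a p - a q\<bar> \<le> 1 / real (Suc m)" using p q xy by (intro k) auto
      then show ?thesis using p(4) q(4) m unfolding dist_real_def by linarith
    qed
    then show ?thesis by (intro exI[of _ "1 / real (Suc k)"]) auto
  qed
  have "\<forall>e>0. \<exists>P. eventually P (at_right 0) \<and> (\<forall>x y. P x \<and> P y \<longrightarrow> dist (a x) (a y) < e)"
  proof (intro allI impI)
    fix e :: real assume "e > 0"
    from cau[OF this] obtain b where b: "b > 0" "\<And>x y. 0 < x \<Longrightarrow> x < b \<Longrightarrow> 0 < y \<Longrightarrow> y < b \<Longrightarrow> dist (a x) (a y) < e" by blast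
    have "eventually (\<lambda>x. 0 < x \<and> x < b) (at_right (0::real))"
      unfolding eventually_at_right_field using b(1) by blast
    then show "\<exists>P. eventually P (at_right 0) \<and> (\<forall>x y. P x \<and> P y \<longrightarrow> dist (a x) (a y) < e)"
      using b(2) by blast
  qed
  then have "cauchy_filter (filtermap a (at_right 0))"
    by (subst cauchy_filter_metric_filtermap)
  then show ?L
    using cauchy_filter_complete_converges[of "filtermap a (at_right 0)" UNIV] complete_UNIV
    by (auto simp: filterlim_def filtermap_bot_iff)
qed

text \<open>Here \<open>dim\<close> is the condition (n - d)/2 < 1, and \<open>ball_measure\<close>
  is the upper bound that the L-condition and the normalization give together. The last two
  assumptions express that the frontier is the support of \<open>\<mu>\<close>.\<close>

locale traced_domain = n_set_domain \<Omega> c0 for \<Omega> :: "'a::euclidean_space set" and c0 +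
  fixes \<mu> :: "'a measure" and d Cm :: real
  assumes sets_mu: "sets \<mu> = sets borel"
    and dim: "d > real DIM('a) - 2" "d \<ge> 0"
    and Cm: "Cm \<ge> 0"
    and ball_measure: "x \<in> frontier \<Omega> \<Longrightarrow> 0 < r \<Longrightarrow> r \<le> 1 \<Longrightarrow> emeasure \<mu> (ball x r) \<le> ennreal (Cm * r powr d)"
    and null_outside: "emeasure \<mu> (- frontier \<Omega>) = 0"
    and ball_measure_pos: "x \<in> frontier \<Omega> \<Longrightarrow> 0 < r \<Longrightarrow> 0 < emeasure \<mu> (ball x r)"
begin

abbreviation \<nu> :: "'a measure" where "\<nu> \<equiv> restrict_space \<mu> (frontier \<Omega>)"

lemma space_mu: "space \<mu> = UNIV"
  using sets_eq_imp_space_eq[OF sets_mu] by simp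

lemma frontier_sets: "frontier \<Omega> \<in> sets \<mu>"
  using sets_mu by simp

lemma frontier_in_closure: "x \<in> frontier \<Omega> \<Longrightarrow> x \<in> closure \<Omega>"
  by (simp add: frontier_def)

lemma emeasure_nu: "A \<in> sets borel \<Longrightarrow> emeasure \<nu> (frontier \<Omega> \<inter> A) = emeasure \<mu> (frontier \<Omega> \<inter> A)"
  using frontier_sets by (subst emeasure_restrict_space) auto

lemma space_nu: "space \<nu> = frontier \<Omega>"
  using space_mu by (simp add: space_restrict_space)

lemma borel_measurable_nu: "f \<in> borel_measurable borel \<Longrightarrow> f \<in> borel_measurable \<nu>"
  using sets_mu measurable_cong_sets[OF sets_mu refl] by (intro measurable_restrict_space1) blast

lemma finite_measure_nu: "finite_measure \<nu>"
proof
  have "compact (frontier \<Omega>)" using bounded_dom by (simp add: compact_frontier_bounded)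
  then obtain P where P: "finite P" "P \<subseteq> frontier \<Omega>" "frontier \<Omega> \<subseteq> (\<Union>p\<in>P. ball p 1)"
    using compactE_image[of "frontier \<Omega>" "frontier \<Omega>" "\<lambda>p. ball p 1"] by force
  have "emeasure \<mu> (frontier \<Omega>) \<le> emeasure \<mu> (\<Union>p\<in>P. ball p 1)"
    using P sets_mu by (intro emeasure_mono) auto
  also have "\<dots> \<le> (\<Sum>p\<in>P. emeasure \<mu> (ball p 1))"
    using P sets_mu by (intro emeasure_subadditive_finite) auto
  also have "\<dots> \<le> (\<Sum>p\<in>P. ennreal Cm)"
    using P ball_measure[of _ 1] by (intro sum_mono) auto
  also have "\<dots> < \<infinity>" by (simp add: ennreal_mult_less_top of_nat_less_top)
  finally show "emeasure \<nu> (space \<nu>) \<noteq> \<infinity>"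
    using emeasure_nu[of UNIV] by (simp add: space_nu)
qed

sublocale nu: finite_measure \<nu> by (rule finite_measure_nu)

text \<open>The centre need not lie on the frontier; moving it to a frontier point of the ball
  doubles the radius, whence the bound 1/2 on \<open>r\<close>.\<close>

lemma nu_ball: "0 < r \<Longrightarrow> r \<le> 1 / 2 \<Longrightarrow> emeasure \<nu> (frontier \<Omega> \<inter> ball y r) \<le> ennreal (Cm * (2 * r) powr d)"
proof (cases "frontier \<Omega> \<inter> ball y r = {}")
  case False
  assume r: "0 < r" "r \<le> 1 / 2"
  obtain x where x: "x \<in> frontier \<Omega>" "dist y x < r" using False by auto
  have "frontier \<Omega> \<inter> ball y r \<subseteq> ball x (2 * r)"
  proof
    fix z assume "z \<in> frontier \<Omega> \<inter> ball y r"
    then show "z \<in> ball x (2 * r)" using x(2) dist_triangle[of x z y] by (simp add: dist_commute)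
  qed
  then have "emeasure \<mu> (frontier \<Omega> \<inter> ball y r) \<le> emeasure \<mu> (ball x (2 * r))"
    using sets_mu by (intro emeasure_mono) auto
  also have "\<dots> \<le> ennreal (Cm * (2 * r) powr d)" using x r by (intro ball_measure) auto
  finally show ?thesis using emeasure_nu[of "ball y r"] by simp
qed simp

definition local_energy :: "('a \<Rightarrow> real) \<Rightarrow> 'a \<Rightarrow> real \<Rightarrow> ennreal" where
  "local_energy u x r = (\<integral>\<^sup>+ y. (sharp_maximal \<Omega> u y)\<^sup>2 * indicator (ball x r) y \<partial>lebesgue_on \<Omega>)"

text \<open>Fubini: integrating over the boundary point \<open>x\<close> first replaces the
  indicator of the ball by its boundary measure, which \<open>nu_ball\<close> bounds
  uniformly.\<close>

lemma local_energy_integral: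
  assumes u: "u \<in> C12 \<Omega>" and r: "0 < r" "r \<le> 1 / 2"
  shows "(\<integral>\<^sup>+ x. local_energy u x r \<partial>\<nu>) \<le> ennreal (Cm * (2 * r) powr d * sharp_energy u)"
    and "(\<lambda>x. local_energy u x r) \<in> borel_measurable borel"
proof -
  let ?F = "\<lambda>y. (sharp_maximal \<Omega> u y)\<^sup>2"
  have Fm: "?F \<in> borel_measurable (lebesgue_on \<Omega>)" using u by (auto simp: C12_def)
  have "(\<lambda>y. ?F y * indicator \<Omega> y) \<in> borel_measurable lebesgue"
    using Fm sets_dom borel_measurable_restrict_space_iff_ennreal[of \<Omega> lebesgue ?F] by simp
  then obtain h where h: "h \<in> borel_measurable lborel" "AE y in lborel. ?F y * indicator \<Omega> y = h y"
    using completion_ex_borel_measurable by blast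
  have [measurable]: "h \<in> borel_measurable borel" using h(1) by simp
  have conv: "(\<integral>\<^sup>+ y. ?F y * g y \<partial>lebesgue_on \<Omega>) = (\<integral>\<^sup>+ y. h y * g y \<partial>lborel)" for g :: "'a \<Rightarrow> ennreal"
  proof -
    have "(\<integral>\<^sup>+ y. ?F y * g y \<partial>lebesgue_on \<Omega>) = (\<integral>\<^sup>+ y. ?F y * g y * indicator \<Omega> y \<partial>lebesgue)"
      using sets_dom by (simp add: nn_integral_restrict_space)
    also have "\<dots> = (\<integral>\<^sup>+ y. h y * g y \<partial>lebesgue)"
      by (rule nn_integral_cong_AE) (use AE_completion[OF h(2)] in eventually_elim, simp add: mult_ac)
    finally show ?thesis by (simp add: nn_integral_completion)
  qed
  have eq: "local_energy u x r = (\<integral>\<^sup>+ y. h y * (if dist x y < r then 1 else 0) \<partial>lborel)" for x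
    unfolding local_energy_def conv by (intro nn_integral_cong) (auto split: split_indicator)
  have m: "(\<lambda>(x, y). h y * (if dist x y < r then 1 else 0)) \<in> borel_measurable (borel \<Otimes>\<^sub>M lborel)" by measurable
  show "(\<lambda>x. local_energy u x r) \<in> borel_measurable borel"
    unfolding eq using lborel.borel_measurable_nn_integral[OF m] by simp
  interpret P: pair_sigma_finite \<nu> "lborel :: 'a measure" ..
  have "(\<lambda>(x, y). h y * (if dist x y < r then 1 else 0)) \<in> borel_measurable (\<nu> \<Otimes>\<^sub>M lborel)"
  proof (rule measurable_compose[OF _ m, where f = "\<lambda>p. p", simplified])
    have "id \<in> \<nu> \<rightarrow>\<^sub>M borel" using borel_measurable_nu[of id] by simp
    then show "(\<lambda>p. p) \<in> \<nu> \<Otimes>\<^sub>M lborel \<rightarrow>\<^sub>M borel \<Otimes>\<^sub>M lborel"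
      by (auto intro!: measurable_pair simp: o_def id_def intro: measurable_compose[OF measurable_fst])
  qed
  then have "(\<integral>\<^sup>+ x. local_energy u x r \<partial>\<nu>) = (\<integral>\<^sup>+ y. \<integral>\<^sup>+ x. h y * (if dist x y < r then 1 else 0) \<partial>\<nu> \<partial>lborel)"
    unfolding eq by (rule P.Fubini'[symmetric])
  also have "\<dots> \<le> (\<integral>\<^sup>+ y. h y * ennreal (Cm * (2 * r) powr d) \<partial>lborel)"
  proof (rule nn_integral_mono)
    fix y
    have "(\<integral>\<^sup>+ x. h y * (if dist x y < r then 1 else 0) \<partial>\<nu>) = (\<integral>\<^sup>+ x. h y * indicator (frontier \<Omega> \<inter> ball y r) x \<partial>\<nu>)"
      by (intro nn_integral_cong) (auto simp: space_nu dist_commute split: split_indicator)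
    also have "\<dots> = h y * emeasure \<nu> (frontier \<Omega> \<inter> ball y r)"
    proof (rule nn_integral_cmult_indicator)
      show "frontier \<Omega> \<inter> ball y r \<in> sets \<nu>"
        using sets_mu by (auto simp: sets_restrict_space intro!: image_eqI[of _ _ "ball y r"])
    qed
    also have "\<dots> \<le> h y * ennreal (Cm * (2 * r) powr d)" using nu_ball[OF r] by (intro mult_left_mono) auto
    finally show "(\<integral>\<^sup>+ x. h y * (if dist x y < r then 1 else 0) \<partial>\<nu>) \<le> h y * ennreal (Cm * (2 * r) powr d)" .
  qed
  also have "\<dots> = (\<integral>\<^sup>+ y. h y \<partial>lborel) * ennreal (Cm * (2 * r) powr d)" by (rule nn_integral_multc) (rule h(1))
  also have "(\<integral>\<^sup>+ y. h y \<partial>lborel) = ennreal (sharp_energy u)"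
    using conv[of "\<lambda>y. 1"] C12_sharp(4)[OF u] by simp
  also have "ennreal (sharp_energy u) * ennreal (Cm * (2 * r) powr d) = ennreal (Cm * (2 * r) powr d * sharp_energy u)"
    using Cm by (simp add: ennreal_mult[symmetric] sharp_energy_def mult.commute)
  finally show "(\<integral>\<^sup>+ x. local_energy u x r \<partial>\<nu>) \<le> ennreal (Cm * (2 * r) powr d * sharp_energy u)" .
qed

text \<open>At a boundary point the maximal function gives no control, but each \<open>y\<close> in
  the ball may serve as base point with \<open>R = 2 * r\<close>. Integrating the squared bound over
  these \<open>y\<close> produces the local energy on one side and at least
  \<open>c0 * r ^ DIM('a)\<close> on the other.\<close>

lemma average_diff_local_energy:
  assumes u: "u \<in> C12 \<Omega>" and x: "x \<in> closure \<Omega>" and r: "0 < r" "r \<le> 1 / 2" and \<rho>: "r / 2 \<le> \<rho>" "\<rho> \<le> r"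
  shows "ennreal ((ball_average \<Omega> u x r - ball_average \<Omega> u x \<rho>)\<^sup>2 * (c0 * r ^ DIM('a)))
    \<le> ennreal ((K_sharp * (2 * r))\<^sup>2) * local_energy u x r"
proof -
  have uL: "u \<in> L2 \<Omega>" using u by (simp add: C12_def)
  let ?D = "\<bar>ball_average \<Omega> u x r - ball_average \<Omega> u x \<rho>\<bar>"
  have Fm[measurable]: "(\<lambda>y. (sharp_maximal \<Omega> u y)\<^sup>2) \<in> borel_measurable (lebesgue_on \<Omega>)" using u by (auto simp: C12_def)
  have im[measurable]: "indicator (ball x r) \<in> borel_measurable (lebesgue_on \<Omega>)"
    by (intro measurable_restrict_space1 measurable_completion borel_measurable_indicator) auto
  have pt: "ennreal (?D\<^sup>2) \<le> ennreal ((K_sharp * (2 * r))\<^sup>2) * (sharp_maximal \<Omega> u y)\<^sup>2" if y: "y \<in> ball x r" for y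
  proof -
    have b: "ball x r \<subseteq> ball y (2 * r)"
    proof
      fix z assume "z \<in> ball x r"
      then show "z \<in> ball y (2 * r)" using y dist_triangle[of y z x] by (simp add: dist_commute)
    qed
    have "ennreal ?D \<le> ennreal (K_sharp * (2 * r)) * sharp_maximal \<Omega> u y"
    proof (rule average_diff_sharp[OF uL x x])
      show "ball x \<rho> \<subseteq> ball y (2 * r)" using b subset_ball[OF \<rho>(2), of x] by blast
    qed (use r \<rho> b in auto)
    then have "(ennreal ?D)\<^sup>2 \<le> (ennreal (K_sharp * (2 * r)) * sharp_maximal \<Omega> u y)\<^sup>2" by (rule power_mono) simp
    then show ?thesis using K_sharp_pos r by (simp add: power_mult_distrib ennreal_power)
  qed
  have "c0 * r ^ DIM('a) \<le> measure lebesgue (\<Omega> \<inter> ball x r)" using density[OF x r(1)] r by simp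
  then have "ennreal (?D\<^sup>2 * (c0 * r ^ DIM('a))) \<le> ennreal (?D\<^sup>2 * measure lebesgue (\<Omega> \<inter> ball x r))"
    by (intro ennreal_leI mult_left_mono) auto
  also have "\<dots> = ennreal (?D\<^sup>2) * emeasure lebesgue (\<Omega> \<inter> ball x r)"
  proof -
    have "\<Omega> \<inter> ball x r \<in> lmeasurable" using sets_dom bounded_dom by (intro bounded_set_imp_lmeasurable) auto
    then show ?thesis by (simp add: ennreal_mult emeasure_eq_measure2)
  qed
  also have "emeasure lebesgue (\<Omega> \<inter> ball x r) = (\<integral>\<^sup>+ y. indicator (ball x r) y \<partial>lebesgue_on \<Omega>)"
  proof -
    have "(\<integral>\<^sup>+ y. indicator (ball x r) y \<partial>lebesgue_on \<Omega>) = (\<integral>\<^sup>+ y. indicator (\<Omega> \<inter> ball x r) y \<partial>lebesgue)"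
      using sets_dom by (simp add: nn_integral_restrict_space indicator_inter_arith[symmetric] mult.commute Int_commute)
    also have "\<dots> = emeasure lebesgue (\<Omega> \<inter> ball x r)" using sets_dom by (intro nn_integral_indicator) auto
    finally show ?thesis by simp
  qed
  also have "ennreal (?D\<^sup>2) * \<dots> = (\<integral>\<^sup>+ y. ennreal (?D\<^sup>2) * indicator (ball x r) y \<partial>lebesgue_on \<Omega>)"
    using im by (intro nn_integral_cmult[symmetric]) auto
  also have "\<dots> \<le> (\<integral>\<^sup>+ y. ennreal ((K_sharp * (2 * r))\<^sup>2) * ((sharp_maximal \<Omega> u y)\<^sup>2 * indicator (ball x r) y) \<partial>lebesgue_on \<Omega>)"
    using pt by (intro nn_integral_mono) (auto split: split_indicator)
  also have "\<dots> = ennreal ((K_sharp * (2 * r))\<^sup>2) * local_energy u x r"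
    unfolding local_energy_def by (intro nn_integral_cmult) measurable
  finally show ?thesis by simp
qed

end

lemma pred_ball_countable:
  assumes "countable I" "\<And>i. i \<in> I \<Longrightarrow> Measurable.pred M (P i)"
  shows "Measurable.pred M (\<lambda>x. \<forall>i\<in>I. P i x)"
proof (cases "I = {}")
  case False
  have "Measurable.pred M (\<lambda>x. \<forall>n::nat. P (from_nat_into I n) x)"
    by (intro pred_intros_countable assms(2) from_nat_into False)
  moreover have "(\<forall>n::nat. P (from_nat_into I n) x) \<longleftrightarrow> (\<forall>i\<in>I. P i x)" for x
    using range_from_nat_into[OF False assms(1)] by (metis rangeE rangeI)
  ultimately show ?thesis by simp
qed simp

section \<open>Summation of the increments over dyadic radii at the boundary\<close>

context traced_domain
begin

text \<open>The exponent of the radius in the boundary integral of the squared increments: 2 from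
  the estimate, minus the dimension from averaging, plus \<open>d\<close> from the measure.\<close>

definition gam :: real where "gam = 2 - real DIM('a) + d"

text \<open>The decay factor per halving of the radius that remains when half of the exponent
  \<open>gam\<close> has been spent on \<open>weight\<close>.\<close>

definition qg :: real where "qg = (1 / 2) powr (gam / 2)"

lemma qg: "0 < qg" "qg < 1" and gam_pos: "gam > 0"
proof -
  show "gam > 0" using dim by (simp add: gam_def)
  then show "0 < qg" "qg < 1" by (auto simp: qg_def powr_def mult_pos_neg)
qed

text \<open>The radii start at 1/2, the largest one that \<open>nu_ball\<close> admits.\<close>

definition rad :: "nat \<Rightarrow> real" where "rad k = (1 / 2) / 2 ^ k"

lemma rad: "0 < rad k" "rad k \<le> 1 / 2"
  by (auto simp: rad_def divide_le_eq)

lemma rad_powr: "rad k powr (gam / 2) = qg * qg ^ k"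
proof -
  have "rad k = (1 / 2) powr real (Suc k)" by (subst powr_realpow) (auto simp: rad_def power_divide)
  then have "rad k powr (gam / 2) = (1 / 2) powr (gam / 2 * real (Suc k))" by (simp add: powr_powr mult.commute)
  also have "\<dots> = qg powr real (Suc k)" by (simp add: qg_def powr_powr)
  also have "\<dots> = qg ^ Suc k" using qg(1) by (rule powr_realpow)
  finally show ?thesis by simp
qed

text \<open>The exponent lies strictly between \<open>-d\<close>, which is needed for integrability of the sum over the
  boundary, and \<open>2 - n\<close>, which is needed for geometric decay of the increments of the averages.\<close>

definition weight :: "nat \<Rightarrow> real" where "weight k = rad k powr (2 - real DIM('a) - gam / 2)"

lemma weight_pos: "weight k > 0"
  using rad[of k] by (simp add: weight_def)

text \<open>A single majorant for all scales: finiteness at \<open>x\<close> bounds every weighted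
  local energy there, and the weights grow fast enough for the increments of the averages to decay
  geometrically.\<close>

definition trace_sum :: "('a \<Rightarrow> real) \<Rightarrow> 'a \<Rightarrow> ennreal" where
  "trace_sum u x = (\<Sum>k. ennreal (weight k) * local_energy u x (rad k))"

lemma trace_sum_integral:
  assumes u: "u \<in> C12 \<Omega>"
  shows "(\<integral>\<^sup>+ x. trace_sum u x \<partial>\<nu>) \<le> ennreal (Cm * 2 powr d * (qg / (1 - qg)) * sharp_energy u)"
    and "trace_sum u \<in> borel_measurable \<nu>"
proof -
  have E: "sharp_energy u \<ge> 0" by (simp add: sharp_energy_def)
  have m[measurable]: "(\<lambda>x. local_energy u x (rad k)) \<in> borel_measurable \<nu>" for k
    by (rule borel_measurable_nu[OF local_energy_integral(2)[OF u rad]])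
  show "trace_sum u \<in> borel_measurable \<nu>" unfolding trace_sum_def by measurable
  have "(\<integral>\<^sup>+ x. trace_sum u x \<partial>\<nu>) = (\<Sum>k. \<integral>\<^sup>+ x. ennreal (weight k) * local_energy u x (rad k) \<partial>\<nu>)"
    unfolding trace_sum_def by (rule nn_integral_suminf) measurable
  also have "\<dots> = (\<Sum>k. ennreal (weight k) * (\<integral>\<^sup>+ x. local_energy u x (rad k) \<partial>\<nu>))"
    by (intro suminf_cong nn_integral_cmult) measurable
  also have "\<dots> \<le> (\<Sum>k. ennreal (weight k) * ennreal (Cm * (2 * rad k) powr d * sharp_energy u))"
    by (intro suminf_le mult_left_mono local_energy_integral(1)[OF u rad]) auto
  also have "\<dots> = (\<Sum>k. ennreal (Cm * 2 powr d * sharp_energy u * qg * qg ^ k))"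
  proof (rule suminf_cong)
    fix k
    \<comment> \<open>The exponents add up to \<open>gam - gam / 2\<close>, so the series is
      geometric with ratio \<open>qg\<close>.\<close>
    have "weight k * rad k powr d = rad k powr (gam / 2)"
      unfolding weight_def powr_add[symmetric] by (simp add: gam_def field_simps)
    then have eq: "weight k * (Cm * (2 * rad k) powr d * sharp_energy u) = Cm * 2 powr d * sharp_energy u * qg * qg ^ k"
      using rad[of k] by (simp add: powr_mult rad_powr algebra_simps)
    show "ennreal (weight k) * ennreal (Cm * (2 * rad k) powr d * sharp_energy u) = ennreal (Cm * 2 powr d * sharp_energy u * qg * qg ^ k)"
      unfolding eq[symmetric] using weight_pos[of k] Cm E by (intro ennreal_mult[symmetric]) auto
  qed
  also have "\<dots> = ennreal (\<Sum>k. Cm * 2 powr d * sharp_energy u * qg * qg ^ k)"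
    using Cm E qg by (intro suminf_ennreal2) (auto intro!: summable_mult summable_geometric)
  also have "(\<Sum>k. Cm * 2 powr d * sharp_energy u * qg * qg ^ k) = Cm * 2 powr d * sharp_energy u * qg * (1 / (1 - qg))"
    using qg by (subst suminf_mult) (auto intro!: summable_geometric simp: suminf_geometric)
  finally show "(\<integral>\<^sup>+ x. trace_sum u x \<partial>\<nu>) \<le> ennreal (Cm * 2 powr d * (qg / (1 - qg)) * sharp_energy u)"
    by (simp add: mult_ac)
qed

text \<open>From the square of \<open>K_sharp * (2 * r)\<close> divided by the density constant; the
  factor \<open>qg\<close> accounts for \<open>rad 0 = 1 / 2\<close>.\<close>

definition C_incr :: real where "C_incr = 4 * K_sharp\<^sup>2 / c0 * qg"

text \<open>Each local energy is bounded by the whole sum divided by its weight, which turns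
  \<open>average_diff_local_energy\<close> into the hypothesis of
  \<open>dyadic_limit\<close>.\<close>

lemma trace_limit:
  assumes u: "u \<in> C12 \<Omega>" and x: "x \<in> closure \<Omega>" and fin: "trace_sum u x < top"
  shows "\<exists>l. (ball_average \<Omega> u x \<longlongrightarrow> l) (at_right 0) \<and>
    (l - ball_average \<Omega> u x (1 / 2))\<^sup>2 \<le> C_incr / (1 - sqrt qg)\<^sup>2 * enn2real (trace_sum u x)"
proof -
  define s where "s = enn2real (trace_sum u x)"
  have s: "s \<ge> 0" "trace_sum u x = ennreal s" using fin by (auto simp: s_def)
  have C: "C_incr \<ge> 0" using c0 qg by (simp add: C_incr_def)
  have "\<exists>l. (ball_average \<Omega> u x \<longlongrightarrow> l) (at_right 0) \<and> (l - ball_average \<Omega> u x (1 / 2))\<^sup>2 \<le> C_incr * s / (1 - sqrt qg)\<^sup>2"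
  proof (rule dyadic_limit(1))
    fix k :: nat and \<rho> :: real assume \<rho>: "1 / 2 / 2 ^ Suc k \<le> \<rho>" "\<rho> \<le> 1 / 2 / 2 ^ k"
    let ?r = "rad k" and ?D = "(ball_average \<Omega> u x (rad k) - ball_average \<Omega> u x \<rho>)\<^sup>2"
    have "ennreal (weight k) * local_energy u x ?r \<le> trace_sum u x"
      unfolding trace_sum_def using sum_le_suminf[of "\<lambda>k. ennreal (weight k) * local_energy u x (rad k)" "{k}"] by simp
    then have le: "ennreal (weight k) * local_energy u x ?r \<le> ennreal s" using s by simp
    have "ennreal (weight k * (?D * (c0 * ?r ^ DIM('a)))) = ennreal (weight k) * ennreal (?D * (c0 * ?r ^ DIM('a)))"
      using weight_pos[of k] c0 rad[of k] by (simp add: ennreal_mult)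
    also have "\<dots> \<le> ennreal (weight k) * (ennreal ((K_sharp * (2 * ?r))\<^sup>2) * local_energy u x ?r)"
      using \<rho> by (intro mult_left_mono average_diff_local_energy[OF u x rad]) (auto simp: rad_def)
    also have "\<dots> = ennreal ((K_sharp * (2 * ?r))\<^sup>2) * (ennreal (weight k) * local_energy u x ?r)" by (simp add: mult_ac)
    also have "\<dots> \<le> ennreal ((K_sharp * (2 * ?r))\<^sup>2) * ennreal s" using le by (rule mult_left_mono) simp
    also have "\<dots> = ennreal ((K_sharp * (2 * ?r))\<^sup>2 * s)" using s by (simp add: ennreal_mult)
    finally have 1: "weight k * (?D * (c0 * ?r ^ DIM('a))) \<le> (K_sharp * (2 * ?r))\<^sup>2 * s"
      using s by (subst (asm) ennreal_le_iff) auto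
    \<comment> \<open>The factor \<open>?r\<close> squared of the estimate, divided by weight and
      ball volume, is exactly the geometric term.\<close>
    have p: "weight k * ?r ^ DIM('a) * (qg * qg ^ k) = ?r\<^sup>2"
    proof -
      have "weight k * ?r ^ DIM('a) * (qg * qg ^ k) = ?r powr (2 - real DIM('a) - gam / 2) * ?r powr real DIM('a) * ?r powr (gam / 2)"
        using rad[of k] by (simp add: weight_def rad_powr powr_realpow)
      also have "\<dots> = ?r powr 2" unfolding powr_add[symmetric] by simp
      also have "\<dots> = ?r\<^sup>2" using rad[of k] by simp
      finally show ?thesis .
    qed
    have w: "weight k * ?r ^ DIM('a) > 0" using weight_pos[of k] rad[of k] by simp
    have "weight k * ?r ^ DIM('a) * (?D * c0) \<le> 4 * K_sharp\<^sup>2 * s * ?r\<^sup>2"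
      using 1 by (simp add: power_mult_distrib mult_ac)
    also have "\<dots> = weight k * ?r ^ DIM('a) * (4 * K_sharp\<^sup>2 * s * (qg * qg ^ k))"
      unfolding p[symmetric] by (simp add: mult_ac)
    finally have "?D * c0 \<le> 4 * K_sharp\<^sup>2 * s * (qg * qg ^ k)"
      using w by (rule mult_left_le_imp_le)
    then have "?D \<le> 4 * K_sharp\<^sup>2 * s * (qg * qg ^ k) / c0" using c0 by (simp add: pos_le_divide_eq)
    also have "\<dots> = C_incr * s * qg ^ k" by (simp add: C_incr_def)
    finally show "(ball_average \<Omega> u x (1 / 2 / 2 ^ k) - ball_average \<Omega> u x \<rho>)\<^sup>2 \<le> C_incr * s * qg ^ k"
      by (simp add: rad_def)
  qed (use qg C s in auto)
  then show ?thesis by (simp add: s_def)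
qed

lemma boundary_trace_eq:
  "(ball_average \<Omega> u x \<longlongrightarrow> l) (at_right 0) \<Longrightarrow> boundary_trace \<Omega> u x = l"
  unfolding boundary_trace_def using tendsto_Lim[of "at_right 0" "ball_average \<Omega> u x" l] by auto

lemma trace_AE_limit:
  assumes u: "u \<in> C12 \<Omega>"
  shows "AE x in \<nu>. (ball_average \<Omega> u x \<longlongrightarrow> boundary_trace \<Omega> u x) (at_right 0) \<and>
    (boundary_trace \<Omega> u x)\<^sup>2 \<le> 2 * (ball_average \<Omega> u x (1 / 2))\<^sup>2
       + 2 * (C_incr / (1 - sqrt qg)\<^sup>2) * enn2real (trace_sum u x) \<and> trace_sum u x < top"
proof -
  have "(\<integral>\<^sup>+ x. trace_sum u x \<partial>\<nu>) \<noteq> \<infinity>"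
    using trace_sum_integral(1)[OF u] by (auto simp: top_unique)
  then have "AE x in \<nu>. trace_sum u x \<noteq> \<infinity>"
    by (rule nn_integral_PInf_AE[OF trace_sum_integral(2)[OF u]])
  moreover have "AE x in \<nu>. x \<in> frontier \<Omega>" by (rule AE_I2) (simp add: space_nu)
  ultimately show ?thesis
  proof eventually_elim
    case (elim x)
    then have fin: "trace_sum u x < top" by (simp add: less_top)
    obtain l where l: "(ball_average \<Omega> u x \<longlongrightarrow> l) (at_right 0)"
      "(l - ball_average \<Omega> u x (1 / 2))\<^sup>2 \<le> C_incr / (1 - sqrt qg)\<^sup>2 * enn2real (trace_sum u x)"
      using trace_limit[OF u frontier_in_closure[OF elim(2)] fin] by blast
    have "0 \<le> (l - 2 * ball_average \<Omega> u x (1 / 2))\<^sup>2" by simp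
    then have "l\<^sup>2 \<le> 2 * (l - ball_average \<Omega> u x (1 / 2))\<^sup>2 + 2 * (ball_average \<Omega> u x (1 / 2))\<^sup>2"
      by (simp add: power2_eq_square algebra_simps)
    then show ?case using l fin boundary_trace_eq[OF l(1)] by (auto simp: algebra_simps)
  qed
qed

text \<open>The set where the limit exists is described by rational radii, and on it the trace is a
  limit along the radii \<open>1 / 2 ^ k\<close>. The description is valid on the closure of
  \<open>\<Omega>\<close>, where the averages are left continuous; this covers all points of
  \<nu>.\<close>

lemma boundary_trace_measurable:
  assumes u: "u \<in> L2 \<Omega>"
  shows "boundary_trace \<Omega> u \<in> borel_measurable \<nu>"
proof -
  have ui: "integrable (lebesgue_on \<Omega>) u" by (rule L2_integrable[OF bs u])
  let ?A = "\<lambda>x. ball_average \<Omega> u x"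
  let ?R = "\<lambda>x. \<forall>m::nat. \<exists>k::nat. \<forall>p\<in>\<rat> \<inter> {0<..<1 / real (Suc k)}. \<forall>q\<in>\<rat> \<inter> {0<..<1 / real (Suc k)}. \<bar>?A x p - ?A x q\<bar> \<le> 1 / real (Suc m)"
  have Am[measurable]: "(\<lambda>x. ?A x r) \<in> borel_measurable borel" for r
    by (rule borel_measurable_ball_average[OF ui])
  have co: "countable (\<rat> \<inter> {0<..<1 / real (Suc k)})" for k :: nat
    using countable_rat by (rule countable_Int1)
  have [measurable]: "Measurable.pred borel (\<lambda>x. \<forall>p\<in>\<rat> \<inter> {0<..<1 / real (Suc k)}. \<forall>q\<in>\<rat> \<inter> {0<..<1 / real (Suc k)}. \<bar>?A x p - ?A x q\<bar> \<le> 1 / real (Suc m))" for k m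
    by (rule pred_ball_countable[OF co], rule pred_ball_countable[OF co]) measurable
  have [measurable]: "Measurable.pred borel ?R" by measurable
  have "(\<lambda>x. if ?R x then lim (\<lambda>k. ?A x (1 / 2 ^ k)) else 0) \<in> borel_measurable borel"
    by measurable
  then have "(\<lambda>x. if ?R x then lim (\<lambda>k. ?A x (1 / 2 ^ k)) else 0) \<in> borel_measurable \<nu>"
    by (rule borel_measurable_nu)
  moreover have "(if ?R x then lim (\<lambda>k. ?A x (1 / 2 ^ k)) else 0) = boundary_trace \<Omega> u x" if x: "x \<in> space \<nu>" for x
  proof -
    have xc: "x \<in> closure \<Omega>" using x frontier_in_closure by (simp add: space_nu)
    have iff: "(\<exists>l. (?A x \<longlongrightarrow> l) (at_right 0)) \<longleftrightarrow> ?R x"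
      by (rule tendsto_at_right_0_iff_rational_Cauchy[OF ball_average_left_continuous[OF ui xc]])
    show ?thesis
    proof (cases "\<exists>l. (?A x \<longlongrightarrow> l) (at_right 0)")
      case True
      then obtain l where l: "(?A x \<longlongrightarrow> l) (at_right 0)" by blast
      have "(\<lambda>k. 1 * (1/2) ^ k) \<longlonglongrightarrow> (0::real)" by (intro tendsto_mult_right_zero LIMSEQ_realpow_zero) auto
      then have "filterlim (\<lambda>k. 1 / 2 ^ k) (at_right (0::real)) sequentially"
        by (auto simp: filterlim_at power_divide)
      from filterlim_compose[OF l this] have "lim (\<lambda>k. ?A x (1 / 2 ^ k)) = l" by (rule limI)
      then show ?thesis using iff True boundary_trace_eq[OF l] by auto
    next
      case False
      then have "boundary_trace \<Omega> u x = 0" by (simp add: boundary_trace_def)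
      moreover have "\<not> ?R x" using iff False by blast
      ultimately show ?thesis by (simp only: if_False)
    qed
  qed
  ultimately show ?thesis using measurable_cong[of \<nu> "\<lambda>x. if ?R x then lim (\<lambda>k. ?A x (1 / 2 ^ k)) else 0" "boundary_trace \<Omega> u" borel] by blast
qed

text \<open>The first summand bounds the averages at radius 1/2 over the finite measure \<nu>, the
  second the distance from these averages to the limit.\<close>

definition C_trace :: real where
  "C_trace = 2 * (measure lebesgue \<Omega> / (c0 * (1 / 2) ^ DIM('a))\<^sup>2) * measure \<nu> (space \<nu>)
    + 2 * (C_incr / (1 - sqrt qg)\<^sup>2) * (Cm * 2 powr d * (qg / (1 - qg)))"

lemma C_trace_nonneg: "C_trace \<ge> 0"
  unfolding C_trace_def C_incr_def using c0 qg Cm by simp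

lemma trace_bound:
  assumes u: "u \<in> C12 \<Omega>"
  shows "integrable \<nu> (\<lambda>x. (boundary_trace \<Omega> u x)\<^sup>2)"
    and "(LINT x|\<nu>. (boundary_trace \<Omega> u x)\<^sup>2) \<le> C_trace * (L2_inner \<Omega> u u + sharp_energy u)"
proof -
  have uL: "u \<in> L2 \<Omega>" using u by (simp add: C12_def)
  have E: "sharp_energy u \<ge> 0" by (simp add: sharp_energy_def)
  note B0 = L2.nonneg[OF uL]
  define c1 where "c1 = measure lebesgue \<Omega> / (c0 * (1 / 2) ^ DIM('a))\<^sup>2"
  define c2 where "c2 = C_incr / (1 - sqrt qg)\<^sup>2"
  define c3 where "c3 = Cm * 2 powr d * (qg / (1 - qg))"
  have c: "c1 \<ge> 0" "c2 \<ge> 0" "c3 \<ge> 0" using c0 qg Cm by (auto simp: c1_def c2_def c3_def C_incr_def)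
  have [measurable]: "boundary_trace \<Omega> u \<in> borel_measurable \<nu>" "trace_sum u \<in> borel_measurable \<nu>"
    using boundary_trace_measurable[OF uL] trace_sum_integral(2)[OF u] .
  have xF: "AE x in \<nu>. x \<in> frontier \<Omega>" by (rule AE_I2) (simp add: space_nu)
  have ae: "AE x in \<nu>. ennreal ((boundary_trace \<Omega> u x)\<^sup>2) \<le> ennreal (2 * (L2_inner \<Omega> u u * c1)) + ennreal (2 * c2) * trace_sum u x"
    using trace_AE_limit[OF u] xF
  proof eventually_elim
    case (elim x)
    have "(ball_average \<Omega> u x (1 / 2))\<^sup>2 \<le> L2_inner \<Omega> u u * c1"
      unfolding c1_def using frontier_in_closure[OF elim(2)] by (intro ball_average_bound uL) auto
    then have "(boundary_trace \<Omega> u x)\<^sup>2 \<le> 2 * (L2_inner \<Omega> u u * c1) + 2 * c2 * enn2real (trace_sum u x)"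
      using elim(1) by (auto simp: c2_def)
    then have "ennreal ((boundary_trace \<Omega> u x)\<^sup>2) \<le> ennreal (2 * (L2_inner \<Omega> u u * c1) + 2 * c2 * enn2real (trace_sum u x))"
      by (rule ennreal_leI)
    also have "\<dots> = ennreal (2 * (L2_inner \<Omega> u u * c1)) + ennreal (2 * c2) * ennreal (enn2real (trace_sum u x))"
      using c B0 by (simp add: ennreal_plus ennreal_mult)
    also have "ennreal (enn2real (trace_sum u x)) = trace_sum u x" using elim(1) by simp
    finally show ?case .
  qed
  have "(\<integral>\<^sup>+ x. ennreal ((boundary_trace \<Omega> u x)\<^sup>2) \<partial>\<nu>)
    \<le> (\<integral>\<^sup>+ x. ennreal (2 * (L2_inner \<Omega> u u * c1)) + ennreal (2 * c2) * trace_sum u x \<partial>\<nu>)"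
    by (rule nn_integral_mono_AE[OF ae])
  also have "\<dots> = ennreal (2 * (L2_inner \<Omega> u u * c1)) * emeasure \<nu> (space \<nu>) + ennreal (2 * c2) * (\<integral>\<^sup>+ x. trace_sum u x \<partial>\<nu>)"
    by (subst nn_integral_add) (auto simp: nn_integral_cmult)
  also have "\<dots> \<le> ennreal (2 * (L2_inner \<Omega> u u * c1)) * ennreal (measure \<nu> (space \<nu>)) + ennreal (2 * c2) * ennreal (c3 * sharp_energy u)"
    using trace_sum_integral(1)[OF u] by (intro add_mono mult_left_mono) (auto simp: c3_def nu.emeasure_eq_measure)
  also have "\<dots> = ennreal (2 * (L2_inner \<Omega> u u * c1) * measure \<nu> (space \<nu>) + 2 * c2 * (c3 * sharp_energy u))"
    using c B0 E by (simp add: ennreal_mult[symmetric] ennreal_plus[symmetric] del: ennreal_plus)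
  finally have nn: "(\<integral>\<^sup>+ x. ennreal ((boundary_trace \<Omega> u x)\<^sup>2) \<partial>\<nu>)
    \<le> ennreal (2 * (L2_inner \<Omega> u u * c1) * measure \<nu> (space \<nu>) + 2 * c2 * (c3 * sharp_energy u))" .
  show i: "integrable \<nu> (\<lambda>x. (boundary_trace \<Omega> u x)\<^sup>2)"
    by (rule integrableI_bounded) (use nn in \<open>auto simp: less_top[symmetric] top_unique\<close>)
  have "ennreal (LINT x|\<nu>. (boundary_trace \<Omega> u x)\<^sup>2) \<le> ennreal (2 * (L2_inner \<Omega> u u * c1) * measure \<nu> (space \<nu>) + 2 * c2 * (c3 * sharp_energy u))"
    using nn nn_integral_eq_integral[OF i] by simp
  then have "(LINT x|\<nu>. (boundary_trace \<Omega> u x)\<^sup>2) \<le> 2 * (L2_inner \<Omega> u u * c1) * measure \<nu> (space \<nu>) + 2 * c2 * (c3 * sharp_energy u)"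
    using c B0 E by (subst (asm) ennreal_le_iff) auto
  also have "\<dots> \<le> (2 * c1 * measure \<nu> (space \<nu>) + 2 * c2 * c3) * (L2_inner \<Omega> u u + sharp_energy u)"
  proof -
    have "0 \<le> 2 * c1 * measure \<nu> (space \<nu>) * sharp_energy u" "0 \<le> 2 * c2 * c3 * L2_inner \<Omega> u u"
      using c B0 E by auto
    then show ?thesis by (simp add: algebra_simps)
  qed
  also have "\<dots> = C_trace * (L2_inner \<Omega> u u + sharp_energy u)" by (simp add: C_trace_def c1_def c2_def c3_def)
  finally show "(LINT x|\<nu>. (boundary_trace \<Omega> u x)\<^sup>2) \<le> C_trace * (L2_inner \<Omega> u u + sharp_energy u)" .
qed

text \<open>Holds only almost everywhere: where one of the limits fails to exist, the dummy value 0
  breaks linearity.\<close>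

lemma trace_lin:
  assumes u: "u \<in> C12 \<Omega>" and v: "v \<in> C12 \<Omega>"
  shows "AE x in \<nu>. boundary_trace \<Omega> (\<lambda>x. u x + c * v x) x = boundary_trace \<Omega> u x + c * boundary_trace \<Omega> v x"
  using trace_AE_limit[OF u] trace_AE_limit[OF v]
proof eventually_elim
  case (elim x)
  have L: "u \<in> L2 \<Omega>" "v \<in> L2 \<Omega>" using u v by (auto simp: C12_def)
  have "((\<lambda>r. ball_average \<Omega> u x r + c * ball_average \<Omega> v x r) \<longlongrightarrow> boundary_trace \<Omega> u x + c * boundary_trace \<Omega> v x) (at_right 0)"
    using elim by (intro tendsto_intros) auto
  moreover have "ball_average \<Omega> (\<lambda>x. u x + c * v x) x = (\<lambda>r. ball_average \<Omega> u x r + c * ball_average \<Omega> v x r)"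
    by (rule ext) (rule ball_average_lin[OF L])
  ultimately show ?case by (intro boundary_trace_eq) simp
qed

text \<open>The trace sees \<open>u\<close> only through averages, so here the conclusion holds at
  every point and not just almost everywhere.\<close>

lemma trace_AE_const:
  assumes u: "u \<in> L2 \<Omega>" and c: "AE x in lebesgue_on \<Omega>. u x = c" and x: "x \<in> closure \<Omega>"
  shows "boundary_trace \<Omega> u x = c"
proof (rule boundary_trace_eq, rule tendsto_eventually)
  have "ball_average \<Omega> u x r = c" if r: "r > 0" for r
  proof -
    let ?m = "measure lebesgue (\<Omega> \<inter> ball x r)"
    have m: "?m > 0" by (rule measure_dom_ball_pos[OF x r])
    let ?S = "\<Omega> \<inter> ball x r"
    have S: "?S \<in> sets lebesgue" using sets_dom by auto
    have "AE z in lebesgue_on ?S. u z = c"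
      using c sets_dom S by (simp add: AE_restrict_space_iff) (auto elim: eventually_mono)
    then have "(LINT z|lebesgue_on ?S. u z) = (LINT z|lebesgue_on ?S. c)"
      using integrable_lebesgue_on_subset[OF L2_integrable[OF bs u] _ S sets_dom] by (intro integral_cong_AE) auto
    also have "\<dots> = c * ?m" using S by (simp add: measure_restrict_space space_restrict_space)
    finally show ?thesis unfolding ball_average_def using m by simp
  qed
  then show "\<forall>\<^sub>F r in at_right 0. ball_average \<Omega> u x r = c"
    unfolding eventually_at_right_field by (intro exI[of _ 1]) auto
qed

lemma frontier_nu_pos:
  assumes "frontier \<Omega> \<noteq> {}"
  shows "measure \<nu> (space \<nu>) > 0"
proof (rule ccontr)
  assume "\<not> ?thesis"
  then have "emeasure \<nu> (space \<nu>) = 0" using measure_nonneg[of \<nu> "space \<nu>"] by (simp add: nu.emeasure_eq_measure)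
  then have z: "emeasure \<mu> (frontier \<Omega>) = 0" using emeasure_nu[of UNIV] by (simp add: space_nu)
  obtain x where "x \<in> frontier \<Omega>" using assms by blast
  then have "0 < emeasure \<mu> (ball x 1)" by (intro ball_measure_pos) auto
  also have "\<dots> \<le> emeasure \<mu> (frontier \<Omega> \<union> - frontier \<Omega>)"
    using sets_mu frontier_sets by (intro emeasure_mono) auto
  also have "\<dots> \<le> emeasure \<mu> (frontier \<Omega>) + emeasure \<mu> (- frontier \<Omega>)"
    using sets_mu by (intro emeasure_subadditive) auto
  finally show False using z null_outside by simp
qed

end

section \<open>Functions with vanishing gradient\<close>

context n_set_domain
begin

text \<open>Linearity of the derivative extends the weak identity from coordinate directions to an
  arbitrary direction, as translations along \<open>v\<close> require.\<close>

lemma gradient_zero_directional: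
  assumes u: "u \<in> H1 \<Omega>" and z: "AE x in lebesgue_on \<Omega>. weak_grad \<Omega> u x = 0" and \<phi>: "\<phi> \<in> test_functions \<Omega>"
  shows "(LINT x|lebesgue_on \<Omega>. u x * frechet_derivative \<phi> (at x) v) = 0"
proof -
  have zb: "L2_inner \<Omega> u (\<lambda>x. frechet_derivative \<phi> (at x) b) = 0" if b: "b \<in> Basis" for b
  proof -
    have g: "(\<lambda>x. weak_grad \<Omega> u x \<bullet> b) \<in> L2 \<Omega>" by (rule H1_weak_grad_L2[OF u b])
    have "AE x in lebesgue_on \<Omega>. weak_grad \<Omega> u x \<bullet> b = 0" using z by eventually_elim simp
    then have "L2_inner \<Omega> (\<lambda>x. weak_grad \<Omega> u x \<bullet> b) \<phi> = 0"
      using L2.null_left[OF g test_function_L2(1)[OF bs \<phi>]] L2_inner_zero_iff[OF g] by blast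
    then show ?thesis using has_L2_gradientD(2)[OF H1D(2)[OF u] \<phi> b] by simp
  qed
  note lin = test_function_derivative_components[OF \<phi>, of _ v]
  have i: "integrable (lebesgue_on \<Omega>) (\<lambda>x. u x * frechet_derivative \<phi> (at x) b)" for b
    by (intro L2_mult_integrable H1D(1)[OF u] test_function_L2(2)[OF bs \<phi>])
  have "(LINT x|lebesgue_on \<Omega>. u x * frechet_derivative \<phi> (at x) v)
    = (LINT x|lebesgue_on \<Omega>. (\<Sum>b\<in>Basis. (v \<bullet> b) * (u x * frechet_derivative \<phi> (at x) b)))"
    unfolding lin by (simp add: sum_distrib_left mult_ac)
  also have "\<dots> = (\<Sum>b\<in>Basis. (v \<bullet> b) * (LINT x|lebesgue_on \<Omega>. u x * frechet_derivative \<phi> (at x) b))"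
    using i by (subst Bochner_Integration.integral_sum) auto
  also have "\<dots> = 0" using zb by (simp add: L2_inner_def)
  finally show ?thesis .
qed

text \<open>For a vanishing gradient, \<open>s \<mapsto> \<integral> u(y) \<phi>(y - s v) dy\<close> has derivative zero as long as the
  translated test function stays supported in \<open>\<Omega>\<close>.\<close>

lemma gradient_zero_bump_shift:
  assumes u: "u \<in> H1 \<Omega>" and z: "AE x in lebesgue_on \<Omega>. weak_grad \<Omega> u x = 0"
    and sub: "\<And>s. s \<in> {0..1} \<Longrightarrow> cbox (a + s *\<^sub>R v) (b + s *\<^sub>R v) \<subseteq> \<Omega>"
  shows "(LINT x|lebesgue_on \<Omega>. u x * bump (a + v) (b + v) m x) = (LINT x|lebesgue_on \<Omega>. u x * bump a b m x)"
proof -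
  define \<phi> where "\<phi> s = bump (a + s *\<^sub>R v) (b + s *\<^sub>R v) m" for s
  define I where "I s = (LINT x|lebesgue_on \<Omega>. u x * \<phi> s x)" for s
  have tf: "\<phi> s \<in> test_functions \<Omega>" if "s \<in> {0..1}" for s
    unfolding \<phi>_def by (rule bump_test_function[OF sub[OF that]])
  have shift: "\<phi> t x = \<phi> s (x + (- (t - s)) *\<^sub>R v)" for s t x
    by (simp add: \<phi>_def bump_def algebra_simps inner_simps)
  have ui: "integrable (lebesgue_on \<Omega>) u" by (rule L2_integrable[OF bs H1D(1)[OF u]])
  have prod_int: "integrable (lebesgue_on \<Omega>) (\<lambda>x. u x * \<phi> s x)" if "s \<in> {0..1}" for s
    by (intro L2_mult_integrable H1D(1)[OF u] test_function_L2(1)[OF bs tf[OF that]])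
  have der: "(I has_field_derivative 0) (at s within {0..1})" if s: "s \<in> {0..1}" for s
    unfolding has_field_derivative_iff tendsto_at_iff_sequentially
  proof (intro allI impI)
    fix t :: "nat \<Rightarrow> real" assume "\<forall>i. t i \<in> {0..1} - {s}" and lim: "t \<longlonglongrightarrow> s"
    then have t: "t i \<in> {0..1}" "t i \<noteq> s" for i by auto
    \<comment> \<open>Moving the bump forward by \<open>t i - s\<close> means evaluating it at a
      point moved backward, hence the sign.\<close>
    define h where "h i = - (t i - s)" for i
    have h: "h \<longlonglongrightarrow> 0" "h i \<noteq> 0" for i
      using tendsto_minus[OF LIM_zero[OF lim]] t(2)[of i] by (simp_all add: h_def[abs_def])
    note \<phi>s = tf[OF s]
    let ?D = "\<lambda>x. frechet_derivative (\<phi> s) (at x)"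
    obtain M where M: "M \<ge> 0" "\<And>x. \<bar>?D x v\<bar> \<le> M" using test_function_derivative_bounded[OF \<phi>s] by blast
    let ?q = "\<lambda>i x. (\<phi> s (x + h i *\<^sub>R v) - \<phi> s x) / h i"
    have q: "u x * ?q i x = - ((u x * \<phi> (t i) x - u x * \<phi> s x) / (t i - s))" for i x
      unfolding shift[of "t i" x s] h_def
      by (simp only: right_diff_distrib divide_minus_right mult_minus_right times_divide_eq_right)
    have "(\<lambda>i. LINT x|lebesgue_on \<Omega>. u x * ?q i x) \<longlonglongrightarrow> (LINT x|lebesgue_on \<Omega>. u x * ?D x v)"
    proof (rule integral_dominated_convergence[where w = "\<lambda>x. M * \<bar>u x\<bar>"])
      show "(\<lambda>x. u x * ?D x v) \<in> borel_measurable (lebesgue_on \<Omega>)"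
        using L2_mult_integrable[OF H1D(1)[OF u] test_function_L2(2)[OF bs \<phi>s]] by (rule borel_measurable_integrable)
      show "(\<lambda>x. u x * ?q i x) \<in> borel_measurable (lebesgue_on \<Omega>)" for i
        unfolding q using prod_int[OF t(1)] prod_int[OF s]
        by (intro borel_measurable_integrable Bochner_Integration.integrable_minus Bochner_Integration.integrable_diff integrable_divide) auto
      show "AE x in lebesgue_on \<Omega>. (\<lambda>i. u x * ?q i x) \<longlonglongrightarrow> u x * ?D x v"
        by (intro AE_I2 tendsto_mult tendsto_const difference_quotient_tendsto[OF test_function_has_derivative[OF \<phi>s] h])
      show "AE x in lebesgue_on \<Omega>. norm (u x * ?q i x) \<le> M * \<bar>u x\<bar>" for i
      proof (rule AE_I2)
        fix x
        have "\<bar>\<phi> s (x + h i *\<^sub>R v) - \<phi> s x\<bar> \<le> \<bar>h i\<bar> * M"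
          by (rule difference_bound[OF test_function_has_derivative[OF \<phi>s] M(2)])
        then have "\<bar>?q i x\<bar> \<le> M" using h(2)[of i] by (simp add: abs_divide pos_divide_le_eq mult.commute)
        then show "norm (u x * ?q i x) \<le> M * \<bar>u x\<bar>"
          unfolding real_norm_def abs_mult by (subst mult.commute) (rule mult_right_mono, simp_all)
      qed
    qed (use ui in auto)
    then have "(\<lambda>i. LINT x|lebesgue_on \<Omega>. u x * ?q i x) \<longlonglongrightarrow> 0"
      using gradient_zero_directional[OF u z \<phi>s] by simp
    moreover have "(LINT x|lebesgue_on \<Omega>. u x * ?q i x) = - ((I (t i) - I s) / (t i - s))" for i
      unfolding q I_def using prod_int[OF t(1)[of i]] prod_int[OF s] by simp
    ultimately have "(\<lambda>i. - ((I (t i) - I s) / (t i - s))) \<longlonglongrightarrow> 0" by simp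
    from tendsto_minus[OF this] show "((\<lambda>y. (I y - I s) / (y - s)) \<circ> t) \<longlonglongrightarrow> 0" by (simp add: o_def)
  qed
  have "\<exists>c. \<forall>x\<in>{0..1}. I x = c"
    by (rule has_field_derivative_zero_constant[OF _ der]) auto
  then have "I 1 = I 0" by auto
  then show ?thesis by (simp add: I_def \<phi>_def)
qed

text \<open>Invariance of the bump integrals passes in the limit to integrals over boxes, hence
  \<open>w y = w (y + v)\<close> for almost every \<open>y\<close> near \<open>x\<close>, and
  finally to averages over balls.\<close>

lemma gradient_zero_average_shift:
  assumes u: "u \<in> H1 \<Omega>" and z: "AE x in lebesgue_on \<Omega>. weak_grad \<Omega> u x = 0"
    and ball: "ball x (3 * e) \<subseteq> \<Omega>" and v: "norm v < e" and r: "0 < r" "r < e"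
  shows "ball_average \<Omega> u (x + v) r = ball_average \<Omega> u x r"
proof -
  have e: "e > 0" using r by simp
  have ui: "integrable (lebesgue_on \<Omega>) u" by (rule L2_integrable[OF bs H1D(1)[OF u]])
  obtain w where w: "w \<in> borel_measurable borel" "integrable lborel w" "\<And>x. x \<notin> \<Omega> \<Longrightarrow> w x = (0::real)"
    "AE x in lebesgue_on \<Omega>. u x = w x" by (rule borel_representative[OF ui]) blast
  have wv: "integrable lborel (\<lambda>y. w (y + v))"
  proof -
    have "integrable (distr lborel borel ((+) v)) w" using w(2) lborel_distr_plus[of v] by simp
    then have "integrable lborel (\<lambda>y. w (v + y))" using w(1) by (subst (asm) integrable_distr_eq) auto
    then show ?thesis by (simp add: add.commute)
  qed
  have [measurable]: "w \<in> borel_measurable borel" by fact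
  \<comment> \<open>Boxes inside this ball, moved by less than \<open>e\<close>, remain in the ball
    of radius \<open>3 * e\<close> and therefore in \<open>\<Omega>\<close>.\<close>
  let ?B = "ball x (2 * e)"
  have rep: "(LINT y|lebesgue_on \<Omega>. u y * indicator (box a b) y) = (LINT y|lborel. indicator (box a b) y * w y)"
    if "box a b \<subseteq> \<Omega>" for a b
  proof -
    have "(LINT y|lebesgue_on \<Omega>. u y * indicator (box a b) y) = (LINT y|lebesgue_on (box a b). u y)"
      using sets_dom that
      by (simp add: integral_restrict_space) (intro arg_cong[of _ _ "integral\<^sup>L lebesgue"], auto simp: fun_eq_iff split: split_indicator)
    also have "\<dots> = (LINT y|lborel. indicator (box a b) y * w y)"
      by (rule set_integral_representative[OF ui w(1,4)]) (use that in auto)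
    finally show ?thesis .
  qed
  have indw: "integrable lborel (\<lambda>y. indicator A y * f y)" if "integrable lborel f" "A \<in> sets borel" for A :: "'a set" and f :: "'a \<Rightarrow> real"
    using integrable_mult_indicator[of A lborel f] that by simp
  have "AE y in lebesgue_on ?B. w y - w (y + v) = 0"
  proof (rule AE_zero_if_box_integrals_zero_on)
    have d: "integrable lborel (\<lambda>y. indicator ?B y * (w y - w (y + v)))"
      using w(2) wv by (intro indw) auto
    have "integrable (lebesgue_on ?B) (\<lambda>y. indicator ?B y * (w y - w (y + v)))"
      using d by (subst integral_lebesgue_on_eq_lborel(2)) auto
    then show "integrable (lebesgue_on ?B) (\<lambda>y. w y - w (y + v))"
      by (rule Bochner_Integration.integrable_cong[THEN iffD1, rotated 2]) auto
    fix a b assume ab: "cbox a b \<subseteq> ?B"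
    have sub: "cbox (a + s *\<^sub>R v) (b + s *\<^sub>R v) \<subseteq> \<Omega>" if s: "s \<in> {0..1}" for s
    proof
      fix y assume "y \<in> cbox (a + s *\<^sub>R v) (b + s *\<^sub>R v)"
      then have "y - s *\<^sub>R v \<in> cbox a b" by (simp add: mem_box inner_simps) (auto simp: algebra_simps)
      then have "dist x (y - s *\<^sub>R v) < 2 * e" using ab by auto
      moreover have "norm (s *\<^sub>R v) < e" using s v mult_left_le_one_le[of "norm v" s] by auto
      moreover have "dist x y \<le> dist x (y - s *\<^sub>R v) + norm (s *\<^sub>R v)"
        using dist_triangle[of x y "y - s *\<^sub>R v"] by (simp add: dist_norm)
      ultimately show "y \<in> \<Omega>" using ball by auto
    qed
    have sub0: "cbox a b \<subseteq> \<Omega>" "cbox (a + v) (b + v) \<subseteq> \<Omega>" using sub[of 0] sub[of 1] by auto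
    have "(\<lambda>m. LINT y|lebesgue_on \<Omega>. u y * bump a b m y) \<longlonglongrightarrow> (LINT y|lebesgue_on \<Omega>. u y * indicator (box (a + v) (b + v)) y)"
      using bump_integral_limit[OF ui sub0(2)] gradient_zero_bump_shift[OF u z sub] by simp
    then have "(LINT y|lebesgue_on \<Omega>. u y * indicator (box a b) y) = (LINT y|lebesgue_on \<Omega>. u y * indicator (box (a + v) (b + v)) y)"
      using bump_integral_limit[OF ui sub0(1)] LIMSEQ_unique by blast
    then have "(LINT y|lborel. indicator (box a b) y * w y) = (LINT y|lborel. indicator (box (a + v) (b + v)) y * w y)"
      using rep sub0 box_subset_cbox by (metis subset_trans)
    also have "\<dots> = (LINT y|lborel. indicator (box (a + v) (b + v)) (y + v) * w (y + v))"
      by (rule integral_lborel_shift[symmetric]) measurable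
    also have "\<dots> = (LINT y|lborel. indicator (box a b) y * w (y + v))"
      by (intro arg_cong[of _ _ "integral\<^sup>L lborel"]) (auto simp: fun_eq_iff mem_box inner_simps split: split_indicator)
    finally have eq: "(LINT y|lborel. indicator (box a b) y * w y) = (LINT y|lborel. indicator (box a b) y * w (y + v))" .
    have "(LINT y|lebesgue_on ?B. indicator (box a b) y * (w y - w (y + v))) = (LINT y|lborel. indicator (box a b) y * (w y - w (y + v)))"
      using ab box_subset_cbox[of a b] by (intro integral_lebesgue_on_eq_lborel(1)) (auto split: split_indicator)
    also have "\<dots> = 0"
      using eq indw[OF w(2), of "box a b"] indw[OF wv, of "box a b"] by (simp add: right_diff_distrib)
    finally show "(LINT y|lebesgue_on ?B. indicator (box a b) y * (w y - w (y + v))) = 0" .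
  qed simp
  then have ae: "AE y in lborel. y \<in> ?B \<longrightarrow> w y - w (y + v) = 0"
    by (simp add: AE_restrict_space_iff AE_completion_iff)
  have rB: "ball x r \<subseteq> ?B" using r by (intro subset_ball) simp
  have "(LINT y|lborel. indicator (ball x r) y * w y) = (LINT y|lborel. indicator (ball x r) y * w (y + v))"
  proof (rule integral_cong_AE)
    show "AE y in lborel. indicator (ball x r) y * w y = indicator (ball x r) y * w (y + v)"
      using ae by eventually_elim (use rB in \<open>auto split: split_indicator\<close>)
    have "(\<lambda>y. w (y + v)) \<in> borel_measurable borel" by measurable
    then show "(\<lambda>y. indicator (ball x r) y * w (y + v)) \<in> borel_measurable lborel"
      "(\<lambda>y. indicator (ball x r) y * w y) \<in> borel_measurable lborel"
      using w(1) by (auto intro!: borel_measurable_times borel_measurable_indicator)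
  qed
  also have "\<dots> = (LINT y|lborel. indicator (ball (x + v) r) (y + v) * w (y + v))"
    by (intro arg_cong[of _ _ "integral\<^sup>L lborel"]) (auto simp: fun_eq_iff dist_norm split: split_indicator)
  also have "\<dots> = (LINT y|lborel. indicator (ball (x + v) r) y * w y)"
    using w(1) by (intro integral_lborel_shift borel_measurable_times borel_measurable_indicator) auto
  finally have eq: "(LINT y|lborel. indicator (ball x r) y * w y) = (LINT y|lborel. indicator (ball (x + v) r) y * w y)" .
  have "ball (x + v) r \<subseteq> ball x (3 * e)"
  proof
    fix y assume "y \<in> ball (x + v) r"
    then show "y \<in> ball x (3 * e)"
      using dist_triangle[of x y "x + v"] v r e by (auto simp: dist_norm)
  qed
  then have "\<Omega> \<inter> ball (x + v) r = ball (x + v) r" "\<Omega> \<inter> ball x r = ball x r"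
    using ball rB subset_ball[of "2 * e" "3 * e" x] e by auto
  moreover have "measure lebesgue (ball (x + v) r) = measure lebesgue (ball x r)"
    using measure_ball[of r "x + v"] measure_ball[of r x] r by simp
  moreover have "ball_average \<Omega> u y r = (LINT z|lborel. indicator (ball y r) z * w z) / (LINT z|lborel. indicator (\<Omega> \<inter> ball y r) z)" for y
    by (rule ball_average_representative[OF ui w(1) _ w(4)]) (rule w(3))
  ultimately show ?thesis using eq by simp
qed

text \<open>Local constancy is obtained for the averages, which are defined at every point, and is
  transferred to \<open>u\<close> at the end through its Lebesgue points.\<close>

lemma gradient_zero_imp_const:
  assumes u: "u \<in> H1 \<Omega>" "u \<in> C12 \<Omega>" and z: "AE x in lebesgue_on \<Omega>. weak_grad \<Omega> u x = 0"
    and con: "connected \<Omega>" and ne: "\<Omega> \<noteq> {}"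
  shows "\<exists>c. AE x in lebesgue_on \<Omega>. u x = c"
proof -
  have yO: "AE y in lebesgue_on \<Omega>. y \<in> \<Omega>" by (rule AE_I2) (simp add: space_restrict_space)
  have "\<exists>y\<in>\<Omega>. (ball_average \<Omega> u y \<longlongrightarrow> u y) (at_right 0)"
  proof (rule ccontr)
    assume "\<not> ?thesis"
    then have nex: "y \<in> \<Omega> \<Longrightarrow> \<not> (ball_average \<Omega> u y \<longlongrightarrow> u y) (at_right 0)" for y by blast
    have "AE y in lebesgue_on \<Omega>. y \<notin> \<Omega>"
      using Lebesgue_points[OF u(2)] by eventually_elim (use nex in blast)
    then have "AE y in lebesgue. y \<notin> \<Omega>" using sets_dom by (simp add: AE_restrict_space_iff)
    then have "negligible \<Omega>" using sets_dom by (simp add: negligible_iff_null_sets AE_iff_null_sets)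
    then show False using open_not_negligible[OF open_dom ne] by blast
  qed
  then obtain y0 where y0: "y0 \<in> \<Omega>" "(ball_average \<Omega> u y0 \<longlongrightarrow> u y0) (at_right 0)" by blast
  \<comment> \<open>A fixed target value makes this a truth value attached to each point; it is
    locally constant, so connectedness spreads it from \<open>y0\<close> over all of
    \<open>\<Omega>\<close>.\<close>
  define P where "P x \<longleftrightarrow> (ball_average \<Omega> u x \<longlongrightarrow> u y0) (at_right 0)" for x
  have local_const: "\<exists>e>0. \<forall>x'\<in>ball x e. P x = P x'" if x: "x \<in> \<Omega>" for x
  proof -
    obtain e' where e': "e' > 0" "ball x e' \<subseteq> \<Omega>" using open_dom x open_contains_ball by blast
    define e where "e = e' / 3"
    have e: "e > 0" "ball x (3 * e) \<subseteq> \<Omega>" using e' by (auto simp: e_def)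
    have "P x = P x'" if x': "x' \<in> ball x e" for x'
    proof -
      have "ball_average \<Omega> u x' r = ball_average \<Omega> u x r" if "0 < r" "r < e" for r
      proof -
        have nv: "norm (x' - x) < e" using x' by (metis dist_commute dist_norm mem_ball)
        from gradient_zero_average_shift[OF u(1) z e(2) nv that] show ?thesis by simp
      qed
      then have "\<forall>\<^sub>F r in at_right 0. ball_average \<Omega> u x r = ball_average \<Omega> u x' r"
        unfolding eventually_at_right_field using e(1) by (intro exI[of _ e]) auto
      then show ?thesis unfolding P_def by (rule tendsto_cong)
    qed
    then show ?thesis using e(1) by blast
  qed
  have all: "P x" if x: "x \<in> \<Omega>" for x
  proof -
    have "P y0 = P x"
    proof (rule connected_local_const[OF con y0(1) x], rule ballI)
      fix a assume "a \<in> \<Omega>"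
      then obtain e where "e > 0" "\<forall>x'\<in>ball a e. P a = P x'" using local_const by blast
      then show "\<forall>\<^sub>F b in at a within \<Omega>. P a = P b"
        unfolding eventually_at by (intro exI[of _ e]) (auto simp: dist_commute)
    qed
    then show ?thesis using y0(2) by (simp add: P_def)
  qed
  have "AE y in lebesgue_on \<Omega>. u y = u y0"
    using Lebesgue_points[OF u(2)] yO
  proof eventually_elim
    case (elim y)
    show ?case using tendsto_unique[OF _ elim(1) all[OF elim(2), unfolded P_def]] by simp
  qed
  then show ?thesis by blast
qed

end

section \<open>The trace eigenvalue problem\<close>

locale trace_problem = traced_domain \<Omega> c0 \<mu> d Cm
  for \<Omega> :: "'a::euclidean_space set" and c0 and \<mu> :: "'a measure" and d Cm +
  fixes a CE :: real
  assumes con: "connected \<Omega>" and ne: "\<Omega> \<noteq> {}" and a: "a > 0" and CE: "CE \<ge> 0"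
    and H1_C12: "H1 \<Omega> = C12 \<Omega>"
    and sharp_energy_bound: "u \<in> H1 \<Omega> \<Longrightarrow> sharp_energy u \<le> CE * (L2_inner \<Omega> u u + grad_inner \<Omega> u u)"
begin

definition trace_form :: "('a \<Rightarrow> real) \<Rightarrow> ('a \<Rightarrow> real) \<Rightarrow> real" where
  "trace_form u v = (LINT x|\<nu>. boundary_trace \<Omega> u x * boundary_trace \<Omega> v x)"

lemma Tr_inner_eq: "Tr_inner \<Omega> \<mu> a u v = grad_inner \<Omega> u v + a * trace_form u v"
  unfolding Tr_inner_def trace_form_def set_lebesgue_integral_def
  using frontier_sets by (simp add: integral_restrict_space)

lemma trace_meas: "u \<in> H1 \<Omega> \<Longrightarrow> boundary_trace \<Omega> u \<in> borel_measurable \<nu>"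
  by (intro boundary_trace_measurable H1D(1))

lemma trace_square: "u \<in> H1 \<Omega> \<Longrightarrow> integrable \<nu> (\<lambda>x. (boundary_trace \<Omega> u x)\<^sup>2)"
  using trace_bound(1) H1_C12 by simp

lemma trace_prod: "u \<in> H1 \<Omega> \<Longrightarrow> v \<in> H1 \<Omega> \<Longrightarrow> integrable \<nu> (\<lambda>x. boundary_trace \<Omega> u x * boundary_trace \<Omega> v x)"
  by (intro integrable_mult_if_square_integrable trace_meas trace_square)

lemma trace_form_lin:
  assumes "u \<in> H1 \<Omega>" "v \<in> H1 \<Omega>" "w \<in> H1 \<Omega>"
  shows "trace_form (\<lambda>x. u x + c * v x) w = trace_form u w + c * trace_form v w"
proof -
  have [measurable]: "boundary_trace \<Omega> (\<lambda>x. u x + c * v x) \<in> borel_measurable \<nu>"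
    "boundary_trace \<Omega> u \<in> borel_measurable \<nu>" "boundary_trace \<Omega> v \<in> borel_measurable \<nu>" "boundary_trace \<Omega> w \<in> borel_measurable \<nu>"
    using trace_meas H1_lin assms by blast+
  have "trace_form (\<lambda>x. u x + c * v x) w
    = (LINT x|\<nu>. boundary_trace \<Omega> u x * boundary_trace \<Omega> w x + c * (boundary_trace \<Omega> v x * boundary_trace \<Omega> w x))"
    unfolding trace_form_def
  proof (rule integral_cong_AE)
    have "u \<in> C12 \<Omega>" "v \<in> C12 \<Omega>" using assms H1_C12 by auto
    from trace_lin[OF this, of c] show "AE x in \<nu>. boundary_trace \<Omega> (\<lambda>x. u x + c * v x) x * boundary_trace \<Omega> w x
      = boundary_trace \<Omega> u x * boundary_trace \<Omega> w x + c * (boundary_trace \<Omega> v x * boundary_trace \<Omega> w x)"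
      by eventually_elim (simp add: algebra_simps)
  qed measurable
  then show ?thesis unfolding trace_form_def using trace_prod assms by simp
qed

lemma psd_form_Tr: "psd_form (H1 \<Omega>) (Tr_inner \<Omega> \<mu> a)"
proof
  show "(\<lambda>x. 0) \<in> H1 \<Omega>" by (rule grad.zero_mem)
  show "(\<lambda>x. u x + c * v x) \<in> H1 \<Omega>" if "u \<in> H1 \<Omega>" "v \<in> H1 \<Omega>" for u v c by (rule H1_lin[OF that])
  show "Tr_inner \<Omega> \<mu> a u v = Tr_inner \<Omega> \<mu> a v u" if "u \<in> H1 \<Omega>" "v \<in> H1 \<Omega>" for u v
    unfolding Tr_inner_eq using grad.sym[OF that] by (simp add: trace_form_def mult.commute)
  show "Tr_inner \<Omega> \<mu> a (\<lambda>x. u x + c * v x) w = Tr_inner \<Omega> \<mu> a u w + c * Tr_inner \<Omega> \<mu> a v w"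
    if "u \<in> H1 \<Omega>" "v \<in> H1 \<Omega>" "w \<in> H1 \<Omega>" for u v w c
    unfolding Tr_inner_eq grad.lin[OF that] trace_form_lin[OF that] by (simp add: algebra_simps)
  show "0 \<le> Tr_inner \<Omega> \<mu> a u u" if "u \<in> H1 \<Omega>" for u
    unfolding Tr_inner_eq trace_form_def using grad.nonneg[OF that] a by simp
qed

lemma grad_le_Tr: "u \<in> H1 \<Omega> \<Longrightarrow> grad_inner \<Omega> u u \<le> Tr_inner \<Omega> \<mu> a u u"
  unfolding Tr_inner_eq trace_form_def using a by simp

text \<open>Together with \<open>grad_le_Tr\<close> this shows that adding the L2 part to either
  form gives equivalent norms, so completeness carries over from \<open>H1_complete\<close>.\<close>

lemma Tr_le:
  assumes "u \<in> H1 \<Omega>"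
  shows "Tr_inner \<Omega> \<mu> a u u \<le> (1 + a * C_trace * (1 + CE)) * (grad_inner \<Omega> u u + L2_inner \<Omega> u u)"
proof -
  note g = grad.nonneg[OF assms] and l = L2.nonneg[OF H1D(1)[OF assms]]
  have "trace_form u u \<le> C_trace * (L2_inner \<Omega> u u + sharp_energy u)"
    using trace_bound(2)[of u] assms H1_C12 unfolding trace_form_def by (simp add: power2_eq_square)
  also have "\<dots> \<le> C_trace * (L2_inner \<Omega> u u + CE * (L2_inner \<Omega> u u + grad_inner \<Omega> u u))"
    using sharp_energy_bound[OF assms] C_trace_nonneg by (intro mult_left_mono add_left_mono) auto
  also have "\<dots> \<le> C_trace * ((1 + CE) * (grad_inner \<Omega> u u + L2_inner \<Omega> u u))"
    using g C_trace_nonneg by (intro mult_left_mono) (auto simp: algebra_simps)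
  finally have "a * trace_form u u \<le> a * (C_trace * ((1 + CE) * (grad_inner \<Omega> u u + L2_inner \<Omega> u u)))"
    using a by (intro mult_left_mono) auto
  then show ?thesis unfolding Tr_inner_eq using l by (simp add: algebra_simps)
qed

lemma Tr_null_iff:
  assumes u: "u \<in> H1 \<Omega>"
  shows "Tr_inner \<Omega> \<mu> a u u = 0 \<longleftrightarrow> L2_inner \<Omega> u u = 0"
proof
  assume "Tr_inner \<Omega> \<mu> a u u = 0"
  moreover have "0 \<le> trace_form u u" by (simp add: trace_form_def)
  ultimately have g0: "grad_inner \<Omega> u u = 0" and t0: "trace_form u u = 0"
    using grad.nonneg[OF u] a unfolding Tr_inner_eq by (auto simp: add_nonneg_eq_0_iff)
  have "AE x in lebesgue_on \<Omega>. weak_grad \<Omega> u x \<bullet> weak_grad \<Omega> u x = 0"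
    using g0 integral_nonneg_eq_0_iff_AE[OF grad_inner_components(2)[OF u u]] by (simp add: grad_inner_def)
  then have "AE x in lebesgue_on \<Omega>. weak_grad \<Omega> u x = 0" by eventually_elim simp
  from gradient_zero_imp_const[OF u _ this con ne] u H1_C12
  obtain c where c: "AE x in lebesgue_on \<Omega>. u x = c" by auto
  \<comment> \<open>A nonempty bounded set has a frontier, which therefore has positive measure;
    otherwise the trace could not exclude nonzero constants.\<close>
  have "frontier \<Omega> \<noteq> {}" using frontier_not_empty[OF ne] bounded_dom not_bounded_UNIV by blast
  then have pos: "measure \<nu> (space \<nu>) > 0" by (rule frontier_nu_pos)
  have "trace_form u u = (LINT x|\<nu>. c * c)"
    unfolding trace_form_def
    by (intro Bochner_Integration.integral_cong refl)
      (use trace_AE_const[OF H1D(1)[OF u] c] frontier_in_closure in \<open>simp add: space_nu\<close>)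
  then have "c = 0" using t0 pos by simp
  then show "L2_inner \<Omega> u u = 0" using c L2_inner_zero_iff[OF H1D(1)[OF u]] by simp
next
  assume "L2_inner \<Omega> u u = 0"
  then have ae: "AE x in lebesgue_on \<Omega>. u x = 0" using L2_inner_zero_iff[OF H1D(1)[OF u]] by simp
  have "AE x in lebesgue_on \<Omega>. weak_grad \<Omega> u x = 0" by (rule H1_if_AE_zero(2)[OF H1D(1)[OF u] ae])
  then have "AE x in lebesgue_on \<Omega>. weak_grad \<Omega> u x \<bullet> weak_grad \<Omega> u x = 0" by eventually_elim simp
  then have "grad_inner \<Omega> u u = 0"
    unfolding grad_inner_def using integral_nonneg_eq_0_iff_AE[OF grad_inner_components(2)[OF u u]] by simp
  moreover have "trace_form u u = (LINT x|\<nu>. 0 * 0)"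
    unfolding trace_form_def
    by (intro Bochner_Integration.integral_cong refl)
      (use trace_AE_const[OF H1D(1)[OF u] ae] frontier_in_closure in \<open>simp add: space_nu\<close>)
  ultimately show "Tr_inner \<Omega> \<mu> a u u = 0" unfolding Tr_inner_eq by simp
qed

text \<open>A Cauchy sequence for the larger energy is Cauchy in \<open>H1 \<Omega>\<close>;
  convergence there returns to the energy by \<open>Tr_le\<close>.\<close>

lemma Tr_complete:
  assumes s: "\<And>n::nat. s n \<in> H1 \<Omega>"
    and Cauchy: "\<And>e. e > 0 \<Longrightarrow> \<exists>M. \<forall>m\<ge>M. \<forall>n\<ge>M. Tr_inner \<Omega> \<mu> a (\<lambda>x. s m x - s n x) (\<lambda>x. s m x - s n x)
         + L2_inner \<Omega> (\<lambda>x. s m x - s n x) (\<lambda>x. s m x - s n x) < e"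
  shows "\<exists>l\<in>H1 \<Omega>. (\<lambda>n. Tr_inner \<Omega> \<mu> a (\<lambda>x. s n x - l x) (\<lambda>x. s n x - l x)
         + L2_inner \<Omega> (\<lambda>x. s n x - l x) (\<lambda>x. s n x - l x)) \<longlonglongrightarrow> 0"
proof -
  have "\<exists>K. \<forall>m\<ge>K. \<forall>n\<ge>K. grad_inner \<Omega> (\<lambda>x. s m x - s n x) (\<lambda>x. s m x - s n x)
       + L2_inner \<Omega> (\<lambda>x. s m x - s n x) (\<lambda>x. s m x - s n x) < e" if "e > 0" for e
  proof -
    obtain M where M: "\<forall>m\<ge>M. \<forall>n\<ge>M. Tr_inner \<Omega> \<mu> a (\<lambda>x. s m x - s n x) (\<lambda>x. s m x - s n x)
         + L2_inner \<Omega> (\<lambda>x. s m x - s n x) (\<lambda>x. s m x - s n x) < e" using Cauchy[OF \<open>e > 0\<close>] by blast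
    have gT: "grad_inner \<Omega> (\<lambda>x. s m x - s n x) (\<lambda>x. s m x - s n x) \<le> Tr_inner \<Omega> \<mu> a (\<lambda>x. s m x - s n x) (\<lambda>x. s m x - s n x)" for m n
      by (rule grad_le_Tr[OF grad.diff_mem[OF s s]])
    show ?thesis
    proof (intro exI[of _ M] allI impI)
      fix m n assume "M \<le> m" "M \<le> n"
      with M have "Tr_inner \<Omega> \<mu> a (\<lambda>x. s m x - s n x) (\<lambda>x. s m x - s n x)
        + L2_inner \<Omega> (\<lambda>x. s m x - s n x) (\<lambda>x. s m x - s n x) < e" by blast
      then show "grad_inner \<Omega> (\<lambda>x. s m x - s n x) (\<lambda>x. s m x - s n x)
        + L2_inner \<Omega> (\<lambda>x. s m x - s n x) (\<lambda>x. s m x - s n x) < e"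
        using gT[of m n] by linarith
    qed
  qed
  from H1_complete[OF s this] obtain l where l: "l \<in> H1 \<Omega>"
    and g: "(\<lambda>n. grad_inner \<Omega> (\<lambda>x. s n x - l x) (\<lambda>x. s n x - l x)) \<longlonglongrightarrow> 0"
    and b: "(\<lambda>n. L2_inner \<Omega> (\<lambda>x. s n x - l x) (\<lambda>x. s n x - l x)) \<longlonglongrightarrow> 0" by blast
  have d: "(\<lambda>x. s n x - l x) \<in> H1 \<Omega>" for n by (rule grad.diff_mem[OF s l])
  have "(\<lambda>n. Tr_inner \<Omega> \<mu> a (\<lambda>x. s n x - l x) (\<lambda>x. s n x - l x)) \<longlonglongrightarrow> 0"
  proof (rule tendsto_sandwich[OF _ _ tendsto_const])
    show "(\<lambda>n. (1 + a * C_trace * (1 + CE)) * (grad_inner \<Omega> (\<lambda>x. s n x - l x) (\<lambda>x. s n x - l x)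
      + L2_inner \<Omega> (\<lambda>x. s n x - l x) (\<lambda>x. s n x - l x))) \<longlonglongrightarrow> 0"
      using tendsto_mult_right_zero[OF tendsto_add[OF g b, simplified]] .
    show "\<forall>\<^sub>F n in sequentially. 0 \<le> Tr_inner \<Omega> \<mu> a (\<lambda>x. s n x - l x) (\<lambda>x. s n x - l x)"
      using psd_form.nonneg[OF psd_form_Tr d] by simp
  qed (use Tr_le[OF d] in simp)
  from tendsto_add[OF this b] l show ?thesis by auto
qed

lemma finite_ball_cover: "0 < r \<Longrightarrow> \<exists>P. finite P \<and> P \<subseteq> \<Omega> \<and> \<Omega> \<subseteq> (\<Union>p\<in>P. ball p r)"
proof -
  assume r: "0 < r"
  have c: "compact (closure \<Omega>)" using bounded_dom by (simp add: compact_closure)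
  have sub: "closure \<Omega> \<subseteq> (\<Union>p\<in>\<Omega>. ball p r)"
  proof
    fix x assume "x \<in> closure \<Omega>"
    then obtain y where "y \<in> \<Omega>" "dist y x < r" using r closure_approachable by blast
    then show "x \<in> (\<Union>p\<in>\<Omega>. ball p r)" by auto
  qed
  obtain P where P: "P \<subseteq> \<Omega>" "finite P" "closure \<Omega> \<subseteq> (\<Union>p\<in>P. ball p r)"
    by (rule compactE_image[OF c _ sub]) auto
  show ?thesis by (intro exI[of _ P] conjI P(1,2) subset_trans[OF closure_subset P(3)])
qed

text \<open>The functionals are the averages at the centres of a finite cover by balls of radius
  \<open>r\<close>, scaled to absorb the factor \<open>2 * measure lebesgue \<Omega>\<close>;
  shrinking \<open>r\<close> makes the remaining term small.\<close>

lemma Tr_compact: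
  assumes e: "e > 0"
  shows "\<exists>(m::nat) \<phi> C.
      (\<forall>i<m. \<forall>u\<in>H1 \<Omega>. \<forall>v\<in>H1 \<Omega>. \<phi> i (\<lambda>x. u x - v x) = \<phi> i u - \<phi> i v) \<and>
      (\<forall>i<m. \<forall>u\<in>H1 \<Omega>. (\<phi> i u)\<^sup>2 \<le> C * L2_inner \<Omega> u u) \<and>
      (\<forall>u\<in>H1 \<Omega>. L2_inner \<Omega> u u \<le> e * (Tr_inner \<Omega> \<mu> a u u + L2_inner \<Omega> u u) + (\<Sum>i<m. (\<phi> i u :: real)\<^sup>2))"
proof -
  \<comment> \<open>The summand 1 keeps \<open>M\<close> positive, so that \<open>e / M\<close> is
    meaningful when \<open>CE = 0\<close>.\<close>
  define M where "M = 32 * K_sharp\<^sup>2 * (CE + 1)"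
  have M: "M > 0" using K_sharp_pos CE by (simp add: M_def)
  define r where "r = min 1 (sqrt (e / M))"
  have r: "0 < r" "r \<le> 1" using e M by (auto simp: r_def)
  have "r\<^sup>2 \<le> (sqrt (e / M))\<^sup>2" using r by (intro power_mono) (auto simp: r_def)
  then have "M * r\<^sup>2 \<le> e" using e M by (simp add: field_simps)
  moreover have "32 * (K_sharp * r)\<^sup>2 * CE \<le> M * r\<^sup>2"
    unfolding M_def power_mult_distrib using CE by (simp add: algebra_simps)
  ultimately have re: "32 * (K_sharp * r)\<^sup>2 * CE \<le> e" by linarith
  obtain P where P: "finite P" "P \<subseteq> \<Omega>" "\<Omega> \<subseteq> (\<Union>p\<in>P. ball p r)" using finite_ball_cover[OF r(1)] by blast
  obtain p where p: "bij_betw p {0..<card P} P" using ex_bij_betw_nat_finite[OF P(1)] by blast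
  define k where "k = sqrt (2 * measure lebesgue \<Omega>)"
  define \<phi> where "\<phi> i u = k * ball_average \<Omega> u (p i) r" for i u
  define C where "C = k\<^sup>2 * (measure lebesgue \<Omega> / (c0 * r ^ DIM('a))\<^sup>2)"
  have k2: "k\<^sup>2 = 2 * measure lebesgue \<Omega>" by (simp add: k_def)
  have "\<phi> i (\<lambda>x. u x - v x) = \<phi> i u - \<phi> i v" if "u \<in> H1 \<Omega>" "v \<in> H1 \<Omega>" for i u v
  proof -
    have "ball_average \<Omega> (\<lambda>x. u x - v x) (p i) r = ball_average \<Omega> u (p i) r - ball_average \<Omega> v (p i) r"
      using ball_average_lin[OF H1D(1)[OF that(1)] H1D(1)[OF that(2)], of "-1" "p i" r] by simp
    then show ?thesis unfolding \<phi>_def by (simp only: right_diff_distrib)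
  qed
  moreover have "(\<phi> i u)\<^sup>2 \<le> C * L2_inner \<Omega> u u" if i: "i < card P" and u: "u \<in> H1 \<Omega>" for i u
  proof -
    have "p i \<in> closure \<Omega>" using bij_betwE[OF p] i P(2) closure_subset by fastforce
    from mult_left_mono[OF ball_average_bound[OF H1D(1)[OF u] this r], of "k\<^sup>2"]
    show ?thesis by (simp add: \<phi>_def C_def power_mult_distrib mult_ac)
  qed
  moreover have "L2_inner \<Omega> u u \<le> e * (Tr_inner \<Omega> \<mu> a u u + L2_inner \<Omega> u u) + (\<Sum>i<card P. (\<phi> i u)\<^sup>2)"
    if u: "u \<in> H1 \<Omega>" for u
  proof -
    have "L2_inner \<Omega> u u \<le> 32 * (K_sharp * r)\<^sup>2 * sharp_energy u + (\<Sum>q\<in>P. 2 * measure lebesgue \<Omega> * (ball_average \<Omega> u q r)\<^sup>2)"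
      using u H1_C12 by (intro compactness_estimate r P) auto
    also have "(\<Sum>q\<in>P. 2 * measure lebesgue \<Omega> * (ball_average \<Omega> u q r)\<^sup>2) = (\<Sum>i<card P. (\<phi> i u)\<^sup>2)"
      using sum.reindex_bij_betw[OF p, of "\<lambda>q. 2 * measure lebesgue \<Omega> * (ball_average \<Omega> u q r)\<^sup>2"]
      by (simp add: \<phi>_def power_mult_distrib k2 lessThan_atLeast0)
    finally have "L2_inner \<Omega> u u \<le> 32 * (K_sharp * r)\<^sup>2 * sharp_energy u + (\<Sum>i<card P. (\<phi> i u)\<^sup>2)" .
    moreover have "32 * (K_sharp * r)\<^sup>2 * sharp_energy u \<le> 32 * (K_sharp * r)\<^sup>2 * (CE * (L2_inner \<Omega> u u + grad_inner \<Omega> u u))"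
      using sharp_energy_bound[OF u] by (intro mult_left_mono) auto
    moreover have "\<dots> = 32 * (K_sharp * r)\<^sup>2 * CE * (L2_inner \<Omega> u u + grad_inner \<Omega> u u)" by simp
    moreover have "\<dots> \<le> e * (L2_inner \<Omega> u u + grad_inner \<Omega> u u)"
      using re grad.nonneg[OF u] L2.nonneg[OF H1D(1)[OF u]] by (intro mult_right_mono) auto
    moreover have "\<dots> \<le> e * (Tr_inner \<Omega> \<mu> a u u + L2_inner \<Omega> u u)"
      using grad_le_Tr[OF u] e by (intro mult_left_mono) auto
    ultimately show ?thesis by linarith
  qed
  ultimately show ?thesis by blast
qed

sublocale spectral: spectral_pair "H1 \<Omega>" "Tr_inner \<Omega> \<mu> a" "L2_inner \<Omega>"
proof -
  interpret T: psd_form "H1 \<Omega>" "Tr_inner \<Omega> \<mu> a" by (rule psd_form_Tr)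
  interpret L: psd_form "H1 \<Omega>" "L2_inner \<Omega>" by (rule psd_form_H1_L2)
  show "spectral_pair (H1 \<Omega>) (Tr_inner \<Omega> \<mu> a) (L2_inner \<Omega>)"
    by unfold_locales (rule Tr_null_iff Tr_complete Tr_compact ex_orthonormal_family; (assumption | rule ne)?)+
qed

lemma Tr_expansion:
  assumes f: "f \<in> H1 \<Omega>"
  defines "h \<equiv> \<lambda>n x. f x - (\<Sum>i<n. L2_inner \<Omega> f (spectral.ev i) * spectral.ev i x)"
  shows "h n \<in> H1 \<Omega>"
    and "(\<lambda>n. Tr_inner \<Omega> \<mu> a (h n) (h n)) \<longlonglongrightarrow> 0" and "(\<lambda>n. L2_inner \<Omega> (h n) (h n)) \<longlonglongrightarrow> 0"
proof -
  have h: "h n \<in> H1 \<Omega>" for n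
    unfolding h_def by (rule grad.diff_mem[OF f grad.sum_mem[OF spectral.ev_props(1)]])
  then show "h n \<in> H1 \<Omega>" .
  have z: "(\<lambda>x. h n x - 0) = h n" for n by simp
  have lim: "(\<lambda>n. Tr_inner \<Omega> \<mu> a (\<lambda>x. h n x - 0) (\<lambda>x. h n x - 0) + L2_inner \<Omega> (\<lambda>x. h n x - 0) (\<lambda>x. h n x - 0)) \<longlonglongrightarrow> 0"
    unfolding z unfolding h_def by (rule spectral.ev_expansion[OF f])
  show "(\<lambda>n. Tr_inner \<Omega> \<mu> a (h n) (h n)) \<longlonglongrightarrow> 0"
    using spectral.tendsto_parts(1)[OF h grad.zero_mem lim] unfolding z .
  show "(\<lambda>n. L2_inner \<Omega> (h n) (h n)) \<longlonglongrightarrow> 0"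
    using spectral.tendsto_parts(2)[OF h grad.zero_mem lim] unfolding z .
qed

text \<open>By Bessel the residuals converge to some \<open>g\<close> orthogonal to all
  eigenfunctions. Since every element of \<open>H1 \<Omega>\<close> is a limit of eigenfunction
  sums, \<open>g\<close> is orthogonal to \<open>H1 \<Omega>\<close>, in particular to all test
  functions, and vanishes by the fundamental lemma.\<close>

lemma L2_expansion:
  assumes f: "f \<in> L2 \<Omega>"
  defines "h \<equiv> \<lambda>n x. f x - (\<Sum>i<n. L2_inner \<Omega> f (spectral.ev i) * spectral.ev i x)"
  shows "(\<lambda>n. L2_inner \<Omega> (h n) (h n)) \<longlonglongrightarrow> 0"
proof -
  have evL: "spectral.ev i \<in> L2 \<Omega>" for i by (rule H1D(1)[OF spectral.ev_props(1)])
  have hn: "h n = (\<lambda>x. f x - (\<Sum>i<n. L2_inner \<Omega> f (spectral.ev i) * spectral.ev i x))" for n by (simp add: h_def)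
  note pe = L2.projection_error[of spectral.ev f, OF evL spectral.ev_orthonormal f, folded hn]
  have pd: "L2_inner \<Omega> (\<lambda>x. h m x - h n x) (\<lambda>x. h m x - h n x) = L2_inner \<Omega> (h m) (h m) - L2_inner \<Omega> (h n) (h n)"
    if "m \<le> n" for m n
    unfolding hn by (rule L2.projection_residual_diff[OF evL spectral.ev_orthonormal f that])
  have "decseq (\<lambda>n. L2_inner \<Omega> (h n) (h n))"
    unfolding decseq_def
  proof (intro allI impI)
    fix m n :: nat assume "m \<le> n"
    then show "L2_inner \<Omega> (h n) (h n) \<le> L2_inner \<Omega> (h m) (h m)"
      using pd[of m n] L2.nonneg[OF L2.diff_mem[OF pe(1)[of m] pe(1)[of n]]] by linarith
  qed
  then have "convergent (\<lambda>n. L2_inner \<Omega> (h n) (h n))"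
    using L2.nonneg[OF pe(1)] by (intro Bseq_monoseq_convergent decseq_imp_monoseq decseq_bounded) auto
  then have C: "Cauchy (\<lambda>n. L2_inner \<Omega> (h n) (h n))" by (rule convergent_Cauchy)
  have "\<exists>K. \<forall>m\<ge>K. \<forall>n\<ge>K. L2_inner \<Omega> (\<lambda>x. h m x - h n x) (\<lambda>x. h m x - h n x) < e" if e: "e > 0" for e
  proof -
    obtain K where K: "\<And>m n. m \<ge> K \<Longrightarrow> n \<ge> K \<Longrightarrow> \<bar>L2_inner \<Omega> (h m) (h m) - L2_inner \<Omega> (h n) (h n)\<bar> < e"
      using C e unfolding Cauchy_def dist_real_def by meson
    have "L2_inner \<Omega> (\<lambda>x. h m x - h n x) (\<lambda>x. h m x - h n x) < e" if "m \<ge> K" "n \<ge> K" for m n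
    proof (cases "m \<le> n")
      case True
      then show ?thesis using pd[OF True] K[OF that] by linarith
    next
      case False
      have "L2_inner \<Omega> (\<lambda>x. h m x - h n x) (\<lambda>x. h m x - h n x) = L2_inner \<Omega> (\<lambda>x. h n x - h m x) (\<lambda>x. h n x - h m x)"
        by (simp add: L2_inner_self power2_commute)
      then show ?thesis using pd[of n m] K[OF that] False by linarith
    qed
    then show ?thesis by blast
  qed
  from L2_complete[OF bs pe(1) this] obtain g where g: "g \<in> L2 \<Omega>"
    and lim: "(\<lambda>n. L2_inner \<Omega> (\<lambda>x. h n x - g x) (\<lambda>x. h n x - g x)) \<longlonglongrightarrow> 0" by blast
  have gw: "L2_inner \<Omega> g (spectral.ev j) = 0" for j
  proof -
    have "(\<lambda>n. L2_inner \<Omega> (h n) (spectral.ev j)) \<longlonglongrightarrow> L2_inner \<Omega> g (spectral.ev j)"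
      by (rule L2.tendsto_left[OF pe(1) g evL lim])
    moreover have "(\<lambda>n. L2_inner \<Omega> (h n) (spectral.ev j)) \<longlonglongrightarrow> 0"
      by (rule tendsto_eventually) (use pe(3) in \<open>auto simp: eventually_sequentially intro!: exI[of _ "Suc j"]\<close>)
    ultimately show ?thesis by (rule LIMSEQ_unique)
  qed
  have gv: "L2_inner \<Omega> g v = 0" if v: "v \<in> H1 \<Omega>" for v
  proof -
    define k where "k n = (\<lambda>x. v x - (\<Sum>i<n. L2_inner \<Omega> v (spectral.ev i) * spectral.ev i x))" for n
    note ke = Tr_expansion[OF v, folded k_def]
    have sL: "(\<lambda>x. \<Sum>i<n. L2_inner \<Omega> v (spectral.ev i) * spectral.ev i x) \<in> L2 \<Omega>" for n
      by (intro L2.sum_mem evL)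
    have "L2_inner \<Omega> (k n) g = L2_inner \<Omega> v g" for n
    proof -
      have "L2_inner \<Omega> (\<lambda>x. \<Sum>i<n. L2_inner \<Omega> v (spectral.ev i) * spectral.ev i x) g
        = (\<Sum>i<n. L2_inner \<Omega> v (spectral.ev i) * L2_inner \<Omega> (spectral.ev i) g)"
        by (rule L2.sum_left[OF evL g])
      also have "\<dots> = 0" using gw L2.sym[OF g evL] by (intro sum.neutral) auto
      finally show ?thesis unfolding k_def using L2.diff_left[OF H1D(1)[OF v] sL g] by simp
    qed
    then have le: "(L2_inner \<Omega> v g)\<^sup>2 \<le> L2_inner \<Omega> (k n) (k n) * L2_inner \<Omega> g g" for n
      using L2.cauchy_schwarz[OF H1D(1)[OF ke(1)] g] by metis
    have "(L2_inner \<Omega> v g)\<^sup>2 \<le> 0"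
      using LIMSEQ_le_const[OF tendsto_mult_left_zero[OF ke(3)], of "(L2_inner \<Omega> v g)\<^sup>2" "L2_inner \<Omega> g g"] le by blast
    then show ?thesis using L2.sym[OF g H1D(1)[OF v]] by simp
  qed
  have "AE x in lebesgue_on \<Omega>. g x = 0"
    by (rule fundamental_lemma[OF open_dom L2_integrable[OF bs g]])
      (use gv[OF test_function_H1] in \<open>simp add: L2_inner_def\<close>)
  then have "L2_inner \<Omega> g g = 0" using L2_inner_zero_iff[OF g] by simp
  then show ?thesis using L2.tendsto_quadratic[OF pe(1) g lim] by simp
qed

lemma not_AE_zero_iff: "u \<in> H1 \<Omega> \<Longrightarrow> \<not> (AE x in lebesgue_on \<Omega>. u x = 0) \<longleftrightarrow> L2_inner \<Omega> u u \<noteq> 0"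
  using L2_inner_zero_iff[OF H1D(1)] by blast

lemma eigenvalue_range: "{l. eigenvalue \<Omega> \<mu> a l} = range spectral.lam"
proof -
  have "eigenvalue \<Omega> \<mu> a l \<longleftrightarrow> (\<exists>u\<in>H1 \<Omega>. (\<forall>v\<in>H1 \<Omega>. Tr_inner \<Omega> \<mu> a u v = l * L2_inner \<Omega> u v) \<and> L2_inner \<Omega> u u \<noteq> 0)" for l
    unfolding eigenvalue_def eigenfunction_def eigenspace_def using not_AE_zero_iff by blast
  then show ?thesis unfolding spectral.eigenvalue_iff by blast
qed

lemma ev_eigenspace: "spectral.ev j \<in> eigenspace \<Omega> \<mu> a (spectral.lam j)"
  unfolding eigenspace_def using spectral.ev_props(1) spectral.ev_eigen by blast

text \<open>The eigenfunctions whose eigenvalue is \<open>l\<close> form the basis: orthonormality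
  gives independence, and \<open>eigenvector_expansion\<close> gives spanning up to null
  functions.\<close>

lemma multiplicity: "has_multiplicity \<Omega> \<mu> a l (card {j. spectral.lam j = l})"
proof -
  let ?J = "{j. spectral.lam j = l}" and ?m = "card {j. spectral.lam j = l}"
  have evL: "spectral.ev i \<in> L2 \<Omega>" for i by (rule H1D(1)[OF spectral.ev_props(1)])
  obtain e where e0: "bij_betw e {0..<?m} ?J" using ex_bij_betw_nat_finite[OF spectral.finite_lam] by blast
  then have e: "bij_betw e {..<?m} ?J" by (simp add: lessThan_atLeast0)
  have "spectral.ev (e i) \<in> eigenspace \<Omega> \<mu> a l" if "i < ?m" for i
    using ev_eigenspace[of "e i"] bij_betwE[OF e] that by auto
  moreover have "c i = 0" if ae: "AE x in lebesgue_on \<Omega>. (\<Sum>i<?m. c i * spectral.ev (e i) x) = 0" and i: "i < ?m" for c i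
  proof -
    let ?s = "\<lambda>x. \<Sum>i<?m. c i * spectral.ev (e i) x"
    have s: "?s \<in> L2 \<Omega>" by (intro L2.sum_mem evL)
    have "L2_inner \<Omega> ?s ?s = 0" using L2_inner_zero_iff[OF s] ae by blast
    then have "0 = L2_inner \<Omega> ?s (spectral.ev (e i))" using L2.null_left[OF s evL] by simp
    also have "\<dots> = (\<Sum>k<?m. c k * L2_inner \<Omega> (spectral.ev (e k)) (spectral.ev (e i)))"
      by (rule L2.sum_left[OF evL evL])
    also have "\<dots> = (\<Sum>k<?m. if k = i then c i else 0)"
    proof (intro sum.cong refl)
      fix k assume "k \<in> {..<?m}"
      then have "e k = e i \<longleftrightarrow> k = i" using bij_betw_imp_inj_on[OF e] i by (auto simp: inj_on_def)
      then show "c k * L2_inner \<Omega> (spectral.ev (e k)) (spectral.ev (e i)) = (if k = i then c i else 0)"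
        by (simp add: spectral.ev_orthonormal)
    qed
    also have "\<dots> = c i" using i by simp
    finally show ?thesis by simp
  qed
  moreover have "\<exists>c :: nat \<Rightarrow> real. AE x in lebesgue_on \<Omega>. u x = (\<Sum>i<?m. c i * spectral.ev (e i) x)"
    if u: "u \<in> eigenspace \<Omega> \<mu> a l" for u
  proof -
    have uH: "u \<in> H1 \<Omega>" and ue: "\<forall>v\<in>H1 \<Omega>. Tr_inner \<Omega> \<mu> a u v = l * L2_inner \<Omega> u v"
      using u by (auto simp: eigenspace_def)
    let ?r = "\<lambda>x. u x - (\<Sum>i<?m. L2_inner \<Omega> u (spectral.ev (e i)) * spectral.ev (e i) x)"
    have r: "?r \<in> L2 \<Omega>" by (intro L2.diff_mem H1D(1)[OF uH] L2.sum_mem evL)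
    have "L2_inner \<Omega> ?r ?r = 0" by (rule spectral.eigenvector_expansion[OF uH ue e])
    then have "AE x in lebesgue_on \<Omega>. ?r x = 0" using L2_inner_zero_iff[OF r] by simp
    then show ?thesis by (intro exI[of _ "\<lambda>i. L2_inner \<Omega> u (spectral.ev (e i))"]) simp
  qed
  ultimately show ?thesis unfolding has_multiplicity_def by (intro exI[of _ "\<lambda>i. spectral.ev (e i)"]) blast
qed

lemma eigenbasis_L2: "orthonormal_basis (L2 \<Omega>) (L2_inner \<Omega>) spectral.ev"
proof -
  have "\<exists>c :: nat \<Rightarrow> real. (\<lambda>N. let h = (\<lambda>x. f x - (\<Sum>i<N. c i * spectral.ev i x)) in sqrt (L2_inner \<Omega> h h)) \<longlonglongrightarrow> 0"
    if "f \<in> L2 \<Omega>" for f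
    using tendsto_real_sqrt[OF L2_expansion[OF that]]
    by (intro exI[of _ "\<lambda>i. L2_inner \<Omega> f (spectral.ev i)"]) (simp add: Let_def)
  then show ?thesis
    unfolding orthonormal_basis_def orthogonal_basis_def
    using H1D(1)[OF spectral.ev_props(1)] by (auto simp: spectral.ev_orthonormal)
qed

lemma eigenbasis_H1: "orthogonal_basis (H1 \<Omega>) (Tr_inner \<Omega> \<mu> a) spectral.ev"
proof -
  have "\<exists>c :: nat \<Rightarrow> real. (\<lambda>N. let h = (\<lambda>x. f x - (\<Sum>i<N. c i * spectral.ev i x)) in sqrt (Tr_inner \<Omega> \<mu> a h h)) \<longlonglongrightarrow> 0"
    if "f \<in> H1 \<Omega>" for f
    using tendsto_real_sqrt[OF Tr_expansion(2)[OF that]]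
    by (intro exI[of _ "\<lambda>i. L2_inner \<Omega> f (spectral.ev i)"]) (simp add: Let_def)
  moreover have "Tr_inner \<Omega> \<mu> a (spectral.ev j) (spectral.ev j) > 0" for j
    using spectral.lam_pos[of j] by (simp add: spectral.lam_def)
  ultimately show ?thesis
    unfolding orthogonal_basis_def using spectral.ev_props(1) spectral.ev_A_orthogonal by auto
qed

end

section \<open>Constants extracted from the geometric hypotheses\<close>

lemma n_set_closure_density:
  fixes \<Omega> :: "'a::euclidean_space set"
  assumes "n_set \<Omega>" "open \<Omega>" "bounded \<Omega>"
  obtains c0 where "c0 > 0" "\<And>x r. x \<in> closure \<Omega> \<Longrightarrow> 0 < r \<Longrightarrow> r \<le> 1 \<Longrightarrow> c0 * r ^ DIM('a) \<le> measure lebesgue (\<Omega> \<inter> ball x r)"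
proof -
  obtain c where c: "c > 0" and d: "\<And>x r. x \<in> \<Omega> \<Longrightarrow> 0 < r \<Longrightarrow> r \<le> 1 \<Longrightarrow> ennreal (c * r ^ DIM('a)) \<le> emeasure lebesgue (ball x r \<inter> \<Omega>)"
    using assms(1) unfolding n_set_def by blast
  have lm: "\<Omega> \<inter> ball x r \<in> lmeasurable" for x r
    using assms(2,3) by (intro bounded_set_imp_lmeasurable) auto
  have "c / 2 ^ DIM('a) * r ^ DIM('a) \<le> measure lebesgue (\<Omega> \<inter> ball x r)"
    if x: "x \<in> closure \<Omega>" and r: "0 < r" "r \<le> 1" for x r
  proof -
    \<comment> \<open>Around a point of \<open>\<Omega>\<close> within \<open>r / 2\<close> the ball
      of half the radius fits into the given ball; the halving costs the factor
      \<open>2 ^ DIM('a)\<close>.\<close>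
    obtain y where y: "y \<in> \<Omega>" "dist y x < r / 2" using x r closure_approachable[of x \<Omega>] half_gt_zero by blast
    have "ennreal (c * (r / 2) ^ DIM('a)) \<le> emeasure lebesgue (ball y (r / 2) \<inter> \<Omega>)" using d[OF y(1), of "r / 2"] r by simp
    also have "\<dots> \<le> emeasure lebesgue (\<Omega> \<inter> ball x r)"
    proof (rule emeasure_mono)
      show "ball y (r / 2) \<inter> \<Omega> \<subseteq> \<Omega> \<inter> ball x r"
      proof
        fix z assume "z \<in> ball y (r / 2) \<inter> \<Omega>"
        then show "z \<in> \<Omega> \<inter> ball x r" using y(2) dist_triangle[of x z y] by (auto simp: dist_commute)
      qed
    qed (use lm in blast)
    also have "\<dots> = ennreal (measure lebesgue (\<Omega> \<inter> ball x r))" by (rule emeasure_eq_measure2[OF lm])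
    finally show ?thesis by (simp add: power_divide)
  qed
  then show ?thesis using that[of "c / 2 ^ DIM('a)"] c by simp
qed

text \<open>The L-condition with \<kappa> = 1/r compares radius \<open>r\<close> with radius 1,
  where the normalization condition bounds the measure.\<close>

lemma ball_measure_upper_bound:
  fixes \<mu> :: "'a::euclidean_space measure"
  assumes "L_condition d \<mu>" "normalization_condition \<mu>"
  obtains C where "C \<ge> 0" "\<And>x r. x \<in> measure_support \<mu> \<Longrightarrow> 0 < r \<Longrightarrow> r \<le> 1 \<Longrightarrow> emeasure \<mu> (ball x r) \<le> ennreal (C * r powr d)"
proof -
  obtain c where c: "c > 0" and L: "\<And>x r \<kappa>. x \<in> measure_support \<mu> \<Longrightarrow> r > 0 \<Longrightarrow> \<kappa> \<ge> 1 \<Longrightarrow> \<kappa> * r \<le> 1 \<Longrightarrow>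
     ennreal (c * \<kappa> powr d) * emeasure \<mu> (ball x r) \<le> emeasure \<mu> (ball x (\<kappa> * r))"
    using assms(1) unfolding L_condition_def by blast
  obtain c2 where c2: "c2 > 0" "\<And>x. x \<in> measure_support \<mu> \<Longrightarrow> emeasure \<mu> (ball x 1) \<le> ennreal c2"
    using assms(2) unfolding normalization_condition_def by blast
  have "emeasure \<mu> (ball x r) \<le> ennreal (c2 / c * r powr d)"
    if x: "x \<in> measure_support \<mu>" and r: "0 < r" "r \<le> 1" for x r
  proof -
    define A where "A = c * (1 / r) powr d"
    have A: "A > 0" using c r by (simp add: A_def)
    have le: "ennreal A * emeasure \<mu> (ball x r) \<le> ennreal c2"
      unfolding A_def using order_trans[OF L[OF x r(1), of "1 / r"]] c2(2)[OF x] r by simp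
    have "emeasure \<mu> (ball x r) = ennreal (1 / A) * (ennreal A * emeasure \<mu> (ball x r))"
      using A by (simp add: mult.assoc[symmetric] ennreal_mult[symmetric])
    also have "\<dots> \<le> ennreal (1 / A) * ennreal c2" using le by (rule mult_left_mono) simp
    also have "\<dots> = ennreal (1 / A * c2)" using A c2(1) by (simp add: ennreal_mult[symmetric])
    also have "1 / A * c2 = c2 / c * r powr d" using c r by (simp add: A_def powr_divide)
    finally show ?thesis .
  qed
  then show ?thesis using that[of "c2 / c"] c c2 by simp
qed

text \<open>The complement is the union of all open null sets; by Lindelof countably many of them
  suffice.\<close>

lemma null_outside_support:
  fixes \<mu> :: "'a::euclidean_space measure"
  assumes "sets \<mu> = sets borel"
  shows "emeasure \<mu> (- measure_support \<mu>) = 0"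
proof -
  let ?F = "{U. open U \<and> emeasure \<mu> U = 0}"
  obtain F where F: "F \<subseteq> ?F" "countable F" "\<Union>F = \<Union>?F"
    using Lindelof[of ?F] by blast
  have "- measure_support \<mu> = \<Union>F"
    unfolding F(3) measure_support_def by (auto simp: zero_less_iff_neq_zero)
  moreover have "\<Union>F \<in> null_sets \<mu>"
    using F(1) assms by (intro null_sets_UN'[OF F(2), of "\<lambda>x. x", simplified]) (auto intro!: null_setsI)
  ultimately show ?thesis by (simp add: null_setsD1)
qed

theorem theorem13:
  fixes \<Omega> :: "'a::euclidean_space set" and \<mu> :: "'a measure" and a :: real
  assumes "bounded \<Omega>"
    and "H1_Sobolev_admissible \<Omega>"
    and "admissible_boundary_measure \<Omega> \<mu>"
    and "a > 0"
  shows "\<exists>(lam :: nat \<Rightarrow> real) (w :: nat \<Rightarrow> 'a \<Rightarrow> real).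
      {l. eigenvalue \<Omega> \<mu> a l} = range lam
    \<and> (\<forall>l. eigenvalue \<Omega> \<mu> a l \<longrightarrow>
          finite {j. lam j = l} \<and> has_multiplicity \<Omega> \<mu> a l (card {j. lam j = l}))
    \<and> (\<forall>j. 0 < lam j)
    \<and> mono lam
    \<and> filterlim lam at_top sequentially
    \<and> (\<forall>j. eigenfunction \<Omega> \<mu> a (lam j) (w j))
    \<and> orthonormal_basis (L2 \<Omega>) (L2_inner \<Omega>) w
    \<and> orthogonal_basis (H1 \<Omega>) (Tr_inner \<Omega> \<mu> a) w"
proof -
  have dom: "open \<Omega>" "connected \<Omega>" "\<Omega> \<noteq> {}" and nset: "n_set \<Omega>" and eq: "H1 \<Omega> = C12 \<Omega>"
    using assms(2) by (auto simp: H1_Sobolev_admissible_def domain_def)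
  obtain C where C: "C > 0" "\<And>u. u \<in> H1 \<Omega> \<Longrightarrow> C12_norm \<Omega> u \<le> C * H1_norm \<Omega> u"
    using assms(2) unfolding H1_Sobolev_admissible_def by blast
  obtain c0 where c0: "c0 > 0" "\<And>x r. x \<in> closure \<Omega> \<Longrightarrow> 0 < r \<Longrightarrow> r \<le> 1 \<Longrightarrow> c0 * r ^ DIM('a) \<le> measure lebesgue (\<Omega> \<inter> ball x r)"
    using n_set_closure_density[OF nset dom(1) assms(1)] by blast
  have sets: "sets \<mu> = sets borel" and supp: "measure_support \<mu> = frontier \<Omega>" and norm: "normalization_condition \<mu>"
    using assms(3) by (auto simp: admissible_boundary_measure_def)
  \<comment> \<open>The lower bound for \<open>d\<close> restates (n - d)/2 < 1.\<close>
  obtain d where d: "d \<ge> 0" "d > real DIM('a) - 2" "L_condition d \<mu>"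
    using assms(3) unfolding admissible_boundary_measure_def by fastforce
  obtain Cm where Cm: "Cm \<ge> 0" "\<And>x r. x \<in> measure_support \<mu> \<Longrightarrow> 0 < r \<Longrightarrow> r \<le> 1 \<Longrightarrow> emeasure \<mu> (ball x r) \<le> ennreal (Cm * r powr d)"
    using ball_measure_upper_bound[OF d(3) norm] by blast
  interpret n_set_domain \<Omega> c0
    by unfold_locales (use assms(1) dom(1) c0 in auto)
  have E: "sharp_energy u \<le> C\<^sup>2 * (L2_inner \<Omega> u u + grad_inner \<Omega> u u)" if u: "u \<in> H1 \<Omega>" for u
  proof -
    have pos: "0 \<le> L2_inner \<Omega> u u + grad_inner \<Omega> u u"
      using L2.nonneg[OF H1D(1)[OF u]] grad.nonneg[OF u] by simp
    \<comment> \<open>This root is one of the two nonnegative summands of the norm, so equivalence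
      of the norms bounds the sharp energy with constant \<open>CE\<close> equal to the square of
      \<open>C\<close>.\<close>
    have "sqrt (sharp_energy u) \<le> C12_norm \<Omega> u"
      using L2.nonneg[OF H1D(1)[OF u]] by (simp add: C12_norm_def L2_norm_def sharp_energy_def)
    also have "\<dots> \<le> C * sqrt (L2_inner \<Omega> u u + grad_inner \<Omega> u u)" using C(2)[OF u] by (simp add: H1_norm_def)
    finally have "(sqrt (sharp_energy u))\<^sup>2 \<le> (C * sqrt (L2_inner \<Omega> u u + grad_inner \<Omega> u u))\<^sup>2"
      by (intro power_mono) (auto simp: sharp_energy_def)
    then show ?thesis using pos by (simp add: power_mult_distrib sharp_energy_def)
  qed
  interpret trace_problem \<Omega> c0 \<mu> d Cm a "C\<^sup>2"
  proof
    show "0 < emeasure \<mu> (ball x r)" if "x \<in> frontier \<Omega>" "0 < r" for x r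
      using that supp unfolding measure_support_def by (metis (mono_tags, lifting) centre_in_ball mem_Collect_eq open_ball)
    show "emeasure \<mu> (- frontier \<Omega>) = 0" using null_outside_support[OF sets] supp by simp
  qed (use sets d Cm dom assms(4) eq E supp in auto)
  have "eigenfunction \<Omega> \<mu> a (spectral.lam j) (spectral.ev j)" for j
    unfolding eigenfunction_def
    using ev_eigenspace not_AE_zero_iff[OF spectral.ev_props(1)] spectral.ev_orthonormal[of j j] by simp
  then show ?thesis
    using eigenvalue_range spectral.finite_lam multiplicity spectral.lam_pos spectral.lam_mono
      spectral.lam_at_top eigenbasis_L2 eigenbasis_H1
    by (intro exI[of _ spectral.lam] exI[of _ spectral.ev] conjI allI impI)
qed

end
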